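(* Let $n,m\ge1$ and let $\mathcal L$ be a positive definite linear functional on $\prod^{n,m}$, with $\phi^m_{n,m}$ and $\mathcal K_{n,m}$ as defined in the context. (i) If $\mathcal K_{n,m}=0$, then $\overleftarrow\phi^m_{n,m}(z,w)$ is stable and $$\mathcal L(e^{-ik\theta}e^{-il\phi})=\Big(\frac1{2\pi}\Big)^2\int_{\mathbb{T}^2}\frac{e^{-ik\theta}e^{-il\phi}}{|\phi^m_{n,m}(e^{i\theta},e^{i\phi})|^2}\,d\theta\,d\phi,\qquad |k|\le n,\ |l|\le m.$$ (ii) Conversely, if $\pi_{n,m}(z,w)$ is a polynomial of degree $(n,m)$ such that $\overleftarrow\pi_{n,m}$ is stable and $$\mathcal L(e^{-ik\theta}e^{-il\phi})=\Big(\frac1{2\pi}\Big)^2\int_{\mathbb{T}^2}\frac{e^{-ik\theta}e^{-il\phi}}{|\pi_{n,m}(e^{i\theta},e^{i\phi})|^2}\,d\theta\,d\phi,\qquad |k|\le n,\ |l|\le m,$$ then $\mathcal K_{n,m}=0$.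
   Context: $\prod^{n,m}=\mathrm{span}\{z^iw^j:|i|\le n,|j|\le m\}$, $\hat\prod^{n,m}=\mathrm{span}\{z^iw^j:0\le i\le n,0\le j\le m\}$; $z=e^{i\theta}$, $w=e^{i\phi}$. For a (matrix valued) Laurent polynomial $Q$, $Q^\dagger(z,w)=Q(1/\bar z,1/\bar w)^\dagger$. A linear functional $\mathcal L$ on $\prod^{n,m}$ with $\mathcal L(z^{-i}w^{-j})=\overline{\mathcal L(z^iw^j)}$ is positive definite if $\mathcal L(pp^\dagger)>0$ for all nonzero $p\in\hat\prod^{n,m}$. It is applied entrywise to matrices, and $\langle X,Y\rangle=\mathcal L(XY^\dagger)$. Lexicographic orthonormal polynomials: for $0\le l\le m$, $\phi^l_{n,m}$ is the unique element of $\mathrm{span}(\{z^iw^j:0\le i<n,0\le j\le m\}\cup\{z^nw^j:0\le j\le l\})$ with positive coefficient of $z^nw^l$, $\langle\phi^l_{n,m},\phi^l_{n,m}\rangle=1$, orthogonal to all of these monomials except $z^nw^l$. $\Phi_{n,m}=[\phi^m_{n,m},\dots,\phi^0_{n,m}]^T$. Reverse lexicographic: for $0\le l\le n$, $\tilde\phi^l_{n,m}$ is the unique element of $\mathrm{span}(\{z^iw^j:0\le i\le n,0\le j<m\}\cup\{z^iw^m:0\le i\le l\})$ with positive coefficient of $z^lw^m$, norm one, orthogonal to all of these monomials except $z^lw^m$; $\tilde\Phi_{n,m}=[\tilde\phi^n_{n,m},\dots,\tilde\phi^0_{n,m}]^T$. These are defined with $(n,m)$ replaced by any smaller pair of indices.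 $\mathcal K_{n,m}=\langle\Phi_{n,m-1},\tilde\Phi_{n-1,m}\rangle$, an $m\times n$ matrix. A polynomial $p$ has degree $(n,m)$ if $p\in\hat\prod^{n,m}$ and its coefficient of $z^nw^m$ is nonzero; then $\overleftarrow p(z,w)=z^nw^m\,\overline{p(1/\bar z,1/\bar w)}$. A polynomial $p$ is stable if $p(z,w)\ne0$ for $|z|\le1$, $|w|\le1$. *)

theory Defs
  imports "HOL-Analysis.Analysis" "HOL-Library.Poly_Mapping" "HOL-Library.Product_Plus"
    "Jordan_Normal_Form.Matrix"
begin

text \<open>A Laurent polynomial in \<open>z, w\<close> is its finitely supported coefficient family; the
  exponents form the additive group \<open>\<int> \<times> \<int>\<close>, so the library's convolution product is the
  product of Laurent polynomials.\<close>

type_synonym laurent = "(int \<times> int) \<Rightarrow>\<^sub>0 complex"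

definition lmono :: "int \<Rightarrow> int \<Rightarrow> laurent" where
  "lmono i j = Poly_Mapping.single (i, j) 1"

definition lscale :: "complex \<Rightarrow> laurent \<Rightarrow> laurent" where
  "lscale c p = Poly_Mapping.single 0 c * p"

global_interpretation laurent: vector_space lscale
  by unfold_locales
    (simp_all add: lscale_def ring_distribs single_add mult_single mult.assoc[symmetric])

definition mono_span :: "(int \<times> int) set \<Rightarrow> laurent set" where
  "mono_span S = laurent.span ((\<lambda>(i, j). lmono i j) ` S)"

definition laurent_space :: "nat \<Rightarrow> nat \<Rightarrow> laurent set" where
  "laurent_space n m = mono_span {(i, j). \<bar>i\<bar> \<le> int n \<and> \<bar>j\<bar> \<le> int m}"

definition poly_space :: "nat \<Rightarrow> nat \<Rightarrow> laurent set" where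
  "poly_space n m = mono_span {(i, j). 0 \<le> i \<and> i \<le> int n \<and> 0 \<le> j \<and> j \<le> int m}"

text \<open>Since \<open>0 powi k = 0\<close> for negative \<open>k\<close>, the value at a point with \<open>z = 0\<close> or \<open>w = 0\<close>
  is meaningful only for polynomials, i.e. for nonnegative exponents.\<close>

definition leval :: "laurent \<Rightarrow> complex \<Rightarrow> complex \<Rightarrow> complex" where
  "leval p z w =
    (\<Sum>(i, j)\<in>Poly_Mapping.keys p. Poly_Mapping.lookup p (i, j) * z powi i * w powi j)"

text \<open>\<open>Q\<^sup>\<dagger>(z, w) = Q(1/z\<^sup>*, 1/w\<^sup>*)\<^sup>*\<close>, written in coefficients; see \<open>leval_dagger\<close>.\<close>

definition dagger :: "laurent \<Rightarrow> laurent" where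
  "dagger p = (\<Sum>(i, j)\<in>Poly_Mapping.keys p.
     Poly_Mapping.single (- i, - j) (cnj (Poly_Mapping.lookup p (i, j))))"

definition dagger_mat :: "laurent mat \<Rightarrow> laurent mat" where
  "dagger_mat X = transpose_mat (map_mat dagger X)"

text \<open>A functional on \<open>laurent_space n m\<close> is represented by a total function of which only the
  restriction to that space matters.\<close>

definition linear_functional :: "nat \<Rightarrow> nat \<Rightarrow> (laurent \<Rightarrow> complex) \<Rightarrow> bool" where
  "linear_functional n m L \<longleftrightarrow>
    (\<forall>p\<in>laurent_space n m. \<forall>q\<in>laurent_space n m. L (p + q) = L p + L q) \<and>
    (\<forall>c. \<forall>p\<in>laurent_space n m. L (lscale c p) = c * L p)"

definition pos_real :: "complex \<Rightarrow> bool" where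
  "pos_real c \<longleftrightarrow> c \<in> \<real> \<and> 0 < Re c"

definition positive_definite :: "nat \<Rightarrow> nat \<Rightarrow> (laurent \<Rightarrow> complex) \<Rightarrow> bool" where
  "positive_definite n m L \<longleftrightarrow>
    linear_functional n m L \<and>
    (\<forall>i j. \<bar>i\<bar> \<le> int n \<and> \<bar>j\<bar> \<le> int m \<longrightarrow> L (lmono (- i) (- j)) = cnj (L (lmono i j))) \<and>
    (\<forall>p\<in>poly_space n m. p \<noteq> 0 \<longrightarrow> pos_real (L (p * dagger p)))"

definition inner_mat :: "(laurent \<Rightarrow> complex) \<Rightarrow> laurent mat \<Rightarrow> laurent mat \<Rightarrow> complex mat" where
  "inner_mat L X Y = map_mat L (X * dagger_mat Y)"

definition linner :: "(laurent \<Rightarrow> complex) \<Rightarrow> laurent \<Rightarrow> laurent \<Rightarrow> complex" where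
  "linner L p q = L (p * dagger q)"

definition orthonormal_at ::
  "(laurent \<Rightarrow> complex) \<Rightarrow> (int \<times> int) set \<Rightarrow> int \<times> int \<Rightarrow> laurent \<Rightarrow> bool" where
  "orthonormal_at L S e p \<longleftrightarrow>
    p \<in> mono_span S \<and> pos_real (Poly_Mapping.lookup p e) \<and> linner L p p = 1 \<and>
    (\<forall>(i, j)\<in>S - {e}. linner L p (lmono i j) = 0)"

definition lex_set :: "nat \<Rightarrow> nat \<Rightarrow> nat \<Rightarrow> (int \<times> int) set" where
  "lex_set n m l = {(i, j). 0 \<le> i \<and> i < int n \<and> 0 \<le> j \<and> j \<le> int m}
     \<union> {(i, j). i = int n \<and> 0 \<le> j \<and> j \<le> int l}"

definition revlex_set :: "nat \<Rightarrow> nat \<Rightarrow> nat \<Rightarrow> (int \<times> int) set" where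
  "revlex_set n m l = {(i, j). 0 \<le> i \<and> i \<le> int n \<and> 0 \<le> j \<and> j < int m}
     \<union> {(i, j). 0 \<le> i \<and> i \<le> int l \<and> j = int m}"

definition phi :: "(laurent \<Rightarrow> complex) \<Rightarrow> nat \<Rightarrow> nat \<Rightarrow> nat \<Rightarrow> laurent" where
  "phi L n m l = (THE p. orthonormal_at L (lex_set n m l) (int n, int l) p)"

definition phi_tilde :: "(laurent \<Rightarrow> complex) \<Rightarrow> nat \<Rightarrow> nat \<Rightarrow> nat \<Rightarrow> laurent" where
  "phi_tilde L n m l = (THE p. orthonormal_at L (revlex_set n m l) (int l, int m) p)"

text \<open>The columns \<open>[\<phi>\<^sup>m, \<dots>, \<phi>\<^sup>0]\<^sup>T\<close> and \<open>[\<phi>'\<^sup>n, \<dots>, \<phi>'\<^sup>0]\<^sup>T\<close>, in decreasing order of the upper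
  index.\<close>

definition Phi :: "(laurent \<Rightarrow> complex) \<Rightarrow> nat \<Rightarrow> nat \<Rightarrow> laurent mat" where
  "Phi L n m = Matrix.mat (m + 1) 1 (\<lambda>(r, _). phi L n m (m - r))"

definition Phi_tilde :: "(laurent \<Rightarrow> complex) \<Rightarrow> nat \<Rightarrow> nat \<Rightarrow> laurent mat" where
  "Phi_tilde L n m = Matrix.mat (n + 1) 1 (\<lambda>(r, _). phi_tilde L n m (n - r))"

definition Kmat :: "(laurent \<Rightarrow> complex) \<Rightarrow> nat \<Rightarrow> nat \<Rightarrow> complex mat" where
  "Kmat L n m = inner_mat L (Phi L n (m - 1)) (Phi_tilde L (n - 1) m)"

definition has_degree :: "laurent \<Rightarrow> nat \<Rightarrow> nat \<Rightarrow> bool" where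
  "has_degree p n m \<longleftrightarrow> p \<in> poly_space n m \<and> Poly_Mapping.lookup p (int n, int m) \<noteq> 0"

text \<open>\<open>z\<^sup>n w\<^sup>m p(1/z\<^sup>*, 1/w\<^sup>*)\<^sup>*\<close>; see \<open>leval_reversed\<close>.\<close>

definition reversed :: "nat \<Rightarrow> nat \<Rightarrow> laurent \<Rightarrow> laurent" where
  "reversed n m p = lmono (int n) (int m) * dagger p"

definition stable_poly :: "laurent \<Rightarrow> bool" where
  "stable_poly p \<longleftrightarrow> (\<forall>z w. cmod z \<le> 1 \<and> cmod w \<le> 1 \<longrightarrow> leval p z w \<noteq> 0)"

text \<open>The integral of \<open>z\<^sup>-\<^sup>k w\<^sup>-\<^sup>l / \<bar>p\<bar>\<^sup>2\<close> over the torus; the exponents are \<open>- k\<close> and \<open>- l\<close>.\<close>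

definition bernstein_szego_moment :: "laurent \<Rightarrow> int \<Rightarrow> int \<Rightarrow> complex" where
  "bernstein_szego_moment p k l =
    complex_of_real ((1 / (2 * pi))\<^sup>2) *
    set_lebesgue_integral lborel ({0..2 * pi} \<times> {0..2 * pi})
      (\<lambda>(\<theta>::real, \<phi>::real).
         exp (- \<i> * of_int k * of_real \<theta>) * exp (- \<i> * of_int l * of_real \<phi>) /
         of_real ((cmod (leval p (exp (\<i> * of_real \<theta>)) (exp (\<i> * of_real \<phi>))))\<^sup>2))"

lemma laurent_expand:
  fixes p :: laurent
  shows "p = (\<Sum>e\<in>Poly_Mapping.keys p. Poly_Mapping.single e (Poly_Mapping.lookup p e))"
  by (rule poly_mapping_eqI) (simp add: lookup_sum lookup_single when_def in_keys_iff)

lemma mono_span_eq: "mono_span S = {p. Poly_Mapping.keys p \<subseteq> S}"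
proof (intro equalityI subsetI)
  fix p assume "p \<in> mono_span S"
  then have "p \<in> laurent.span ((\<lambda>(i, j). lmono i j) ` S)" by (simp add: mono_span_def)
  then have "Poly_Mapping.keys p \<subseteq> S"
  proof (induction rule: laurent.span_induct_alt)
    case base show ?case by simp
  next
    case (step c x y)
    then obtain e where e: "e \<in> S" "x = Poly_Mapping.single e 1"
      by (auto simp: lmono_def)
    then have "lscale c x = Poly_Mapping.single e c"
      by (simp add: lscale_def mult_single)
    then show ?case
      using step e Poly_Mapping.keys_add[of "lscale c x" y] by (auto split: if_splits)
  qed
  then show "p \<in> {p. Poly_Mapping.keys p \<subseteq> S}" by simp
next
  fix p :: laurent assume p: "p \<in> {p. Poly_Mapping.keys p \<subseteq> S}"
  have "p = (\<Sum>e\<in>Poly_Mapping.keys p. Poly_Mapping.single e (Poly_Mapping.lookup p e))"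
    by (rule laurent_expand)
  also have "\<dots> = (\<Sum>e\<in>Poly_Mapping.keys p. lscale (Poly_Mapping.lookup p e) (case e of (i, j) \<Rightarrow> lmono i j))"
    by (rule sum.cong) (auto simp: lscale_def lmono_def mult_single)
  also have "\<dots> \<in> mono_span S"
    unfolding mono_span_def using p
    by (intro laurent.span_sum laurent.span_scale laurent.span_base) auto
  finally show "p \<in> mono_span S" .
qed

lemma lookup_dagger: "Poly_Mapping.lookup (dagger p) (i, j) = cnj (Poly_Mapping.lookup p (- i, - j))"
proof -
  have "Poly_Mapping.lookup (dagger p) (i, j) =
      (\<Sum>e\<in>Poly_Mapping.keys p. if e = (- i, - j) then cnj (Poly_Mapping.lookup p e) else 0)"
    unfolding dagger_def lookup_sum
    by (rule sum.cong) (auto simp: lookup_single when_def split: if_splits)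
  then show ?thesis by (simp add: in_keys_iff)
qed

lemma leval_superset:
  assumes "finite A" "Poly_Mapping.keys p \<subseteq> A"
  shows "leval p z w = (\<Sum>(i, j)\<in>A. Poly_Mapping.lookup p (i, j) * z powi i * w powi j)"
  unfolding leval_def
  by (rule sum.mono_neutral_left) (use assms in \<open>auto simp: in_keys_iff\<close>)

lemma leval_dagger: "leval (dagger p) z w = cnj (leval p (1 / cnj z) (1 / cnj w))"
proof -
  let ?u = "\<lambda>e::int \<times> int. - e"
  have k: "Poly_Mapping.keys (dagger p) \<subseteq> ?u ` Poly_Mapping.keys p"
  proof
    fix e assume "e \<in> Poly_Mapping.keys (dagger p)"
    then have "- e \<in> Poly_Mapping.keys p" by (cases e) (auto simp: in_keys_iff lookup_dagger)
    then show "e \<in> ?u ` Poly_Mapping.keys p" by (metis image_eqI minus_minus)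
  qed
  have "leval (dagger p) z w =
     (\<Sum>e\<in>Poly_Mapping.keys p. case - e of (i, j) \<Rightarrow> Poly_Mapping.lookup (dagger p) (i, j) * z powi i * w powi j)"
    by (subst leval_superset[OF _ k]) (auto simp: sum.reindex inj_on_def)
  also have "\<dots> = cnj (leval p (1 / cnj z) (1 / cnj w))"
    unfolding leval_def cnj_sum
    by (rule sum.cong)
      (auto simp: lookup_dagger power_int_minus power_int_divide_distrib divide_inverse complex_cnj_power_int power_int_inverse)
  finally show ?thesis .
qed

lemma leval_reversed:
  assumes "z \<noteq> 0" "w \<noteq> 0"
  shows "leval (reversed n m p) z w = z ^ n * w ^ m * cnj (leval p (1 / cnj z) (1 / cnj w))"
proof -
  let ?d = "dagger p"
  let ?s = "\<lambda>e. (int n, int m) + e"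
  have "reversed n m p = Poly_Mapping.single (int n, int m) 1 *
      (\<Sum>e\<in>Poly_Mapping.keys ?d. Poly_Mapping.single e (Poly_Mapping.lookup ?d e))"
    unfolding reversed_def lmono_def
    by (rule arg_cong[where f = "(*) _"], rule poly_mapping_eqI)
      (simp add: lookup_sum lookup_single when_def in_keys_iff)
  then have r: "reversed n m p =
      (\<Sum>e\<in>Poly_Mapping.keys ?d. Poly_Mapping.single (?s e) (Poly_Mapping.lookup ?d e))"
    by (simp add: sum_distrib_left mult_single)
  have l: "Poly_Mapping.lookup (reversed n m p) (?s e) = Poly_Mapping.lookup ?d e" for e
  proof -
    have "Poly_Mapping.lookup (reversed n m p) (?s e) =
      (\<Sum>f\<in>Poly_Mapping.keys ?d. if f = e then Poly_Mapping.lookup ?d f else 0)"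
      unfolding r lookup_sum by (rule sum.cong) (auto simp: lookup_single when_def)
    then show ?thesis by (simp add: in_keys_iff)
  qed
  have k: "Poly_Mapping.keys (reversed n m p) \<subseteq> ?s ` Poly_Mapping.keys ?d"
  proof
    fix e assume "e \<in> Poly_Mapping.keys (reversed n m p)"
    moreover have "e = ?s (e - (int n, int m))" by simp
    ultimately show "e \<in> ?s ` Poly_Mapping.keys ?d"
      by (metis image_eqI in_keys_iff l)
  qed
  have "leval (reversed n m p) z w =
     (\<Sum>e\<in>Poly_Mapping.keys ?d. case ?s e of (i, j) \<Rightarrow> Poly_Mapping.lookup (reversed n m p) (i, j) * z powi i * w powi j)"
    by (subst leval_superset[OF _ k]) (auto simp: sum.reindex inj_on_def)
  also have "\<dots> = (\<Sum>e\<in>Poly_Mapping.keys ?d. z ^ n * w ^ m *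
      (case e of (i, j) \<Rightarrow> Poly_Mapping.lookup ?d (i, j) * z powi i * w powi j))"
  proof (rule sum.cong)
    fix e assume "e \<in> Poly_Mapping.keys ?d"
    obtain i j where e: "e = (i, j)" by (cases e)
    show "(case ?s e of (i, j) \<Rightarrow> Poly_Mapping.lookup (reversed n m p) (i, j) * z powi i * w powi j) =
      z ^ n * w ^ m * (case e of (i, j) \<Rightarrow> Poly_Mapping.lookup ?d (i, j) * z powi i * w powi j)"
      using l[of e] assms by (simp add: e power_int_add algebra_simps)
  qed simp
  also have "\<dots> = z ^ n * w ^ m * leval ?d z w"
    by (simp add: leval_def sum_distrib_left)
  finally show ?thesis by (simp add: leval_dagger)
qed

end

theory Submission
  imports Defs "HOL-Complex_Analysis.Complex_Analysis"
    "HOL-Computational_Algebra.Fundamental_Theorem_Algebra"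
begin

text \<open>
  Write \<open>\<langle>_, _\<rangle>\<close> for the inner product of \<open>L\<close>, \<open>E\<close> for the index box of size \<open>(n + 1, m + 1)\<close>, \<open>Q\<close> for the one of
  size \<open>(n, m)\<close>, and \<open>P\<close>, \<open>R\<close> for those of size \<open>(n + 1, m)\<close> and \<open>(n, m + 1)\<close>. Then \<open>K = 0\<close> says that
  the orthogonal complements \<open>P - Q\<close> and \<open>R - Q\<close> of \<open>Q\<close> in \<open>P\<close> and in \<open>R\<close> are orthogonal to each other;
  \<open>K\<^sub>S\<close> denotes the reproducing kernel of \<open>S\<close>. Let \<open>p\<close> be the
  reversal of \<open>\<phi> = \<phi>\<^sup>m\<close>, and let \<open>\<langle>_, _\<rangle>'\<close> be the inner product of \<open>L\<^sup>2(1 / |p|\<^sup>2)\<close> on the torus.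

  If \<open>K = 0\<close>, two orthonormal bases of \<open>E\<close> (one adapted to \<open>Q, P, R, E\<close>, and its reversal) give the
  same reproducing kernel, hence, with \<open>x = z z'\<^sup>*\<close>, \<open>y = w w'\<^sup>*\<close>,
  \<open>p p'\<^sup>* - \<phi> \<phi>'\<^sup>* = (1 - x) (1 - y) K\<^sub>Q + (1 - y) K\<^sub>P\<^sub>-\<^sub>Q + (1 - x) K\<^sub>R\<^sub>-\<^sub>Q\<close>.
  Positivity of the kernels on the right yields stability of \<open>p\<close>. For \<open>|z| = 1\<close> the identity shows that
  the basis of \<open>P - Q\<close> is orthonormal for \<open>|p(z, w)|\<^sup>-\<^sup>2 dw\<close> on every fibre; iterating the \<open>L\<close>-orthogonal
  decomposition of \<open>z g\<close> for \<open>g\<close> in \<open>Q\<close> then gives \<open>P - Q \<bottom> Q\<close> with respect to \<open>\<langle>_, _\<rangle>'\<close>. Solving the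
  identity for \<open>K\<^sub>Q\<close> shows that \<open>K\<^sub>Q\<close> also reproduces \<open>Q\<close> for \<open>\<langle>_, _\<rangle>'\<close>, so the two inner products
  agree on \<open>E\<close>.

  For the converse (also needed above to get \<open>P - Q \<bottom> R - Q\<close> for \<open>\<langle>_, _\<rangle>'\<close>): at fixed \<open>w\<close> the inverse of
  the \<open>n\<close> by \<open>n\<close> Toeplitz matrix of \<open>|p(z, w)|\<^sup>-\<^sup>2 dz\<close> is a trigonometric polynomial of degree \<open>m\<close> in \<open>w\<close>, so an
  \<open>x\<close> in \<open>R - Q\<close>, being orthogonal to \<open>m\<close> consecutive rows of \<open>n\<close> monomials, is orthogonal to all earlier
  rows. The moments \<open>\<langle>x, z\<^sup>n w\<^sup>j\<rangle>'\<close>, \<open>j < m\<close>, then form a bounded solution of a recurrence whose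
  characteristic polynomial \<open>p(0, _)\<close> has no zero in the closed disc, so they vanish.
\<close>

section \<open>Arithmetic and supports of Laurent polynomials\<close>

abbreviation coef :: "laurent \<Rightarrow> int \<times> int \<Rightarrow> complex" where
  "coef \<equiv> Poly_Mapping.lookup"

abbreviation supp :: "laurent \<Rightarrow> (int \<times> int) set" where
  "supp \<equiv> Poly_Mapping.keys"

lemma laurent_induct [case_names zero single add]:
  fixes p :: laurent
  assumes "P 0" "\<And>i j c. P (Poly_Mapping.single (i, j) c)" "\<And>p q. P p \<Longrightarrow> P q \<Longrightarrow> P (p + q)"
  shows "P p"
proof -
  have "P (\<Sum>e\<in>A. Poly_Mapping.single e (coef p e))" if "finite A" for A
    using that by (induction A rule: finite_induct) (auto simp: assms)
  then have "P (\<Sum>e\<in>supp p. Poly_Mapping.single e (coef p e))"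
    by simp
  then show ?thesis
    by (simp only: laurent_expand[symmetric])
qed

lemma dagger_zero [simp]: "dagger 0 = 0"
  by (simp add: dagger_def)

lemma dagger_add: "dagger (p + q) = dagger p + dagger q"
  by (rule poly_mapping_eqI) (auto simp: lookup_dagger lookup_add)

lemma dagger_single [simp]:
  "dagger (Poly_Mapping.single (i, j) c) = Poly_Mapping.single (- i, - j) (cnj c)"
  by (rule poly_mapping_eqI) (auto simp: lookup_dagger lookup_single when_def split: if_splits)

lemma dagger_dagger [simp]: "dagger (dagger p) = p"
  by (rule poly_mapping_eqI) (auto simp: lookup_dagger)

lemma dagger_mult: "dagger (p * q) = dagger p * dagger q"
proof (induction p rule: laurent_induct)
  case (single i j c)
  show ?case
    by (induction q rule: laurent_induct) (auto simp: mult_single dagger_add distrib_left)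
qed (auto simp: dagger_add distrib_right)

lemma dagger_lmono [simp]: "dagger (lmono i j) = lmono (- i) (- j)"
  by (simp add: lmono_def)

lemma dagger_lscale: "dagger (lscale c p) = lscale (cnj c) (dagger p)"
  by (simp add: lscale_def dagger_mult zero_prod_def)

lemma dagger_sum: "dagger (\<Sum>x\<in>A. f x) = (\<Sum>x\<in>A. dagger (f x))"
  by (induction A rule: infinite_finite_induct) (auto simp: dagger_add)

lemma lscale_mult_left: "lscale c p * q = lscale c (p * q)"
  and lscale_mult_right: "p * lscale c q = lscale c (p * q)"
  by (simp_all add: lscale_def ac_simps)

lemma coef_single_mult: "coef (Poly_Mapping.single d c * p) e = c * coef p (e - d)"
proof (induction p rule: laurent_induct)
  case (single i j a)
  then show ?case
    by (auto simp: mult_single lookup_single when_def algebra_simps)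
qed (auto simp: distrib_left lookup_add)

lemma coef_lscale [simp]: "coef (lscale c p) e = c * coef p e"
  by (simp add: lscale_def coef_single_mult)

lemma coef_lmono_mult: "coef (lmono k l * p) (i, j) = coef p (i - k, j - l)"
  by (simp add: lmono_def coef_single_mult)

lemma coef_lmono: "coef (lmono k l) e = (if e = (k, l) then 1 else 0)"
  by (simp add: lmono_def lookup_single when_def)

lemma lmono_mult: "lmono i j * lmono k l = lmono (i + k) (j + l)"
  by (simp add: lmono_def mult_single)

lemma lmono_0_0 [simp]: "lmono 0 0 = 1"
  by (simp add: lmono_def single_one[symmetric] zero_prod_def del: single_one)

lemma laurent_expand_on:
  assumes "finite A" "supp p \<subseteq> A"
  shows "p = (\<Sum>(i, j)\<in>A. lscale (coef p (i, j)) (lmono i j))"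
proof (rule poly_mapping_eqI)
  fix e
  have "coef (\<Sum>(i, j)\<in>A. lscale (coef p (i, j)) (lmono i j)) e = (\<Sum>x\<in>A. if x = e then coef p x else 0)"
    unfolding lookup_sum by (rule sum.cong) (auto simp: coef_lmono)
  also have "\<dots> = coef p e"
    using assms by (auto simp: in_keys_iff)
  finally show "coef p e = coef (\<Sum>(i, j)\<in>A. lscale (coef p (i, j)) (lmono i j)) e" ..
qed

lemma supp_dagger: "supp (dagger p) = (\<lambda>(i, j). (- i, - j)) ` supp p"
proof -
  have "(i, j) \<in> supp (dagger p) \<longleftrightarrow> (- i, - j) \<in> supp p" for i j
    by (simp add: in_keys_iff lookup_dagger)
  then show ?thesis
    by (force simp: image_iff)
qed

lemma supp_lmono_mult: "supp (lmono k l * p) = (\<lambda>(i, j). (i + k, j + l)) ` supp p"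
proof -
  have "(i, j) \<in> supp (lmono k l * p) \<longleftrightarrow> (i - k, j - l) \<in> supp p" for i j
    by (simp add: in_keys_iff coef_lmono_mult)
  then show ?thesis
    by (force simp: image_iff)
qed

lemma supp_lscale: "supp (lscale c p) \<subseteq> supp p"
  by (auto simp: in_keys_iff)

lemma supp_multE:
  assumes "(i, j) \<in> supp (p * q)"
  obtains i1 j1 i2 j2 where "(i1, j1) \<in> supp p" "(i2, j2) \<in> supp q" "i = i1 + i2" "j = j1 + j2"
proof -
  obtain a b where "(i, j) = a + b" "a \<in> supp p" "b \<in> supp q"
    using assms keys_mult[of p q] by auto
  then show ?thesis
    using that[of "fst a" "snd a" "fst b" "snd b"] by (cases a; cases b) auto
qed

lemma mono_span_diff: "p \<in> mono_span S \<Longrightarrow> q \<in> mono_span S \<Longrightarrow> p - q \<in> mono_span S"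
  and mono_span_lscale: "p \<in> mono_span S \<Longrightarrow> lscale c p \<in> mono_span S"
  and mono_span_sum: "(\<And>x. x \<in> A \<Longrightarrow> f x \<in> mono_span S) \<Longrightarrow> (\<Sum>x\<in>A. f x) \<in> mono_span S"
  unfolding mono_span_def
  by (auto intro: laurent.span_diff laurent.span_scale laurent.span_sum)

lemma mono_span_mono: "S \<subseteq> T \<Longrightarrow> mono_span S \<subseteq> mono_span T"
  by (auto simp: mono_span_eq)

lemma lmono_in_span: "(i, j) \<in> S \<Longrightarrow> lmono i j \<in> mono_span S"
  by (auto simp: mono_span_eq lmono_def)

lemma mono_span_shift:
  assumes "p \<in> mono_span S" "\<And>i j. (i, j) \<in> S \<Longrightarrow> (i + k, j + l) \<in> T"
  shows "lmono k l * p \<in> mono_span T"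
  using assms by (force simp: mono_span_eq supp_lmono_mult)

section \<open>Evaluation of Laurent polynomials at a point\<close>

lemma leval_zero [simp]: "leval 0 z w = 0"
  by (simp add: leval_def)

lemma leval_single [simp]: "leval (Poly_Mapping.single (i, j) c) z w = c * z powi i * w powi j"
  by (subst leval_superset[of "{(i, j)}"]) auto

lemma leval_lmono: "leval (lmono i j) z w = z powi i * w powi j"
  by (simp add: lmono_def)

lemma leval_add: "leval (p + q) z w = leval p z w + leval q z w"
proof -
  let ?A = "supp p \<union> supp q"
  have "leval (p + q) z w = (\<Sum>(i, j)\<in>?A. coef (p + q) (i, j) * z powi i * w powi j)"
    using keys_add[of p q] by (intro leval_superset) auto
  also have "\<dots> = (\<Sum>(i, j)\<in>?A. coef p (i, j) * z powi i * w powi j) +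
      (\<Sum>(i, j)\<in>?A. coef q (i, j) * z powi i * w powi j)"
    unfolding sum.distrib[symmetric] by (rule sum.cong) (auto simp: lookup_add algebra_simps)
  also have "\<dots> = leval p z w + leval q z w"
    by (subst (1 2) leval_superset[of ?A]) auto
  finally show ?thesis .
qed

lemma leval_lscale [simp]: "leval (lscale c p) z w = c * leval p z w"
  by (subst (1 2) leval_superset[of "supp p"]) (auto simp: supp_lscale sum_distrib_left ac_simps intro!: sum.cong)

lemma leval_sum: "leval (\<Sum>x\<in>A. f x) z w = (\<Sum>x\<in>A. leval (f x) z w)"
  by (induction A rule: infinite_finite_induct) (auto simp: leval_add)

lemma leval_diff: "leval (p - q) z w = leval p z w - leval q z w"
  using leval_add[of "p - q" q z w] by simp

lemma leval_sum_mult_single: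
  "leval (Poly_Mapping.single d c * q) z w =
    (\<Sum>(i, j)\<in>supp q. c * coef q (i, j) * z powi (fst d + i) * w powi (snd d + j))"
proof -
  have "Poly_Mapping.single d c * q = (\<Sum>e\<in>supp q. Poly_Mapping.single (d + e) (c * coef q e))"
    by (subst (1) laurent_expand[of q]) (simp add: sum_distrib_left mult_single)
  then show ?thesis
    by (simp add: leval_sum) (auto intro!: sum.cong simp: plus_prod_def)
qed

text \<open>\<open>powi\<close> sends \<open>0\<close> with a negative exponent to \<open>0\<close>,
  so exponents fail to add at a coordinate \<open>0\<close> unless that variable occurs only with
  nonnegative exponents; hence the two alternatives.\<close>

lemma leval_mult:
  assumes "z \<noteq> 0 \<or> (\<forall>(i, j)\<in>supp p \<union> supp q. 0 \<le> i)" "w \<noteq> 0 \<or> (\<forall>(i, j)\<in>supp p \<union> supp q. 0 \<le> j)"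
  shows "leval (p * q) z w = leval p z w * leval q z w"
proof -
  have pz: "z powi (i + k) = z powi i * z powi k" if "(i, j) \<in> supp p" "(k, l) \<in> supp q" for i j k l
  proof (cases "z = 0")
    case True
    then have "0 \<le> i" "0 \<le> k"
      using assms(1) that by auto
    then show ?thesis
      by (auto simp: power_int_0_left_if True)
  qed (simp add: power_int_add)
  have pw: "w powi (j + l) = w powi j * w powi l" if "(i, j) \<in> supp p" "(k, l) \<in> supp q" for i j k l
  proof (cases "w = 0")
    case True
    then have "0 \<le> j" "0 \<le> l"
      using assms(2) that by auto
    then show ?thesis
      by (auto simp: power_int_0_left_if True)
  qed (simp add: power_int_add)
  have "p * q = (\<Sum>d\<in>supp p. Poly_Mapping.single d (coef p d) * q)"
    by (subst (1) laurent_expand[of p]) (simp add: sum_distrib_right)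
  then have "leval (p * q) z w = (\<Sum>d\<in>supp p. \<Sum>(i, j)\<in>supp q.
      coef p d * coef q (i, j) * z powi (fst d + i) * w powi (snd d + j))"
    by (simp add: leval_sum leval_sum_mult_single)
  also have "\<dots> = (\<Sum>(i, j)\<in>supp p. \<Sum>(k, l)\<in>supp q.
      (coef p (i, j) * z powi i * w powi j) * (coef q (k, l) * z powi k * w powi l))"
    by (intro sum.cong refl) (auto intro!: sum.cong simp: pz pw)
  also have "\<dots> = leval p z w * leval q z w"
    unfolding leval_def sum_product by (intro sum.cong refl) (auto simp: case_prod_unfold)
  finally show ?thesis .
qed

lemma leval_dagger_torus:
  assumes "cmod z = 1" "cmod w = 1"
  shows "leval (dagger p) z w = cnj (leval p z w)"
proof -
  have "1 / cnj u = u" if "cmod u = 1" for u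
    using that complex_norm_square[of u] by (auto simp: divide_simps)
  then show ?thesis
    using assms by (simp add: leval_dagger)
qed

lemma leval_mult_torus:
  assumes "cmod z = 1" "cmod w = 1"
  shows "leval (p * q) z w = leval p z w * leval q z w"
  using assms by (intro leval_mult) auto

section \<open>Functionals\<close>

text \<open>Linearity on all Laurent polynomials frees sesquilinear computations from membership
  conditions. Positivity is kept apart, because for the given functional it is known only on a box
  of exponents.\<close>

locale laurent_functional =
  fixes L :: "laurent \<Rightarrow> complex"
  assumes L_add: "L (p + q) = L p + L q"
    and L_lscale: "L (lscale c p) = c * L p"
    and L_dagger: "L (dagger p) = cnj (L p)"
begin

abbreviation inn :: "laurent \<Rightarrow> laurent \<Rightarrow> complex" where
  "inn \<equiv> linner L"

lemma L_zero [simp]: "L 0 = 0"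
  using L_add[of 0 0] by simp

lemma L_diff: "L (p - q) = L p - L q"
  using L_add[of "p - q" q] by simp

lemma inn_add_left: "inn (p + q) r = inn p r + inn q r"
  and inn_add_right: "inn r (p + q) = inn r p + inn r q"
  and inn_lscale_left: "inn (lscale c p) r = c * inn p r"
  and inn_lscale_right: "inn r (lscale c p) = cnj c * inn r p"
  and inn_zero_left [simp]: "inn 0 r = 0"
  and inn_zero_right [simp]: "inn r 0 = 0"
  by (simp_all add: linner_def distrib_left distrib_right L_add dagger_add lscale_mult_left
      lscale_mult_right L_lscale dagger_lscale)

lemma inn_diff_left: "inn (p - q) r = inn p r - inn q r"
  using inn_add_left[of "p - q" q r] by simp

lemma inn_diff_right: "inn r (p - q) = inn r p - inn r q"
  using inn_add_right[of r "p - q" q] by simp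

lemma inn_sum_left: "inn (\<Sum>x\<in>A. f x) r = (\<Sum>x\<in>A. inn (f x) r)"
  by (induction A rule: infinite_finite_induct) (auto simp: inn_add_left)

lemma inn_sum_right: "inn r (\<Sum>x\<in>A. f x) = (\<Sum>x\<in>A. inn r (f x))"
  by (induction A rule: infinite_finite_induct) (auto simp: inn_add_right)

lemma inn_cnj: "inn q p = cnj (inn p q)"
proof -
  have "dagger (p * dagger q) = q * dagger p"
    by (simp add: dagger_mult mult.commute)
  then show ?thesis
    using L_dagger[of "p * dagger q"] by (simp add: linner_def)
qed

text \<open>A monomial times its \<open>dagger\<close> is \<open>1\<close>, so multiplication by it
  is an isometry.\<close>

lemma inn_shift: "inn (lmono k l * p) (lmono k l * q) = inn p q"
proof -
  have "lmono k l * p * dagger (lmono k l * q) = (lmono k l * lmono (- k) (- l)) * (p * dagger q)"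
    by (simp add: dagger_mult ac_simps)
  then show ?thesis
    by (simp add: linner_def lmono_mult)
qed

lemma inn_shift': "inn (lmono k l * p) q = inn p (lmono (- k) (- l) * q)"
  by (simp add: linner_def dagger_mult ac_simps)

lemma inn_self_real: "inn p p = of_real (Re (inn p p))"
  using inn_cnj[of p p] by (simp add: complex_eq_iff)

lemma inn_expand_left:
  assumes "finite A" "supp p \<subseteq> A"
  shows "inn p r = (\<Sum>(i, j)\<in>A. coef p (i, j) * inn (lmono i j) r)"
  by (subst laurent_expand_on[OF assms])
    (auto simp: inn_sum_left inn_lscale_left case_prod_unfold intro!: sum.cong)

lemma inn_span_zero:
  assumes "q \<in> mono_span S" "\<And>i j. (i, j) \<in> S \<Longrightarrow> inn p (lmono i j) = 0"
  shows "inn p q = 0"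
proof -
  have "inn q p = (\<Sum>(i, j)\<in>supp q. coef q (i, j) * inn (lmono i j) p)"
    by (rule inn_expand_left) auto
  also have "\<dots> = 0"
    using assms by (intro sum.neutral) (auto simp: mono_span_eq inn_cnj[of _ p] subset_iff)
  finally show ?thesis
    using inn_cnj[of p q] by simp
qed

text \<open>Reversal is \<open>dagger\<close>, which exchanges the two arguments, followed by a
  shift; it is antiunitary.\<close>

lemma inn_rev: "inn (reversed n m p) (reversed n m q) = inn q p"
  unfolding reversed_def inn_shift by (simp add: linner_def mult.commute)

end

section \<open>Orthonormal bases\<close>

definition pd_on :: "(laurent \<Rightarrow> complex) \<Rightarrow> (int \<times> int) set \<Rightarrow> bool" where
  "pd_on L S \<longleftrightarrow> (\<forall>f\<in>mono_span S. f \<noteq> 0 \<longrightarrow> pos_real (linner L f f))"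

text \<open>Completeness is an expansion formula, which shifts and reversals preserve without
  counting dimensions. The index set is separate from \<open>S\<close>, so that a transported basis
  keeps its indices.\<close>

definition onb ::
  "(laurent \<Rightarrow> complex) \<Rightarrow> (int \<times> int) set \<Rightarrow> 'i set \<Rightarrow> ('i \<Rightarrow> laurent) \<Rightarrow> bool" where
  "onb L S I e \<longleftrightarrow> finite I \<and> (\<forall>u\<in>I. e u \<in> mono_span S) \<and>
    (\<forall>u\<in>I. \<forall>v\<in>I. linner L (e u) (e v) = (if u = v then 1 else 0)) \<and>
    (\<forall>f\<in>mono_span S. f = (\<Sum>u\<in>I. lscale (linner L f (e u)) (e u)))"

text \<open>For an orthonormal basis \<open>e\<close> this is the reproducing kernel of its
  span.\<close>

definition kern :: "'i set \<Rightarrow> ('i \<Rightarrow> laurent) \<Rightarrow> complex \<Rightarrow> complex \<Rightarrow> complex \<Rightarrow> complex \<Rightarrow> complex" where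
  "kern I e z w z' w' = (\<Sum>u\<in>I. leval (e u) z w * cnj (leval (e u) z' w'))"

lemma pd_on_mono: "pd_on L T \<Longrightarrow> S \<subseteq> T \<Longrightarrow> pd_on L S"
  using mono_span_mono[of S T] by (auto simp: pd_on_def)

lemma onb_finite: "onb L S I e \<Longrightarrow> finite I"
  and onb_in_span: "onb L S I e \<Longrightarrow> u \<in> I \<Longrightarrow> e u \<in> mono_span S"
  and onb_inn: "onb L S I e \<Longrightarrow> u \<in> I \<Longrightarrow> v \<in> I \<Longrightarrow> linner L (e u) (e v) = (if u = v then 1 else 0)"
  and onb_expand: "onb L S I e \<Longrightarrow> f \<in> mono_span S \<Longrightarrow>
    f = (\<Sum>u\<in>I. lscale (linner L f (e u)) (e u))"
  by (auto simp: onb_def)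

lemma onb_leval_expand:
  assumes "onb L S I e" "f \<in> mono_span S"
  shows "leval f z w = (\<Sum>u\<in>I. linner L f (e u) * leval (e u) z w)"
  by (subst onb_expand[OF assms]) (simp add: leval_sum)

lemma reversed_lscale: "reversed n m (lscale c p) = lscale (cnj c) (reversed n m p)"
  by (simp add: reversed_def dagger_lscale lscale_mult_right)

lemma reversed_sum: "reversed n m (\<Sum>x\<in>A. f x) = (\<Sum>x\<in>A. reversed n m (f x))"
  by (simp add: reversed_def dagger_sum sum_distrib_left)

lemma coef_reversed: "coef (reversed n m p) (i, j) = cnj (coef p (int n - i, int m - j))"
  by (simp add: reversed_def coef_lmono_mult lookup_dagger)

lemma reversed_reversed [simp]: "reversed n m (reversed n m p) = p"
  by (rule poly_mapping_eqI) (auto simp: coef_reversed)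

lemma reversed_in_span:
  assumes "p \<in> mono_span S" "\<And>i j. (i, j) \<in> S \<Longrightarrow> (int n - i, int m - j) \<in> T"
  shows "reversed n m p \<in> mono_span T"
proof -
  have "e \<in> T" if "e \<in> supp (reversed n m p)" for e
  proof -
    obtain i j where e: "e = (i, j)" by (cases e)
    with that have "(int n - i, int m - j) \<in> supp p"
      by (auto simp: in_keys_iff coef_reversed)
    then have "(int n - i, int m - j) \<in> S"
      using assms(1) by (auto simp: mono_span_eq)
    from assms(2)[OF this] show ?thesis by (simp add: e)
  qed
  then show ?thesis
    by (auto simp: mono_span_eq)
qed

section \<open>Gram-Schmidt orthogonalisation and reproducing kernels\<close>

context laurent_functional
begin

lemma onb_parseval:
  assumes "onb L S I e" "f \<in> mono_span S"
  shows "inn f g = (\<Sum>u\<in>I. inn f (e u) * cnj (inn g (e u)))"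
  by (subst onb_expand[OF assms])
    (simp add: inn_sum_left inn_lscale_left inn_cnj[of "e _" g])

lemma onb_norm:
  assumes "onb L S I e" "f \<in> mono_span S"
  shows "Re (inn f f) = (\<Sum>u\<in>I. (cmod (inn f (e u)))\<^sup>2)"
  by (subst onb_parseval[OF assms]) (simp add: complex_mult_cnj cmod_power2)

lemma onb_orthogonal:
  assumes "onb L S I e" "f \<in> mono_span S" "\<And>u. u \<in> I \<Longrightarrow> inn p (e u) = 0"
  shows "inn p f = 0"
  by (subst onb_expand[OF assms(1,2)]) (simp add: inn_sum_right inn_lscale_right assms(3))

text \<open>One Gram-Schmidt step: \<open>r\<close> is the new monomial minus its projection
  \<open>q\<close> to the old span. As \<open>q\<close> has no term at \<open>(i, j)\<close>,
  \<open>r\<close> has coefficient \<open>1\<close> there; so \<open>r \<noteq> 0\<close>, and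
  normalisation leaves that coefficient positive.\<close>

lemma orthonormal_at_exists:
  assumes e: "onb L S S e" and a: "(i, j) \<notin> S" and pd: "pd_on L (insert (i, j) S)"
  shows "\<exists>p. orthonormal_at L (insert (i, j) S) (i, j) p"
proof -
  let ?T = "insert (i, j) S"
  define q where "q = (\<Sum>u\<in>S. lscale (inn (lmono i j) (e u)) (e u))"
  define r where "r = lmono i j - q"
  have q: "q \<in> mono_span S"
    unfolding q_def by (intro mono_span_sum mono_span_lscale onb_in_span[OF e])
  then have q0: "coef q (i, j) = 0"
    using a by (auto simp: mono_span_eq in_keys_iff)
  have r: "r \<in> mono_span ?T"
    unfolding r_def using q mono_span_mono[of S ?T] by (intro mono_span_diff lmono_in_span) auto
  have r1: "coef r (i, j) = 1"
    by (simp add: r_def lookup_minus coef_lmono q0)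
  then have "r \<noteq> 0" by auto
  then have pos: "pos_real (inn r r)"
    using pd r by (auto simp: pd_on_def)
  have "inn r (e v) = 0" if "v \<in> S" for v
  proof -
    have "inn q (e v) = (\<Sum>u\<in>S. if u = v then inn (lmono i j) (e u) else 0)"
      unfolding q_def inn_sum_left
      by (rule sum.cong) (auto simp: inn_lscale_left onb_inn[OF e _ that])
    then show ?thesis
      using that onb_finite[OF e] by (simp add: r_def inn_diff_left)
  qed
  then have orth: "inn r f = 0" if "f \<in> mono_span S" for f
    using onb_orthogonal[OF e that] by blast
  define t where "t = Re (inn r r)"
  have t: "0 < t" "inn r r = of_real t"
    using pos inn_self_real[of r] by (auto simp: t_def pos_real_def)
  have "orthonormal_at L ?T (i, j) (lscale (of_real (1 / sqrt t)) r)"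
    unfolding orthonormal_at_def
  proof (intro conjI ballI)
    show "linner L (lscale (complex_of_real (1 / sqrt t)) r) (lscale (complex_of_real (1 / sqrt t)) r) = 1"
      using t by (simp add: inn_lscale_left inn_lscale_right flip: of_real_mult)
  next
    fix x assume "x \<in> ?T - {(i, j)}"
    then show "case x of (k, l) \<Rightarrow> linner L (lscale (complex_of_real (1 / sqrt t)) r) (lmono k l) = 0"
      by (auto simp: inn_lscale_left orth lmono_in_span)
  qed (use t r in \<open>auto simp: mono_span_lscale pos_real_def r1\<close>)
  then show ?thesis by blast
qed

lemma orthonormal_at_orthogonal:
  assumes "orthonormal_at L S a p" "f \<in> mono_span (S - {a})"
  shows "inn p f = 0"
proof -
  have "\<forall>(i, j)\<in>S - {a}. inn p (lmono i j) = 0"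
    using assms(1) by (simp add: orthonormal_at_def)
  then show ?thesis
    by (intro inn_span_zero[OF assms(2)]) auto
qed

text \<open>With \<open>t\<close> the ratio of the coefficients at \<open>a\<close>,
  \<open>p - lscale t q\<close> has no term at \<open>a\<close>. It lies in the space to which both
  \<open>p\<close> and \<open>q\<close> are orthogonal, so its norm is zero; normalisation and
  positivity then force \<open>t = 1\<close>.\<close>

lemma orthonormal_at_unique:
  assumes "orthonormal_at L S a p" "orthonormal_at L S a q" "pd_on L S"
  shows "p = q"
proof -
  define t where "t = coef p a / coef q a"
  have pq: "pos_real (coef p a)" "pos_real (coef q a)" "inn p p = 1" "inn q q = 1"
    using assms by (auto simp: orthonormal_at_def)
  then have t: "pos_real t"
    by (auto simp: pos_real_def t_def elim!: Reals_cases)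
  have "coef q a \<noteq> 0" using pq by (auto simp: pos_real_def)
  then have "coef (p - lscale t q) a = 0"
    by (simp add: lookup_minus t_def)
  moreover have d: "p - lscale t q \<in> mono_span S"
    using assms by (intro mono_span_diff mono_span_lscale) (auto simp: orthonormal_at_def)
  ultimately have r: "p - lscale t q \<in> mono_span (S - {a})"
    by (auto simp: mono_span_eq in_keys_iff subset_iff)
  have "inn (p - lscale t q) (p - lscale t q) = 0"
    using orthonormal_at_orthogonal[OF assms(1) r] orthonormal_at_orthogonal[OF assms(2) r]
    by (subst inn_diff_left) (simp add: inn_lscale_left)
  then have "p = lscale t q"
    using assms(3) d by (auto simp: pd_on_def pos_real_def)
  then have "t * cnj t = 1"
    using pq by (simp add: inn_lscale_left inn_lscale_right mult.commute)
  moreover obtain s where s: "t = of_real s" "0 < s"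
    using t by (auto simp: pos_real_def elim!: Reals_cases)
  ultimately have "s * s = 1"
    by (simp flip: of_real_mult)
  then have "s = 1"
    using s by (simp add: square_eq_1_iff)
  with \<open>p = lscale t q\<close> s show ?thesis
    by simp
qed

lemma onb_insert:
  assumes e: "onb L S S e" and a: "a \<notin> S" and p: "orthonormal_at L (insert a S) a p"
  shows "onb L (insert a S) (insert a S) (e(a := p))"
proof -
  let ?T = "insert a S"
  have S: "?T - {a} = S" using a by auto
  have orth: "inn p f = 0" if "f \<in> mono_span S" for f
    using orthonormal_at_orthogonal[OF p] that by (simp add: S)
  then have orth': "inn f p = 0" if "f \<in> mono_span S" for f
    using that inn_cnj[of f p] by simp
  have p': "p \<in> mono_span ?T" "coef p a \<noteq> 0" "inn p p = 1"
    using p by (auto simp: orthonormal_at_def pos_real_def)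
  have eS: "e u \<in> mono_span S" if "u \<in> S" for u
    using e that by (rule onb_in_span)
  have "f = (\<Sum>u\<in>?T. lscale (inn f ((e(a := p)) u)) ((e(a := p)) u))" if f: "f \<in> mono_span ?T" for f
  proof -
    define c where "c = coef f a / coef p a"
    define g where "g = f - lscale c p"
    have "g \<in> mono_span ?T" unfolding g_def using f p' by (intro mono_span_diff mono_span_lscale)
    moreover have "coef g a = 0" using p' by (simp add: g_def c_def lookup_minus)
    ultimately have g: "g \<in> mono_span S"
      by (auto simp: mono_span_eq in_keys_iff subset_iff)
    have f': "f = lscale c p + g" by (simp add: g_def)
    have "inn f p = c"
      using p' by (simp add: f' inn_add_left inn_lscale_left orth'[OF g])
    moreover have "inn f (e u) = inn g (e u)" if "u \<in> S" for u
      by (simp add: f' inn_add_left inn_lscale_left orth eS that)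
    ultimately have "(\<Sum>u\<in>?T. lscale (inn f ((e(a := p)) u)) ((e(a := p)) u)) =
        lscale c p + (\<Sum>u\<in>S. lscale (inn g (e u)) (e u))"
      using onb_finite[OF e] a by (auto intro!: sum.cong)
    also have "\<dots> = f"
      using onb_expand[OF e g] f' by simp
    finally show ?thesis ..
  qed
  moreover have "inn ((e(a := p)) u) ((e(a := p)) v) = (if u = v then 1 else 0)"
    if "u \<in> ?T" "v \<in> ?T" for u v
    using that a by (auto simp: onb_inn[OF e] p' orth orth' eS)
  moreover have "(e(a := p)) u \<in> mono_span ?T" if "u \<in> ?T" for u
    using that p'(1) subsetD[OF mono_span_mono[OF subset_insertI] eS[of u]] by (cases "u = a") auto
  ultimately show ?thesis
    unfolding onb_def using onb_finite[OF e] by (intro conjI ballI) auto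
qed

lemma onb_exists:
  assumes "finite S" "pd_on L S"
  shows "\<exists>e. onb L S S e"
  using assms
proof (induction S rule: finite_induct)
  case empty
  then show ?case by (auto simp: onb_def mono_span_eq)
next
  case (insert a S)
  obtain e where e: "onb L S S e"
    using insert pd_on_mono[OF insert.prems, of S] by blast
  obtain p where "orthonormal_at L (insert a S) a p"
    using orthonormal_at_exists[OF e, of "fst a" "snd a"] insert by auto
  from onb_insert[OF e _ this] show ?case using insert by blast
qed

text \<open>Makes the definite descriptions in \<open>phi\<close> and \<open>phi_tilde\<close>
  meaningful: \<open>S - {a}\<close> is orthonormalised first and \<open>a\<close> is adjoined
  last.\<close>

lemma the_orthonormal_at:
  assumes "finite S" "a \<in> S" "pd_on L S"
  shows "orthonormal_at L S a (THE p. orthonormal_at L S a p)"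
proof -
  have S: "insert (fst a, snd a) (S - {a}) = S" using assms by auto
  obtain e where "onb L (S - {a}) (S - {a}) e"
    using onb_exists[of "S - {a}"] assms pd_on_mono[of L S] by blast
  from orthonormal_at_exists[OF this, of "fst a" "snd a"]
  obtain p where "orthonormal_at L S a p"
    using assms S by auto
  then show ?thesis
    using orthonormal_at_unique[OF _ \<open>orthonormal_at L S a p\<close> assms(3)]
    by (intro theI[where P = "orthonormal_at L S a" and a = p])
qed

text \<open>Expanding every \<open>e u\<close> in \<open>f\<close> and regrouping the double sum
  yields the expansion of every \<open>f v\<close> in \<open>e\<close>: the kernel depends on the
  span only.\<close>

lemma onb_kern_unique:
  assumes e: "onb L S I e" and f: "onb L S J f"
  shows "kern I e z w z' w' = kern J f z w z' w'"
proof -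
  have "kern I e z w z' w' =
      (\<Sum>u\<in>I. (\<Sum>v\<in>J. inn (e u) (f v) * leval (f v) z w) * cnj (leval (e u) z' w'))"
    unfolding kern_def
    by (intro sum.cong refl) (simp add: onb_leval_expand[OF f onb_in_span[OF e]])
  also have "\<dots> = (\<Sum>v\<in>J. \<Sum>u\<in>I. inn (e u) (f v) * leval (f v) z w * cnj (leval (e u) z' w'))"
    by (subst sum.swap) (simp add: sum_distrib_right)
  also have "\<dots> = (\<Sum>v\<in>J. leval (f v) z w * cnj (\<Sum>u\<in>I. inn (f v) (e u) * leval (e u) z' w'))"
    by (simp add: sum_distrib_left inn_cnj[of "e _" "f _"] ac_simps)
  also have "\<dots> = kern J f z w z' w'"
    unfolding kern_def
    by (intro sum.cong refl) (simp add: onb_leval_expand[OF e onb_in_span[OF f]])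
  finally show ?thesis .
qed

lemma onb_shift:
  assumes e: "onb L S I e"
  shows "onb L ((\<lambda>(i, j). (i + k, j + l)) ` S) I (\<lambda>u. lmono k l * e u)"
    (is "onb L ?T I ?e")
proof -
  have "f = (\<Sum>u\<in>I. lscale (inn f (?e u)) (?e u))" if "f \<in> mono_span ?T" for f
  proof -
    have g: "lmono (- k) (- l) * f \<in> mono_span S" (is "?g \<in> _")
      using that by (rule mono_span_shift) auto
    have "f = lmono k l * ?g"
      by (simp add: mult.assoc[symmetric] lmono_mult)
    also have "\<dots> = (\<Sum>u\<in>I. lscale (inn ?g (e u)) (?e u))"
      by (subst onb_expand[OF e g]) (simp add: sum_distrib_left lscale_mult_right)
    also have "\<dots> = (\<Sum>u\<in>I. lscale (inn f (?e u)) (?e u))"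
      by (simp add: inn_shift')
    finally show ?thesis .
  qed
  moreover have "?e u \<in> mono_span ?T" if "u \<in> I" for u
    by (rule mono_span_shift[OF onb_in_span[OF e that]]) force
  ultimately show ?thesis
    unfolding onb_def inn_shift using onb_finite[OF e] onb_inn[OF e] by (intro conjI ballI) auto
qed

lemma onb_reversed:
  assumes e: "onb L S I e"
  shows "onb L ((\<lambda>(i, j). (int n - i, int m - j)) ` S) I (\<lambda>u. reversed n m (e u))"
    (is "onb L ?T I ?e")
proof -
  have "f = (\<Sum>u\<in>I. lscale (inn f (?e u)) (?e u))" if "f \<in> mono_span ?T" for f
  proof -
    have g: "reversed n m f \<in> mono_span S" (is "?g \<in> _")
      using that by (rule reversed_in_span) auto
    have "f = reversed n m ?g"
      by simp
    also have "\<dots> = (\<Sum>u\<in>I. lscale (cnj (inn ?g (e u))) (?e u))"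
      by (subst onb_expand[OF e g]) (simp add: reversed_sum reversed_lscale)
    also have "\<dots> = (\<Sum>u\<in>I. lscale (inn f (?e u)) (?e u))"
      using inn_rev[of n m "reversed n m f"] by (simp add: inn_cnj[of "e _" "reversed n m f"])
    finally show ?thesis .
  qed
  moreover have "?e u \<in> mono_span ?T" if "u \<in> I" for u
    by (rule reversed_in_span[OF onb_in_span[OF e that]]) force
  moreover have "\<forall>u\<in>I. \<forall>v\<in>I. inn (?e u) (?e v) = (if u = v then 1 else 0)"
    using e by (auto simp: onb_def inn_rev)
  ultimately show ?thesis
    unfolding onb_def using onb_finite[OF e] by (intro conjI ballI) auto
qed

text \<open>Stated for a semidefinite form, which is what \<open>bs_inn_nonneg\<close> provides for
  the weighted inner product on the torus.\<close>

lemma inn_Cauchy_Schwarz: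
  assumes "\<And>f. 0 \<le> Re (inn f f)"
  shows "(cmod (inn f g))\<^sup>2 \<le> Re (inn f f) * Re (inn g g)"
proof -
  let ?a = "inn f g" and ?F = "Re (inn f f)" and ?G = "Re (inn g g)"
  have key: "0 \<le> ?F - 2 * t * (cmod ?a)\<^sup>2 + t\<^sup>2 * (cmod ?a)\<^sup>2 * ?G" for t :: real
  proof -
    let ?h = "f - lscale (of_real t * ?a) g"
    have "inn ?h ?h = inn f f - of_real (2 * t) * (?a * cnj ?a) + of_real (t\<^sup>2) * (?a * cnj ?a) * inn g g"
      by (simp add: inn_diff_left inn_diff_right inn_lscale_left inn_lscale_right inn_cnj[of g f]
          algebra_simps power2_eq_square)
    then have "Re (inn ?h ?h) = ?F - 2 * t * (cmod ?a)\<^sup>2 + t\<^sup>2 * (cmod ?a)\<^sup>2 * ?G"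
      by (simp flip: complex_norm_square of_real_power of_real_mult)
    then show ?thesis using assms[of ?h] by simp
  qed
  show ?thesis
  proof (cases "?G = 0")
    case True
    have "(cmod ?a)\<^sup>2 \<le> 0"
    proof (rule ccontr)
      assume "\<not> ?thesis"
      then have p: "0 < (cmod ?a)\<^sup>2" by simp
      \<comment> \<open>For \<open>?G = 0\<close> the bound \<open>key\<close> is linear in
        \<open>t\<close>; this \<open>t\<close> makes its right side \<open>- ?F - 2\<close>, which
        is negative.\<close>
      have "0 \<le> ?F - 2 * ((?F + 1) / (cmod ?a)\<^sup>2) * (cmod ?a)\<^sup>2"
        using key[of "(?F + 1) / (cmod ?a)\<^sup>2"] True by simp
      also have "\<dots> = - ?F - 2" using p by simp
      finally show False using assms[of f] by simp
    qed
    then show ?thesis using True by simp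
  next
    case False
    then have G: "0 < ?G" using assms[of g] by simp
    have "0 \<le> ?F - 2 * (1 / ?G) * (cmod ?a)\<^sup>2 + (1 / ?G)\<^sup>2 * (cmod ?a)\<^sup>2 * ?G"
      by (rule key)
    also have "\<dots> = ?F - (cmod ?a)\<^sup>2 / ?G"
      using G by (simp add: power2_eq_square field_simps)
    finally show ?thesis using G by (simp add: field_simps)
  qed
qed

end

section \<open>Means over the circle\<close>

definition cmean :: "(complex \<Rightarrow> complex) \<Rightarrow> complex" where
  "cmean g = integral {0..2 * pi} (\<lambda>t. g (cis t)) / of_real (2 * pi)"

abbreviation circ :: "complex set" where "circ \<equiv> sphere 0 1"

lemma continuous_on_cis_circ:
  assumes "continuous_on circ g"
  shows "continuous_on A (\<lambda>t. g (cis t))"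
  by (rule continuous_on_compose2[OF assms]) (auto intro!: continuous_intros)

lemma cmean_integrable:
  fixes g :: "complex \<Rightarrow> complex"
  assumes "continuous_on circ g"
  shows "(\<lambda>t. g (cis t)) integrable_on {0..2 * pi}"
  by (rule integrable_continuous_real) (rule continuous_on_cis_circ[OF assms])

lemma cmean_cong: "(\<And>z. cmod z = 1 \<Longrightarrow> f z = g z) \<Longrightarrow> cmean f = cmean g"
  unfolding cmean_def by (intro arg_cong2[where f = "(/)"] integral_cong) auto

lemma cmean_add:
  assumes "continuous_on circ f" "continuous_on circ g"
  shows "cmean (\<lambda>z. f z + g z) = cmean f + cmean g"
  unfolding cmean_def using assms
  by (simp add: integral_add cmean_integrable add_divide_distrib)

lemma cmean_diff:
  assumes "continuous_on circ f" "continuous_on circ g"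
  shows "cmean (\<lambda>z. f z - g z) = cmean f - cmean g"
  unfolding cmean_def using assms
  by (simp add: integral_diff cmean_integrable diff_divide_distrib)

lemma cmean_cmult: "cmean (\<lambda>z. c * f z) = c * cmean f"
  unfolding cmean_def by simp

lemma cmean_mult_right: "cmean (\<lambda>z. f z * c) = cmean f * c"
  unfolding cmean_def by simp

lemma cmean_const [simp]: "cmean (\<lambda>z. c) = c"
  by (simp add: cmean_def scaleR_conv_of_real)

lemma cmean_sum:
  assumes "\<And>x. x \<in> A \<Longrightarrow> continuous_on circ (f x)"
  shows "cmean (\<lambda>z. \<Sum>x\<in>A. f x z) = (\<Sum>x\<in>A. cmean (f x))"
proof (cases "finite A")
  case True
  then show ?thesis
    unfolding cmean_def using assms
    by (subst integral_sum) (auto simp: cmean_integrable sum_divide_distrib)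
qed auto

lemma cmean_cnj: "cmean (\<lambda>z. cnj (f z)) = cnj (cmean f)"
  by (simp add: cmean_def integral_cnj[symmetric])

lemma cmean_nonneg:
  assumes g: "continuous_on circ g" and nn: "\<And>z. cmod z = 1 \<Longrightarrow> 0 \<le> g z"
  shows "0 \<le> Re (cmean (\<lambda>z. of_real (g z)))"
proof -
  have "continuous_on {0..2 * pi} (\<lambda>t. g (cis t))"
    by (rule continuous_on_compose2[OF g]) (auto intro!: continuous_intros)
  then have i: "(\<lambda>t. g (cis t)) integrable_on {0..2 * pi}"
    by (rule integrable_continuous_real)
  have "integral {0..2 * pi} (\<lambda>t. complex_of_real (g (cis t))) = of_real (integral {0..2 * pi} (\<lambda>t. g (cis t)))"
    using integral_linear[OF i bounded_linear_of_real] by (simp add: o_def)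
  moreover have "0 \<le> integral {0..2 * pi} (\<lambda>t. g (cis t))"
    by (intro integral_nonneg i) (simp add: nn)
  ultimately show ?thesis
    by (simp add: cmean_def flip: of_real_mult of_real_divide)
qed

section \<open>Cauchy's formula on the circle and Fourier coefficients\<close>

lemma circlepath_eq_cis: "circlepath 0 1 t = cis (2 * pi * t)"
  by (simp add: circlepath cis_conv_exp algebra_simps)

text \<open>On the unit circle \<open>dz / z = \<i> dt\<close>, which turns means into contour
  integrals.\<close>

lemma contour_integral_circlepath_cmean:
  "contour_integral (circlepath 0 1) (\<lambda>z. f z / z) = 2 * of_real pi * \<i> * cmean f"
proof -
  have "contour_integral (circlepath 0 1) (\<lambda>z. f z / z) =
     integral {0..1} (\<lambda>t. 2 * of_real pi * \<i> * f (cis (2 * pi * t)))"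
    unfolding contour_integral_integral
  proof (rule integral_cong)
    fix t :: real assume "t \<in> {0..1}"
    have "vector_derivative (circlepath 0 1) (at t) = 2 * of_real pi * \<i> * cis (2 * pi * t)"
      by (simp add: vector_derivative_circlepath cis_conv_exp algebra_simps)
    then show "f (circlepath 0 1 t) / circlepath 0 1 t * vector_derivative (circlepath 0 1) (at t) =
        2 * of_real pi * \<i> * f (cis (2 * pi * t))"
      by (simp add: circlepath_eq_cis)
  qed
  also have "\<dots> = 2 * of_real pi * \<i> * integral {0..1} (\<lambda>t. f (cis (2 * pi * t)))"
    by simp
  also have "integral {0..1} (\<lambda>t. f (cis (2 * pi * t))) = cmean f"
  proof -
    have "integral ((\<lambda>x. x / (2 * pi)) ` {0..2 * pi}) (\<lambda>t. f (cis (2 * pi * t))) =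
        (1 / \<bar>2 * pi\<bar>) *\<^sub>R integral (cbox 0 (2 * pi)) (\<lambda>t. f (cis t))"
      using integral_stretch_real[where m = "2 * pi" and f = "\<lambda>t. f (cis t)" and a = 0 and b = "2 * pi"]
      by simp
    moreover have "(\<lambda>x. x / (2 * pi)) ` {0..2 * pi} = {0..1}"
      by (simp add: image_divide_atLeastAtMost)
    ultimately show ?thesis
      by (simp add: cmean_def scaleR_conv_of_real field_simps)
  qed
  finally show ?thesis .
qed

text \<open>On the circle \<open>(1 - cnj z * u) * z = z - u\<close>, so this is Cauchy's integral
  formula written with the Szego kernel.\<close>

lemma cmean_Szego:
  assumes f: "continuous_on (cball 0 1) f" "f holomorphic_on ball 0 1" and u: "cmod u < 1"
  shows "cmean (\<lambda>z. f z / (1 - cnj z * u)) = f u"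
proof -
  have "((\<lambda>z. f z / (z - u)) has_contour_integral (2 * of_real pi * \<i> * f u)) (circlepath 0 1)"
    using Cauchy_integral_circlepath[OF f] u by simp
  then have "contour_integral (circlepath 0 1) (\<lambda>z. f z / (z - u)) = 2 * of_real pi * \<i> * f u"
    by (rule contour_integral_unique)
  moreover have "contour_integral (circlepath 0 1) (\<lambda>z. f z / (z - u)) =
      contour_integral (circlepath 0 1) (\<lambda>z. (f z / (1 - cnj z * u)) / z)"
  proof (rule contour_integral_cong)
    fix z assume "z \<in> path_image (circlepath 0 1)"
    then have z: "cmod z = 1" by simp
    then have "z * cnj z = 1" by (simp flip: complex_norm_square)
    then have "(1 - cnj z * u) * z = z - u" by (simp add: algebra_simps)
    then show "f z / (z - u) = f z / (1 - cnj z * u) / z" by simp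
  qed simp
  ultimately show ?thesis
    unfolding contour_integral_circlepath_cmean by simp
qed

lemma cmean_holomorphic:
  assumes "continuous_on (cball 0 1) f" "f holomorphic_on ball 0 1"
  shows "cmean f = f 0"
  using cmean_Szego[OF assms, of 0] by simp

lemma cmean_power: "cmean (\<lambda>z. z powi k) = (if k = 0 then 1 else 0)"
proof -
  have *: "cmean (\<lambda>z. z ^ n) = 0" if "n > 0" for n
    using that by (subst cmean_holomorphic) (auto intro!: continuous_intros holomorphic_intros)
  show ?thesis
  proof (cases "k \<ge> 0")
    case True
    then show ?thesis
      using *[of "nat k"] by (auto simp: power_int_def)
  next
    case False
    have "cmean (\<lambda>z. z powi k) = cmean (\<lambda>z. cnj (z ^ nat (- k)))"
    proof (rule cmean_cong)
      fix z assume z: "cmod z = 1"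
      then have "inverse z = cnj z" by (simp add: inverse_eq_divide divide_conv_cnj)
      then show "z powi k = cnj (z ^ nat (- k))" using False by (simp add: power_int_def)
    qed
    also have "\<dots> = 0"
      using False by (subst cmean_cnj) (simp add: *)
    finally show ?thesis using False by simp
  qed
qed

lemma powi_circ: "cmod z = 1 \<Longrightarrow> z powi (- k) = cnj (z powi k)"
  by (simp add: power_int_minus inverse_eq_divide divide_conv_cnj norm_power_int)

text \<open>\<open>h\<close> is the partial Fourier sum of \<open>g\<close>. The mixed means of
  \<open>g\<close> and \<open>h\<close> and the squared mean of \<open>h\<close> all equal the sum
  of the \<open>|c a|\<^sup>2\<close>; the claim is nonnegativity of the mean of
  \<open>|g - h|\<^sup>2\<close>.\<close>

lemma cmean_Bessel:
  assumes g: "continuous_on circ g"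
  shows "(\<Sum>a<N. (cmod (cmean (\<lambda>z. g z * z powi (- int a))))\<^sup>2) \<le> Re (cmean (\<lambda>z. of_real ((cmod (g z))\<^sup>2)))"
proof -
  define c where "c a = cmean (\<lambda>z. g z * z powi (- int a))" for a
  define h where "h z = (\<Sum>a<N. c a * z powi int a)" for z
  have pc: "continuous_on circ (\<lambda>z. z powi k)" for k :: int
    by (intro continuous_intros) auto
  have hc: "continuous_on circ h"
    unfolding h_def by (intro continuous_intros pc)
  have gh: "cmean (\<lambda>z. g z * cnj (h z)) = (\<Sum>a<N. of_real ((cmod (c a))\<^sup>2))"
  proof -
    have "cmean (\<lambda>z. g z * cnj (h z)) = cmean (\<lambda>z. \<Sum>a<N. cnj (c a) * (g z * z powi (- int a)))"
      by (rule cmean_cong) (simp add: h_def sum_distrib_left powi_circ ac_simps)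
    also have "\<dots> = (\<Sum>a<N. cnj (c a) * c a)"
      by (subst cmean_sum) (auto intro!: continuous_intros g pc simp: cmean_cmult c_def)
    also have "\<dots> = (\<Sum>a<N. of_real ((cmod (c a))\<^sup>2))"
      by (intro sum.cong refl) (simp only: complex_norm_square mult.commute)
    finally show ?thesis .
  qed
  have hh: "cmean (\<lambda>z. h z * cnj (h z)) = (\<Sum>a<N. of_real ((cmod (c a))\<^sup>2))"
  proof -
    have "cmean (\<lambda>z. h z * z powi (- int b)) = c b" if "b < N" for b
    proof -
      have "cmean (\<lambda>z. h z * z powi (- int b)) = cmean (\<lambda>z. \<Sum>a<N. c a * z powi (int a - int b))"
        unfolding h_def sum_distrib_right
      proof (intro cmean_cong sum.cong refl)
        fix z :: complex and a assume "cmod z = 1"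
        then have "z \<noteq> 0" by auto
        then show "c a * z powi int a * z powi (- int b) = c a * z powi (int a - int b)"
          using power_int_add[of z "int a" "- int b"] by (simp add: mult.assoc del: power_int_of_nat)
      qed
      also have "\<dots> = (\<Sum>a<N. c a * (if a = b then 1 else 0))"
        by (subst cmean_sum) (auto intro!: continuous_intros pc sum.cong simp: cmean_cmult cmean_power)
      finally show ?thesis using that by (simp add: mult_delta_right)
    qed
    note hb = this
    have "cmean (\<lambda>z. h z * cnj (h z)) = cmean (\<lambda>z. \<Sum>a<N. cnj (c a) * (h z * z powi (- int a)))"
      by (rule cmean_cong) (simp add: h_def[of "_"] sum_distrib_left powi_circ ac_simps)
    also have "\<dots> = (\<Sum>a<N. cnj (c a) * c a)"
      by (subst cmean_sum) (auto intro!: continuous_intros hc pc simp: cmean_cmult hb)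
    also have "\<dots> = (\<Sum>a<N. of_real ((cmod (c a))\<^sup>2))"
      by (intro sum.cong refl) (simp only: complex_norm_square mult.commute)
    finally show ?thesis .
  qed
  have hg: "cmean (\<lambda>z. h z * cnj (g z)) = (\<Sum>a<N. of_real ((cmod (c a))\<^sup>2))"
    using cmean_cnj[of "\<lambda>z. g z * cnj (h z)"] by (simp add: gh mult.commute)
  have "0 \<le> Re (cmean (\<lambda>z. of_real ((cmod (g z - h z))\<^sup>2)))"
    by (rule cmean_nonneg) (auto intro!: continuous_intros g hc)
  also have "(\<lambda>z. complex_of_real ((cmod (g z - h z))\<^sup>2)) =
      (\<lambda>z. (of_real ((cmod (g z))\<^sup>2) - g z * cnj (h z)) - (h z * cnj (g z) - h z * cnj (h z)))"
    by (simp only: complex_norm_square complex_cnj_diff ring_distribs) (simp add: algebra_simps)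
  also have "cmean \<dots> = (cmean (\<lambda>z. of_real ((cmod (g z))\<^sup>2)) - cmean (\<lambda>z. g z * cnj (h z))) -
      (cmean (\<lambda>z. h z * cnj (g z)) - cmean (\<lambda>z. h z * cnj (h z)))"
    by (subst cmean_diff, (intro continuous_intros g hc)+)+ simp
  also have "\<dots> = cmean (\<lambda>z. of_real ((cmod (g z))\<^sup>2)) - (\<Sum>a<N. of_real ((cmod (c a))\<^sup>2))"
    by (simp add: gh hg hh)
  finally show ?thesis
    by (simp add: c_def)
qed

text \<open>Riemann-Lebesgue for continuous functions, from the summability in Bessel's
  inequality.\<close>

lemma cmean_powi_tendsto_0:
  assumes g: "continuous_on circ g"
  shows "(\<lambda>a. cmean (\<lambda>z. g z * z powi (- int a))) \<longlonglongrightarrow> 0"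
proof -
  have "summable (\<lambda>a. (cmod (cmean (\<lambda>z. g z * z powi (- int a))))\<^sup>2)"
    by (rule summableI_nonneg_bounded[OF _ cmean_Bessel[OF g]]) simp
  then have "(\<lambda>a. (cmod (cmean (\<lambda>z. g z * z powi (- int a))))\<^sup>2) \<longlonglongrightarrow> 0"
    by (rule summable_LIMSEQ_zero)
  then have "(\<lambda>a. sqrt ((cmod (cmean (\<lambda>z. g z * z powi (- int a))))\<^sup>2)) \<longlonglongrightarrow> sqrt 0"
    by (rule tendsto_real_sqrt)
  then show ?thesis
    by (simp add: tendsto_norm_zero_iff)
qed

lemma cmean_powi_tendsto_0':
  assumes g: "continuous_on circ g"
  shows "(\<lambda>a. cmean (\<lambda>z. g z * z powi (int a))) \<longlonglongrightarrow> 0"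
proof -
  have "(\<lambda>a. cnj (cmean (\<lambda>z. cnj (g z) * z powi (- int a)))) \<longlonglongrightarrow> cnj 0"
    by (intro tendsto_cnj cmean_powi_tendsto_0 continuous_intros g)
  moreover have "cnj (cmean (\<lambda>z. cnj (g z) * z powi (- int a))) = cmean (\<lambda>z. g z * z powi (int a))" for a
    unfolding cmean_cnj[symmetric] by (rule cmean_cong) (simp add: powi_circ)
  ultimately show ?thesis by simp
qed

text \<open>The Szego kernel is a geometric series in \<open>cnj z * u\<close>. Its partial sums
  contribute nothing, and the remainder is \<open>u ^ N\<close> times a Fourier coefficient of the
  quotient \<open>h\<close>, which tends to \<open>0\<close>.\<close>

lemma cmean_geometric_zero:
  assumes g: "continuous_on circ g" and u: "cmod u < 1"
    and z: "\<And>a. cmean (\<lambda>z. g z * z powi (- int a)) = 0"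
  shows "cmean (\<lambda>z. g z / (1 - cnj z * u)) = 0"
proof -
  have pc: "continuous_on circ (\<lambda>z. z powi k)" for k :: int
    by (intro continuous_intros) auto
  have ne: "cnj z * u \<noteq> 1" if "cmod z = 1" for z
  proof
    assume "cnj z * u = 1"
    then have "cmod (cnj z * u) = 1" by simp
    then show False using that u by (simp only: norm_mult complex_mod_cnj)
  qed
  define h where "h z = g z / (1 - cnj z * u)" for z
  have hc: "continuous_on circ h"
    unfolding h_def by (intro continuous_intros g) (auto simp: ne)
  have eq: "cmean h = u ^ N * cmean (\<lambda>z. h z * z powi (- int N))" for N
  proof -
    have p: "continuous_on circ (\<lambda>z. g z * z powi (- int a) * u ^ a)" for a
      by (intro continuous_intros g pc)
    have "cmean (\<lambda>z. \<Sum>a<N. g z * z powi (- int a) * u ^ a) = 0"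
      by (subst cmean_sum[OF p]) (simp add: cmean_mult_right z)
    moreover have "cmean (\<lambda>z. \<Sum>a<N. g z * z powi (- int a) * u ^ a) =
        cmean (\<lambda>z. h z - u ^ N * (h z * z powi (- int N)))"
    proof (rule cmean_cong)
      fix z assume z: "cmod z = 1"
      have "z powi (- int a) * u ^ a = (cnj z * u) ^ a" for a
        using z by (simp add: powi_circ power_mult_distrib)
      note pw = this
      have "(\<Sum>a<N. g z * z powi (- int a) * u ^ a) = g z * (\<Sum>a<N. (cnj z * u) ^ a)"
        by (simp add: sum_distrib_left mult.assoc pw)
      also have "\<dots> = g z * ((1 - (cnj z * u) ^ N) / (1 - cnj z * u))"
        using ne[OF z] by (subst sum_gp_strict) auto
      also have "\<dots> = h z - h z * (z powi (- int N) * u ^ N)"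
        unfolding pw h_def by (simp add: diff_divide_distrib algebra_simps)
      finally show "(\<Sum>a<N. g z * z powi (- int a) * u ^ a) = h z - u ^ N * (h z * z powi (- int N))"
        by (simp add: ac_simps)
    qed
    moreover have "\<dots> = cmean h - u ^ N * cmean (\<lambda>z. h z * z powi (- int N))"
      by (subst cmean_diff) (auto intro!: continuous_intros hc pc simp: cmean_cmult)
    ultimately show ?thesis by simp
  qed
  have "(\<lambda>N. u ^ N * cmean (\<lambda>z. h z * z powi (- int N))) \<longlonglongrightarrow> 0 * 0"
    by (intro tendsto_mult cmean_powi_tendsto_0 hc LIMSEQ_power_zero u)
  then have "(\<lambda>N. cmean h) \<longlonglongrightarrow> 0"
    by (simp add: eq[symmetric])
  then show ?thesis
    unfolding h_def by (simp add: LIMSEQ_const_iff)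
qed

lemma continuous_on_cmean:
  assumes f: "continuous_on (A \<times> circ) (\<lambda>(z, w). f z w)"
  shows "continuous_on A (\<lambda>z. cmean (f z))"
proof -
  have tc: "continuous_on (A \<times> cbox 0 (2 * pi)) (\<lambda>x. (fst x, cis (snd x)))"
    by (intro continuous_intros)
  have ti: "(\<lambda>x. (fst x, cis (snd x))) ` (A \<times> cbox 0 (2 * pi)) \<subseteq> A \<times> circ"
    by auto
  have "continuous_on (A \<times> cbox 0 (2 * pi)) (\<lambda>x. case x of (z, t) \<Rightarrow> f z (cis t))"
    using continuous_on_compose2[OF f, of "A \<times> cbox 0 (2 * pi)" "\<lambda>x. (fst x, cis (snd x))", OF tc ti]
    by (simp add: case_prod_unfold)
  from integral_continuous_on_param[OF this] show ?thesis
    unfolding cmean_def by (intro continuous_intros) auto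
qed

text \<open>Fubini for continuous functions; it links the double integral in the moments to iterated
  means and allows either order of the variables.\<close>

lemma cmean_torus_integral:
  assumes f: "continuous_on (circ \<times> circ) (\<lambda>(z, w). f z w)"
  shows "integral (cbox (0, 0) (2 * pi, 2 * pi)) (\<lambda>(s, t). f (cis s) (cis t)) =
    of_real ((2 * pi)\<^sup>2) * cmean (\<lambda>z. cmean (f z))"
    and "continuous_on (cbox (0, 0) (2 * pi, 2 * pi)) (\<lambda>(s, t). f (cis s) (cis t))"
    and "cmean (\<lambda>z. cmean (f z)) = cmean (\<lambda>w. cmean (\<lambda>z. f z w))"
proof -
  let ?B = "cbox (0, 0) (2 * pi, 2 * pi) :: (real \<times> real) set"
  have tc: "continuous_on ?B (\<lambda>x. (cis (fst x), cis (snd x)))"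
    by (intro continuous_intros)
  have ti: "(\<lambda>x. (cis (fst x), cis (snd x))) ` ?B \<subseteq> circ \<times> circ"
    by auto
  show c: "continuous_on ?B (\<lambda>(s, t). f (cis s) (cis t))"
    using continuous_on_compose2[OF f, of ?B "\<lambda>x. (cis (fst x), cis (snd x))", OF tc ti]
    by (simp add: case_prod_unfold)
  show "integral ?B (\<lambda>(s, t). f (cis s) (cis t)) = of_real ((2 * pi)\<^sup>2) * cmean (\<lambda>z. cmean (f z))"
    using integral_prod_continuous[OF c]
    by (simp add: cmean_def power2_eq_square)
  show "cmean (\<lambda>z. cmean (f z)) = cmean (\<lambda>w. cmean (\<lambda>z. f z w))"
    using integral_swap_continuous[OF c]
    by (simp add: cmean_def)
qed

section \<open>Bernstein-Szego functionals\<close>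

definition is_poly :: "laurent \<Rightarrow> bool" where
  "is_poly p \<longleftrightarrow> (\<forall>(i, j)\<in>supp p. 0 \<le> i \<and> 0 \<le> j)"

text \<open>The normalised Bernstein-Szego functional of the weight \<open>1 / |p|\<^sup>2\<close>.
  The iterated form lets one-variable Cauchy theory act on each fibre;
  \<open>bernstein_szego_moment_eq\<close> gives the link to the area integral.\<close>

definition bs :: "laurent \<Rightarrow> laurent \<Rightarrow> complex" where
  "bs p q = cmean (\<lambda>z. cmean (\<lambda>w. leval q z w / of_real ((cmod (leval p z w))\<^sup>2)))"

lemma leval_continuous:
  assumes "0 \<notin> A" "0 \<notin> B"
  shows "continuous_on (A \<times> B) (\<lambda>(z, w). leval q z w)"
  unfolding leval_def case_prod_unfold
  by (intro continuous_intros) (use assms in auto)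

lemma leval_holomorphic_w:
  assumes "\<forall>(i, j)\<in>supp q. 0 \<le> j"
  shows "(\<lambda>w. leval q z w) holomorphic_on A"
proof -
  have "(\<lambda>w. leval q z w) = (\<lambda>w. \<Sum>(i, j)\<in>supp q. coef q (i, j) * z powi i * w ^ nat j)"
    unfolding leval_def by (intro ext sum.cong refl) (use assms in \<open>auto simp: power_int_def\<close>)
  then show ?thesis
    by (simp add: case_prod_unfold) (intro holomorphic_intros)
qed

lemma leval_holomorphic_z:
  assumes "\<forall>(i, j)\<in>supp q. 0 \<le> i"
  shows "(\<lambda>z. leval q z w) holomorphic_on A"
proof -
  have "(\<lambda>z. leval q z w) = (\<lambda>z. \<Sum>(i, j)\<in>supp q. coef q (i, j) * z ^ nat i * w powi j)"
    unfolding leval_def by (intro ext sum.cong refl) (use assms in \<open>auto simp: power_int_def\<close>)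
  then show ?thesis
    by (simp add: case_prod_unfold) (intro holomorphic_intros)
qed

lemma leval_w_0:
  assumes "\<forall>(i, j)\<in>supp q. 0 < j"
  shows "leval q z 0 = 0"
  unfolding leval_def using assms by (intro sum.neutral) auto

lemma leval_z_0:
  assumes "\<forall>(i, j)\<in>supp q. 0 < i"
  shows "leval q 0 w = 0"
  unfolding leval_def using assms by (intro sum.neutral) auto

lemma continuous_on_slices:
  assumes f: "continuous_on (circ \<times> circ) (\<lambda>(z, w). f z w)"
  shows "cmod z = 1 \<Longrightarrow> continuous_on circ (\<lambda>w. f z w)"
    and "cmod w = 1 \<Longrightarrow> continuous_on circ (\<lambda>z. f z w)"
    and "continuous_on (circ \<times> circ) (\<lambda>(w, z). f z w)"
proof -
  show "continuous_on circ (\<lambda>w. f z w)" if "cmod z = 1"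
  proof -
    have "continuous_on circ (\<lambda>w. (z, w))" "(\<lambda>w. (z, w)) ` circ \<subseteq> circ \<times> circ"
      using that by (auto intro!: continuous_intros)
    from continuous_on_compose2[OF f this] show ?thesis by simp
  qed
  show "continuous_on circ (\<lambda>z. f z w)" if "cmod w = 1"
  proof -
    have "continuous_on circ (\<lambda>z. (z, w))" "(\<lambda>z. (z, w)) ` circ \<subseteq> circ \<times> circ"
      using that by (auto intro!: continuous_intros)
    from continuous_on_compose2[OF f this] show ?thesis by simp
  qed
  have "continuous_on (circ \<times> circ) (\<lambda>x. (snd x, fst x))" "(\<lambda>x. (snd x, fst x)) ` (circ \<times> circ) \<subseteq> circ \<times> circ"
    by (auto intro!: continuous_intros simp: mem_Times_iff simp del: mem_sphere)
  from continuous_on_compose2[OF f this] show "continuous_on (circ \<times> circ) (\<lambda>(w, z). f z w)"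
    by (simp add: case_prod_unfold)
qed

lemma cnj_mult_divide_norm_square: "u \<noteq> 0 \<Longrightarrow> cnj u * a / of_real ((cmod u)\<^sup>2) = a / u"
  by (simp add: complex_norm_square del: of_real_power)

text \<open>Enough for a continuous weight, and it also covers a polynomial of which only the
  reversal is stable.\<close>

locale torus_nonzero =
  fixes p :: laurent
  assumes nz: "cmod z = 1 \<Longrightarrow> cmod w = 1 \<Longrightarrow> leval p z w \<noteq> 0"
begin

lemma quot_continuous:
  "continuous_on (circ \<times> circ) (\<lambda>(z, w). leval q z w / of_real ((cmod (leval p z w))\<^sup>2))"
  unfolding case_prod_unfold
  by (intro continuous_intros leval_continuous[unfolded case_prod_unfold]) (auto simp: nz)

lemma quot_continuous_w:
  assumes "cmod z = 1"
  shows "continuous_on circ (\<lambda>w. leval q z w / of_real ((cmod (leval p z w))\<^sup>2))"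
  using continuous_on_slices(1)[OF quot_continuous assms] .

lemma quot_mean_continuous:
  "continuous_on circ (\<lambda>z. cmean (\<lambda>w. leval q z w / of_real ((cmod (leval p z w))\<^sup>2)))"
  by (rule continuous_on_cmean) (rule quot_continuous)

lemma quot_mean_continuous':
  "continuous_on circ (\<lambda>w. cmean (\<lambda>z. leval q z w / of_real ((cmod (leval p z w))\<^sup>2)))"
  by (rule continuous_on_cmean) (rule continuous_on_slices(3)[OF quot_continuous])

lemma bs_iterated: "bs p q = cmean (\<lambda>w. cmean (\<lambda>z. leval q z w / of_real ((cmod (leval p z w))\<^sup>2)))"
  unfolding bs_def by (rule cmean_torus_integral(3)) (rule quot_continuous)

lemma bs_functional: "laurent_functional (bs p)"
proof
  fix q r c
  let ?d = "\<lambda>z w. complex_of_real ((cmod (leval p z w))\<^sup>2)"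
  have "bs p (q + r) = cmean (\<lambda>z. cmean (\<lambda>w. leval q z w / ?d z w) + cmean (\<lambda>w. leval r z w / ?d z w))"
    unfolding bs_def
    by (intro cmean_cong)
      (simp add: cmean_add[OF quot_continuous_w quot_continuous_w, symmetric] leval_add add_divide_distrib
        del: of_real_power)
  then show "bs p (q + r) = bs p q + bs p r"
    by (simp add: cmean_add[OF quot_mean_continuous quot_mean_continuous] bs_def del: of_real_power)
  show "bs p (lscale c q) = c * bs p q"
    by (simp add: bs_def cmean_cmult flip: times_divide_eq_right)
  have "bs p (dagger q) = cmean (\<lambda>z. cmean (\<lambda>w. cnj (leval q z w / ?d z w)))"
    unfolding bs_def by (intro cmean_cong) (simp add: leval_dagger_torus)
  then show "bs p (dagger q) = cnj (bs p q)"
    by (simp add: bs_def cmean_cnj del: complex_cnj_divide)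
qed

sublocale laurent_functional "bs p"
  by (rule bs_functional)

lemma bs_inn_nonneg: "0 \<le> Re (inn q q)"
proof -
  let ?g = "\<lambda>z w. (cmod (leval q z w))\<^sup>2 / (cmod (leval p z w))\<^sup>2"
  have c: "continuous_on (circ \<times> circ) (\<lambda>(z, w). ?g z w)"
    unfolding case_prod_unfold
    by (intro continuous_intros leval_continuous[unfolded case_prod_unfold]) (auto simp: nz)
  have cw: "continuous_on circ (\<lambda>w. ?g z w)" if "cmod z = 1" for z
    using continuous_on_slices(1)[OF c that] .
  have "continuous_on (circ \<times> circ) (\<lambda>(z, w). complex_of_real (?g z w))"
    unfolding case_prod_unfold by (rule continuous_on_of_real[OF c[unfolded case_prod_unfold]])
  then have cm: "continuous_on circ (\<lambda>z. cmean (\<lambda>w. complex_of_real (?g z w)))"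
    by (rule continuous_on_cmean)
  have "inn q q = cmean (\<lambda>z. cmean (\<lambda>w. of_real (?g z w)))"
    unfolding linner_def bs_def
    by (intro cmean_cong) (simp add: leval_mult_torus leval_dagger_torus flip: complex_norm_square)
  also have "\<dots> = cmean (\<lambda>z. of_real (Re (cmean (\<lambda>w. of_real (?g z w)))))"
  proof (rule cmean_cong)
    fix z assume z: "cmod z = 1"
    have "cnj (cmean (\<lambda>w. of_real (?g z w))) = cmean (\<lambda>w. of_real (?g z w))"
      unfolding cmean_cnj[symmetric] by simp
    then show "cmean (\<lambda>w. of_real (?g z w)) = of_real (Re (cmean (\<lambda>w. of_real (?g z w))))"
      by (simp add: complex_eq_iff)
  qed
  finally show ?thesis
    using cmean_nonneg[of "\<lambda>z. Re (cmean (\<lambda>w. of_real (?g z w)))"]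
      cmean_nonneg[OF cw] continuous_on_Re[OF cm] by simp
qed

text \<open>After averaging over \<open>z\<close>, these numbers are Fourier coefficients of a
  continuous function of \<open>w\<close>.\<close>

lemma bs_decay_w: "(\<lambda>N. bs p (lmono 0 (int N) * q)) \<longlonglongrightarrow> 0"
proof -
  have "bs p (lmono 0 (int N) * q) =
      cmean (\<lambda>w. cmean (\<lambda>z. leval q z w / of_real ((cmod (leval p z w))\<^sup>2)) * w powi (int N))" for N
    unfolding bs_iterated cmean_mult_right[symmetric]
    by (intro cmean_cong) (simp add: leval_mult_torus leval_lmono)
  then show ?thesis
    using cmean_powi_tendsto_0'[OF quot_mean_continuous'[of q]] by (simp only:)
qed

lemma bs_decay_z: "(\<lambda>N. bs p (lmono (- int N) 0 * q)) \<longlonglongrightarrow> 0"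
proof -
  have "bs p (lmono (- int N) 0 * q) =
      cmean (\<lambda>z. cmean (\<lambda>w. leval q z w / of_real ((cmod (leval p z w))\<^sup>2)) * z powi (- int N))" for N
    unfolding bs_def cmean_mult_right[symmetric]
    by (intro cmean_cong) (simp add: leval_mult_torus leval_lmono)
  then show ?thesis
    using cmean_powi_tendsto_0[OF quot_mean_continuous[of q]] by (simp only:)
qed

text \<open>On the torus \<open>p * dagger p\<close> cancels the weight and leaves the plain mean of
  \<open>q\<close>.\<close>

lemma bs_p_dagger_p: "bs p (p * dagger p * q) = coef q (0, 0)"
proof -
  have "bs p (p * dagger p * q) = cmean (\<lambda>z. cmean (\<lambda>w. leval q z w))"
    unfolding bs_def
    by (intro cmean_cong)
      (simp add: leval_mult_torus leval_dagger_torus nz flip: complex_norm_square)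
  also have "\<dots> = coef q (0, 0)"
  proof (induction q rule: laurent_induct)
    case (single i j c)
    then show ?case
      by (simp add: cmean_cmult cmean_mult_right cmean_power lookup_single when_def)
  next
    case (add q r)
    have c: "continuous_on (circ \<times> circ) (\<lambda>(z, w). leval q z w)" for q
      by (rule leval_continuous) auto
    have cw: "continuous_on circ (\<lambda>w. leval q z w)" if "cmod z = 1" for q z
      using continuous_on_slices(1)[OF c that] .
    have "cmean (\<lambda>z. cmean (\<lambda>w. leval (q + r) z w)) =
        cmean (\<lambda>z. cmean (\<lambda>w. leval q z w) + cmean (\<lambda>w. leval r z w))"
      by (intro cmean_cong) (simp add: leval_add cmean_add cw)
    also have "\<dots> = cmean (\<lambda>z. cmean (\<lambda>w. leval q z w)) + cmean (\<lambda>z. cmean (\<lambda>w. leval r z w))"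
      by (intro cmean_add continuous_on_cmean c)
    finally show ?case
      by (simp add: add lookup_add)
  qed auto
  finally show ?thesis .
qed

lemma bernstein_szego_moment_eq: "bernstein_szego_moment p k l = bs p (lmono (- k) (- l))"
proof -
  let ?f = "\<lambda>z w. z powi (- k) * w powi (- l) / of_real ((cmod (leval p z w))\<^sup>2)"
  let ?B = "{0..2 * pi} \<times> {0..2 * pi} :: (real \<times> real) set"
  have B: "?B = cbox (0, 0) (2 * pi, 2 * pi)"
    by (simp add: cbox_Pair_eq)
  have c: "continuous_on (circ \<times> circ) (\<lambda>(z, w). ?f z w)"
    using quot_continuous[of "lmono (- k) (- l)"] by (simp add: leval_lmono)
  have ex: "exp (- \<i> * of_int a * of_real t) = cis t powi (- a)" for a t
    by (simp only: cis_power_int) (simp add: cis_conv_exp algebra_simps)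
  have eq: "(\<lambda>(\<theta>, \<phi>). exp (- \<i> * of_int k * of_real \<theta>) * exp (- \<i> * of_int l * of_real \<phi>) /
         of_real ((cmod (leval p (exp (\<i> * of_real \<theta>)) (exp (\<i> * of_real \<phi>))))\<^sup>2)) =
      (\<lambda>(s, t). ?f (cis s) (cis t))"
    unfolding ex by (simp add: cis_conv_exp)
  have int: "set_integrable lborel ?B (\<lambda>(s, t). ?f (cis s) (cis t))"
    unfolding B set_integrable_def
    using borel_integrable_compact[OF compact_cbox cmean_torus_integral(2)[OF c]]
    by (simp add: indicator_scaleR_eq_if case_prod_unfold)
  have "set_lebesgue_integral lborel ?B (\<lambda>(s, t). ?f (cis s) (cis t)) =
      integral ?B (\<lambda>(s, t). ?f (cis s) (cis t))"
    by (rule set_borel_integral_eq_integral(2)[OF int])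
  also have "\<dots> = of_real ((2 * pi)\<^sup>2) * cmean (\<lambda>z. cmean (?f z))"
    unfolding B by (rule cmean_torus_integral(1)[OF c])
  finally show ?thesis
    unfolding bernstein_szego_moment_def eq bs_def leval_lmono
    by (simp add: power_divide)
qed

end

locale stable_polynomial =
  fixes p :: laurent
  assumes poly: "is_poly p" and stable: "stable_poly p"
begin

lemma stable_nz: "cmod z \<le> 1 \<Longrightarrow> cmod w \<le> 1 \<Longrightarrow> leval p z w \<noteq> 0"
  using stable by (auto simp: stable_poly_def)

sublocale torus_nonzero p
  by unfold_locales (auto simp: stable_nz)

lemma quot_hol_w:
  assumes "\<forall>(i, j)\<in>supp q. 0 \<le> j" "cmod z \<le> 1"
  shows "(\<lambda>w. leval q z w / leval p z w) holomorphic_on ball 0 1"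
    and "continuous_on (cball 0 1) (\<lambda>w. leval q z w / leval p z w)"
proof -
  have p: "\<forall>(i, j)\<in>supp p. 0 \<le> j" using poly by (auto simp: is_poly_def)
  show "(\<lambda>w. leval q z w / leval p z w) holomorphic_on ball 0 1"
    using assms by (intro holomorphic_intros leval_holomorphic_w p) (auto simp: stable_nz)
  show "continuous_on (cball 0 1) (\<lambda>w. leval q z w / leval p z w)"
    using assms
    by (intro continuous_intros holomorphic_on_imp_continuous_on leval_holomorphic_w p) (auto simp: stable_nz)
qed

lemma quot_hol_z:
  assumes "\<forall>(i, j)\<in>supp q. 0 \<le> i" "cmod w \<le> 1"
  shows "(\<lambda>z. leval q z w / leval p z w) holomorphic_on ball 0 1"
    and "continuous_on (cball 0 1) (\<lambda>z. leval q z w / leval p z w)"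
proof -
  have p: "\<forall>(i, j)\<in>supp p. 0 \<le> i" using poly by (auto simp: is_poly_def)
  show "(\<lambda>z. leval q z w / leval p z w) holomorphic_on ball 0 1"
    using assms by (intro holomorphic_intros leval_holomorphic_z p) (auto simp: stable_nz)
  show "continuous_on (cball 0 1) (\<lambda>z. leval q z w / leval p z w)"
    using assms
    by (intro continuous_intros holomorphic_on_imp_continuous_on leval_holomorphic_z p) (auto simp: stable_nz)
qed

text \<open>On the torus the integrand is \<open>q / p\<close>. For fixed \<open>z\<close> this is
  holomorphic in \<open>w\<close> on the disc, as \<open>p\<close> has no zero there, so its mean is
  the value at \<open>w = 0\<close>, where \<open>q\<close> vanishes.\<close>

lemma cmean_dagger_w:
  assumes q: "\<forall>(i, j)\<in>supp q. 0 < j" and z: "cmod z = 1"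
  shows "cmean (\<lambda>w. leval (dagger p * q) z w / of_real ((cmod (leval p z w))\<^sup>2)) = 0"
proof -
  have q': "\<forall>(i, j)\<in>supp q. 0 \<le> j" using q by fastforce
  have "cmean (\<lambda>w. leval (dagger p * q) z w / of_real ((cmod (leval p z w))\<^sup>2)) =
      cmean (\<lambda>w. leval q z w / leval p z w)"
    using z by (intro cmean_cong)
      (simp add: leval_mult_torus leval_dagger_torus cnj_mult_divide_norm_square nz del: of_real_power)
  also have "\<dots> = leval q z 0 / leval p z 0"
    using z by (intro cmean_holomorphic quot_hol_w q') auto
  finally show ?thesis
    by (simp add: leval_w_0[OF q])
qed

lemma cmean_dagger_z:
  assumes q: "\<forall>(i, j)\<in>supp q. 0 < i" and w: "cmod w = 1"
  shows "cmean (\<lambda>z. leval (dagger p * q) z w / of_real ((cmod (leval p z w))\<^sup>2)) = 0"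
proof -
  have q': "\<forall>(i, j)\<in>supp q. 0 \<le> i" using q by fastforce
  have "cmean (\<lambda>z. leval (dagger p * q) z w / of_real ((cmod (leval p z w))\<^sup>2)) =
      cmean (\<lambda>z. leval q z w / leval p z w)"
    using w by (intro cmean_cong)
      (simp add: leval_mult_torus leval_dagger_torus cnj_mult_divide_norm_square nz del: of_real_power)
  also have "\<dots> = leval q 0 w / leval p 0 w"
    using w by (intro cmean_holomorphic quot_hol_z q') auto
  finally show ?thesis
    by (simp add: leval_z_0[OF q])
qed

lemma bs_dagger_zero:
  assumes "(\<forall>(i, j)\<in>supp q. 0 < i) \<or> (\<forall>(i, j)\<in>supp q. 0 < j)"
  shows "bs p (dagger p * q) = 0"
  using assms
proof
  assume q: "\<forall>(i, j)\<in>supp q. 0 < i"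
  have "bs p (dagger p * q) = cmean (\<lambda>w. 0)"
    unfolding bs_iterated by (intro cmean_cong cmean_dagger_z[OF q])
  then show ?thesis by simp
next
  assume q: "\<forall>(i, j)\<in>supp q. 0 < j"
  have "bs p (dagger p * q) = cmean (\<lambda>z. 0)"
    unfolding bs_def by (intro cmean_cong cmean_dagger_w[OF q])
  then show ?thesis by simp
qed

text \<open>The Hermitian conjugate of \<open>bs_dagger_zero\<close>.\<close>

lemma bs_p_zero:
  assumes "(\<forall>(i, j)\<in>supp q. i < 0) \<or> (\<forall>(i, j)\<in>supp q. j < 0)"
  shows "bs p (p * q) = 0"
proof -
  have "bs p (dagger p * dagger q) = 0"
    using assms by (intro bs_dagger_zero) (auto simp: supp_dagger)
  then show ?thesis
    using L_dagger[of "p * q"] by (simp add: dagger_mult)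
qed

end

section \<open>Orthogonality of rows and columns\<close>

text \<open>Splitting off a root \<open>r\<close> of \<open>q\<close> gives a bounded sequence with
  \<open>e (Suc s) = r * e s\<close>. As \<open>|r| > 1\<close>, it vanishes, which means that
  \<open>c\<close> satisfies the recurrence of the quotient \<open>q'\<close> of smaller
  degree.\<close>

lemma bounded_recurrence_zero:
  fixes q :: "complex poly" and c :: "nat \<Rightarrow> complex"
  assumes "\<And>z. cmod z \<le> 1 \<Longrightarrow> poly q z \<noteq> 0" "\<And>s. cmod (c s) \<le> B"
    and "\<And>s. (\<Sum>l\<le>degree q. coeff q l * c (s + l)) = 0"
  shows "c s = 0"
  using assms
proof (induction "degree q" arbitrary: q s)
  case 0
  then obtain a where "q = [:a:]" by (metis degree_eq_zeroE)
  then show ?case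
    using 0(2)[of 0] 0(4)[of s] by simp
next
  case (Suc d)
  obtain r where r: "poly q r = 0"
    using fundamental_theorem_of_algebra_alt[of q] Suc(2) by (metis degree_pCons_0 nat.distinct(1))
  then obtain q' where q': "q = [:- r, 1:] * q'"
    by (metis dvdE poly_eq_0_iff_dvd)
  have q0: "q' \<noteq> 0" using q' Suc(2) by auto
  then have deg: "degree q = Suc (degree q')"
    unfolding q' by (subst degree_mult_eq) auto
  define e where "e s = (\<Sum>l\<le>degree q'. coeff q' l * c (s + l))" for s
  have "e (Suc s) = r * e s" for s
  proof -
    have "0 = (\<Sum>l\<le>Suc (degree q'). coeff q l * c (s + l))"
      using Suc.prems(3)[of s] deg by simp
    also have "\<dots> = (\<Sum>l\<le>Suc (degree q'). coeff (pCons 0 q') l * c (s + l)) -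
        r * (\<Sum>l\<le>Suc (degree q'). coeff q' l * c (s + l))"
      by (simp add: q' sum_subtractf[symmetric] sum_distrib_left algebra_simps del: sum.atMost_Suc)
    also have "(\<Sum>l\<le>Suc (degree q'). coeff (pCons 0 q') l * c (s + l)) = e (Suc s)"
      unfolding e_def by (subst sum.atMost_Suc_shift) simp
    also have "(\<Sum>l\<le>Suc (degree q'). coeff q' l * c (s + l)) = e s"
      unfolding e_def by (simp add: coeff_eq_0)
    finally show ?thesis by simp
  qed
  then have es: "e s = r ^ s * e 0" for s
    by (induction s) auto
  have r1: "1 < cmod r"
    using Suc.prems(1)[of r] r by force
  have bound: "cmod (e s) \<le> (\<Sum>l\<le>degree q'. cmod (coeff q' l) * B)" for s
    unfolding e_def by (rule sum_norm_le) (simp add: norm_mult mult_left_mono Suc.prems(2))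
  have "e 0 = 0"
  proof (rule ccontr)
    assume "e 0 \<noteq> 0"
    then obtain k where "(\<Sum>l\<le>degree q'. cmod (coeff q' l) * B) / cmod (e 0) < cmod r ^ k"
      using real_arch_pow[OF r1] by blast
    then show False
      using bound[of k] \<open>e 0 \<noteq> 0\<close> es[of k] by (simp add: norm_mult norm_power field_simps)
  qed
  then have "e s = 0" for s using es[of s] by simp
  then show ?case
    using Suc.prems(1) q' deg Suc(2)
    by (intro Suc(1)[of q'] Suc.prems(2)) (auto simp: e_def)
qed

text \<open>The parameters count exponents instead of bounding them: \<open>poly_space n m\<close>
  belongs to \<open>ibox (n + 1) (m + 1)\<close>.\<close>

definition ibox :: "nat \<Rightarrow> nat \<Rightarrow> (int \<times> int) set" where
  "ibox a b = {(i, j). 0 \<le> i \<and> i < int a \<and> 0 \<le> j \<and> j < int b}"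

definition lrestrict :: "(int \<times> int) set \<Rightarrow> laurent \<Rightarrow> laurent" where
  "lrestrict S q = (\<Sum>e\<in>supp q \<inter> S. Poly_Mapping.single e (coef q e))"

lemma coef_lrestrict: "coef (lrestrict S q) e = (if e \<in> S then coef q e else 0)"
proof -
  have "coef (lrestrict S q) e = (\<Sum>x\<in>supp q \<inter> S. if x = e then coef q x else 0)"
    unfolding lrestrict_def lookup_sum by (rule sum.cong) (auto simp: lookup_single when_def)
  then show ?thesis by (auto simp: in_keys_iff)
qed

lemma supp_lrestrict: "supp (lrestrict S q) = supp q \<inter> S"
  by (auto simp: in_keys_iff coef_lrestrict split: if_splits)

lemma lrestrict_split: "q = lrestrict S q + lrestrict (- S) q"
  by (rule poly_mapping_eqI) (simp add: lookup_add coef_lrestrict)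

definition norm1 :: "laurent \<Rightarrow> real" where
  "norm1 q = (\<Sum>e\<in>supp q. cmod (coef q e))"

lemma norm1_shift: "norm1 (lmono k l * q) = norm1 q"
  unfolding norm1_def supp_lmono_mult
  by (subst sum.reindex) (auto simp: inj_on_def coef_lmono_mult case_prod_unfold intro!: sum.cong)

lemma (in laurent_functional) inn_expand_right:
  assumes "finite A" "supp q \<subseteq> A"
  shows "inn p q = (\<Sum>e\<in>A. cnj (coef q e) * inn p (lmono (fst e) (snd e)))"
  by (subst inn_cnj) (subst inn_expand_left[OF assms], simp add: case_prod_unfold inn_cnj[of _ p])

section \<open>Dual vectors of the monomials in a strip\<close>

locale stable_box = stable_polynomial p for p +
  fixes n m :: nat
  assumes p_box: "p \<in> mono_span (ibox (n + 1) (m + 1))"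
begin

text \<open>\<open>V (z\<^sup>i w\<^sup>j)\<close> is the dual vector of \<open>z\<^sup>i w\<^sup>j\<close> among the monomials with \<open>z\<close>-exponents in \<open>[0, n)\<close>: it is
  \<open>|p|\<^sup>2 z\<^sup>i w\<^sup>j\<close> minus two terms orthogonal to these monomials which truncate it to that strip.\<close>

definition V :: "laurent \<Rightarrow> laurent" where
  "V y = p * lrestrict {e. 0 \<le> fst e} (dagger p * y) - dagger p * lrestrict {e. int n \<le> fst e} (p * y)"

lemma supp_p: "(i, j) \<in> supp p \<Longrightarrow> 0 \<le> i \<and> i \<le> int n \<and> 0 \<le> j \<and> j \<le> int m"
  using p_box by (auto simp: mono_span_eq ibox_def)

lemma supp_dagger_p: "(i, j) \<in> supp (dagger p) \<Longrightarrow> - int n \<le> i \<and> i \<le> 0 \<and> - int m \<le> j \<and> j \<le> 0"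
  using supp_p by (fastforce simp: supp_dagger)

text \<open>Split \<open>p * dagger p * y\<close> by \<open>z\<close>-exponents in two ways and
  compare. The definition of \<open>V\<close> shows that no negative \<open>z\<close>-exponent
  occurs, this form that all are below \<open>n\<close>.\<close>

lemma V_alt:
  "V y = dagger p * lrestrict {e. fst e < int n} (p * y) - p * lrestrict {e. fst e < 0} (dagger p * y)"
proof -
  have c: "- {e. 0 \<le> fst e} = {e :: int \<times> int. fst e < 0}" "- {e. int n \<le> fst e} = {e :: int \<times> int. fst e < int n}"
    by auto
  have "p * (dagger p * y) = dagger p * (p * y)" by (simp add: ac_simps)
  then have "p * lrestrict {e. 0 \<le> fst e} (dagger p * y) + p * lrestrict {e. fst e < 0} (dagger p * y) =
      dagger p * lrestrict {e. int n \<le> fst e} (p * y) + dagger p * lrestrict {e. fst e < int n} (p * y)"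
    using lrestrict_split[of "dagger p * y" "{e. 0 \<le> fst e}"] lrestrict_split[of "p * y" "{e. int n \<le> fst e}"]
    unfolding c distrib_left[symmetric] by simp
  then show ?thesis
    unfolding V_def by (simp add: algebra_simps)
qed

lemma V_alt2:
  "V y = p * dagger p * y - p * lrestrict {e. fst e < 0} (dagger p * y) - dagger p * lrestrict {e. int n \<le> fst e} (p * y)"
proof -
  have c: "- {e. 0 \<le> fst e} = {e :: int \<times> int. fst e < 0}" by auto
  have "p * dagger p * y = p * (lrestrict {e. 0 \<le> fst e} (dagger p * y) + lrestrict {e. fst e < 0} (dagger p * y))"
    using lrestrict_split[of "dagger p * y" "{e. 0 \<le> fst e}"] unfolding c by (simp add: mult.assoc)
  then show ?thesis
    unfolding V_def by (simp add: algebra_simps)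
qed

lemma V_supp:
  assumes y: "\<And>i j. (i, j) \<in> supp y \<Longrightarrow> 0 \<le> i \<and> i < int n \<and> a \<le> j \<and> j \<le> b"
    and e: "(i, j) \<in> supp (V y)"
  shows "0 \<le> i" "i < int n" "a - int m \<le> j" "j \<le> b + int m"
proof -
  have "0 \<le> i \<and> a - int m \<le> j \<and> j \<le> b + int m"
  proof -
    have "(i, j) \<in> supp (p * lrestrict {e. 0 \<le> fst e} (dagger p * y)) \<or>
        (i, j) \<in> supp (dagger p * lrestrict {e. int n \<le> fst e} (p * y))"
      using e by (auto simp: V_def in_keys_iff lookup_minus)
    then show ?thesis
      by (elim disjE supp_multE; fastforce simp: supp_lrestrict dest: supp_p supp_dagger_p y elim!: supp_multE)
  qed
  moreover have "i < int n"
  proof -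
    have "(i, j) \<in> supp (dagger p * lrestrict {e. fst e < int n} (p * y)) \<or>
        (i, j) \<in> supp (p * lrestrict {e. fst e < 0} (dagger p * y))"
      using e by (auto simp: V_alt in_keys_iff lookup_minus)
    then show ?thesis
      by (elim disjE supp_multE; fastforce simp: supp_lrestrict dest: supp_p supp_dagger_p)
  qed
  ultimately show "0 \<le> i" "i < int n" "a - int m \<le> j" "j \<le> b + int m" by auto
qed

text \<open>In \<open>V_alt2\<close> the first term reads off the coefficient. After division by
  \<open>z\<^sup>k\<close> the two truncated factors have only negative, respectively only positive,
  \<open>z\<close>-exponents, so their terms vanish.\<close>

lemma V_moment:
  assumes k: "0 \<le> k" "k < int n"
  shows "inn (V y) (lmono k j) = coef y (k, j)"
proof -
  let ?q = "lmono (- k) (- j)"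
  have "inn (V y) (lmono k j) = bs p (p * dagger p * (?q * y)) - bs p (p * (?q * lrestrict {e. fst e < 0} (dagger p * y))) -
      bs p (dagger p * (?q * lrestrict {e. int n \<le> fst e} (p * y)))"
    by (simp add: linner_def V_alt2 left_diff_distrib right_diff_distrib L_diff ac_simps)
  also have "bs p (p * dagger p * (?q * y)) = coef y (k, j)"
    by (simp add: bs_p_dagger_p coef_lmono_mult)
  also have "bs p (p * (?q * lrestrict {e. fst e < 0} (dagger p * y))) = 0"
    by (rule bs_p_zero) (use k in \<open>auto simp: supp_lmono_mult supp_lrestrict\<close>)
  also have "bs p (dagger p * (?q * lrestrict {e. int n \<le> fst e} (p * y))) = 0"
    by (rule bs_dagger_zero) (use k in \<open>auto simp: supp_lmono_mult supp_lrestrict\<close>)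
  finally show ?thesis by simp
qed

lemma V_inn:
  assumes q: "\<And>i j. (i, j) \<in> supp q \<Longrightarrow> 0 \<le> i \<and> i < int n"
    and A: "finite A" "supp q \<subseteq> A \<or> supp y \<subseteq> A"
  shows "inn (V y) q = (\<Sum>e\<in>A. coef y e * cnj (coef q e))"
proof -
  let ?B = "A \<union> supp q"
  have "inn (V y) q = (\<Sum>e\<in>?B. cnj (coef q e) * inn (V y) (lmono (fst e) (snd e)))"
    by (rule inn_expand_right) (use A in auto)
  also have "\<dots> = (\<Sum>e\<in>?B. coef y e * cnj (coef q e))"
  proof (rule sum.cong)
    fix e
    show "cnj (coef q e) * inn (V y) (lmono (fst e) (snd e)) = coef y e * cnj (coef q e)"
    proof (cases "e \<in> supp q")
      case True
      then show ?thesis using q[of "fst e" "snd e"] by (simp add: V_moment)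
    qed (simp add: in_keys_iff)
  qed simp
  also have "\<dots> = (\<Sum>e\<in>A. coef y e * cnj (coef q e))"
    by (rule sum.mono_neutral_right) (use A in \<open>auto simp: in_keys_iff subset_iff\<close>)
  finally show ?thesis .
qed

text \<open>\<open>V\<close> inverts the moment matrix of the strip; by \<open>V_supp\<close> this
  inverse has bandwidth \<open>m\<close> in \<open>w\<close>.\<close>

lemma V_dual:
  assumes q: "\<And>i j. (i, j) \<in> supp q \<Longrightarrow> 0 \<le> i \<and> i < int n"
  shows "coef q (i, j) = inn q (V (lmono i j))"
proof -
  have "inn (V (lmono i j)) q = (\<Sum>e\<in>{(i, j)}. coef (lmono i j) e * cnj (coef q e))"
    by (rule V_inn[OF q]) (auto simp: lmono_def)
  then show ?thesis
    using inn_cnj[of q "V (lmono i j)"] by (simp add: coef_lmono)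
qed

lemma V_shift: "V (lmono 0 l * y) = lmono 0 l * V y"
proof -
  have r: "lrestrict {e. P (fst e)} (lmono 0 l * y) = lmono 0 l * lrestrict {e. P (fst e)} y" for P y
    by (rule poly_mapping_eqI) (auto simp: coef_lrestrict coef_lmono_mult)
  show ?thesis
    unfolding V_def using r[of "\<lambda>i. 0 \<le> i" "dagger p * y"] r[of "\<lambda>i. int n \<le> i" "p * y"]
    by (simp add: right_diff_distrib mult.left_commute[of _ "lmono 0 l"])
qed

text \<open>Cut the moments \<open>a\<close> of \<open>x\<close> off below row \<open>-N\<close> to get \<open>y N\<close>. As \<open>V\<close> has width \<open>m\<close> in \<open>w\<close> and \<open>m\<close>
  consecutive rows of \<open>a\<close> vanish, \<open>V (y N)\<close> agrees in the negative rows with \<open>x\<close>, that is with \<open>0\<close>,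
  except near the cut, where \<open>a\<close> decays.\<close>

lemma row_zero:
  assumes x: "x \<in> mono_span (ibox n (m + 1))"
    and xQ: "\<And>i j. (i, j) \<in> ibox n m \<Longrightarrow> inn x (lmono i j) = 0"
    and k: "0 \<le> k" "k < int n" and j: "j < int m"
  shows "inn x (lmono k j) = 0"
proof (cases "0 \<le> j")
  case True
  then show ?thesis using xQ k j by (auto simp: ibox_def)
next
  case False
  define a where "a e = inn x (lmono (fst e) (snd e))" for e
  define S where "S N = {0..<int n} \<times> {- int N..<0}" for N
  define y where "y N = (\<Sum>e\<in>S N. Poly_Mapping.single e (a e))" for N
  have cy: "coef (y N) e = (if e \<in> S N then a e else 0)" for N e
  proof -
    have "coef (y N) e = (\<Sum>u\<in>S N. if u = e then a u else 0)"
      unfolding y_def lookup_sum by (rule sum.cong) (auto simp: lookup_single when_def)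
    then show ?thesis by (simp add: S_def)
  qed
  have sy: "supp (y N) \<subseteq> S N" for N
    by (auto simp: in_keys_iff cy split: if_splits)
  have sx: "0 \<le> i \<and> i < int n \<and> 0 \<le> l" if "(i, l) \<in> supp x" for i l
    using x that by (auto simp: mono_span_eq ibox_def)
  have Vy: "0 \<le> i \<and> i < int n" if "(i, l) \<in> supp (V (y N))" for i l N
  proof -
    have "0 \<le> i \<and> i < int n \<and> - int N \<le> j \<and> j \<le> 0" if "(i, j) \<in> supp (y N)" for i j
      using subsetD[OF sy that] by (auto simp: S_def)
    from V_supp[OF this that] show ?thesis by blast
  qed
  have Vm: "0 \<le> fst e \<and> fst e < int n \<and> l - int m \<le> snd e \<and> snd e \<le> l + int m"
    if "e \<in> supp (V (lmono i l))" "0 \<le> i" "i < int n" for i l e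
    using V_supp[of "lmono i l" l l "fst e" "snd e"] that by (auto simp: lmono_def)
  have coef_V: "coef (V (y N)) (i, l) =
      (\<Sum>e\<in>supp (V (lmono i l)). coef (y N) e * cnj (coef (V (lmono i l)) e))"
    if "0 \<le> i" "i < int n" for i l N
  proof -
    have "coef (V (y N)) (i, l) = inn (V (y N)) (V (lmono i l))"
      by (rule V_dual[OF Vy])
    also have "\<dots> = (\<Sum>e\<in>supp (V (lmono i l)). coef (y N) e * cnj (coef (V (lmono i l)) e))"
    proof (rule V_inn)
      show "0 \<le> i' \<and> i' < int n" if "(i', j') \<in> supp (V (lmono i l))" for i' j'
        using Vm[OF that] \<open>0 \<le> i\<close> \<open>i < int n\<close> by auto
    qed auto
    finally show ?thesis .
  qed
  \<comment> \<open>For these \<open>l\<close>, \<open>V (lmono i l)\<close> lives in the rows from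
    \<open>-N\<close> to \<open>m - 1\<close>. There \<open>y N\<close> has the coefficients
    \<open>a\<close>: by construction in negative rows, and since \<open>a\<close> vanishes by
    \<open>xQ\<close> in the others. The result is a coefficient of \<open>x\<close> in a negative
    row.\<close>
  have V0: "coef (V (y N)) (i, l) = 0" if i: "0 \<le> i" "i < int n" and l: "int m - int N \<le> l" "l < 0" for i l N
  proof -
    have "coef (V (y N)) (i, l) = (\<Sum>e\<in>supp (V (lmono i l)). cnj (coef (V (lmono i l)) e) * a e)"
      unfolding coef_V[OF i]
    proof (rule sum.cong)
      fix e assume "e \<in> supp (V (lmono i l))"
      from Vm[OF this i] l have e: "0 \<le> fst e" "fst e < int n" "- int N \<le> snd e" "snd e < int m" by auto
      have "coef (y N) e = a e"
      proof (cases "snd e < 0")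
        case True
        then show ?thesis using e by (auto simp: cy S_def mem_Times_iff)
      next
        case False
        then have "e \<in> ibox n m" using e by (auto simp: ibox_def case_prod_unfold)
        then show ?thesis using False xQ[of "fst e" "snd e"] by (auto simp: cy S_def mem_Times_iff a_def)
      qed
      then show "coef (y N) e * cnj (coef (V (lmono i l)) e) = cnj (coef (V (lmono i l)) e) * a e" by simp
    qed simp
    also have "\<dots> = inn x (V (lmono i l))"
      unfolding a_def by (rule inn_expand_right[symmetric]) auto
    also have "\<dots> = coef x (i, l)"
      using sx by (intro V_dual[symmetric]) blast
    also have "\<dots> = 0"
      using sx[of i l] l by (auto simp: in_keys_iff)
    finally show ?thesis .
  qed
  define C where "C = sqrt (Re (inn x x) * Re (inn 1 1))"
  have aC: "cmod (a e) \<le> C" for e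
  proof -
    have "(cmod (a e))\<^sup>2 \<le> Re (inn x x) * Re (inn (lmono (fst e) (snd e)) (lmono (fst e) (snd e)))"
      unfolding a_def by (rule inn_Cauchy_Schwarz) (rule bs_inn_nonneg)
    also have "inn (lmono (fst e) (snd e)) (lmono (fst e) (snd e)) = inn 1 1"
      using inn_shift[of "fst e" "snd e" 1 1] by simp
    finally show ?thesis unfolding C_def by (simp add: real_le_rsqrt)
  qed
  have C0: "0 \<le> C" using aC[of 0] norm_ge_zero order_trans by blast
  \<comment> \<open>By \<open>V_shift\<close> the norm of \<open>V (lmono i l)\<close> does not
    depend on \<open>l\<close>, so finitely many of them bound the coefficients of
    \<open>V (y N)\<close> uniformly in \<open>N\<close>.\<close>
  define B where "B = (\<Sum>i<n. norm1 (V (lmono (int i) 0)))"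
  have n1: "0 \<le> norm1 q" for q by (simp add: norm1_def sum_nonneg)
  have VB: "cmod (coef (V (y N)) (i, l)) \<le> C * B" if i: "0 \<le> i" "i < int n" for i l N
  proof -
    have "cmod (coef (V (y N)) (i, l)) \<le> (\<Sum>e\<in>supp (V (lmono i l)). C * cmod (coef (V (lmono i l)) e))"
      unfolding coef_V[OF i]
      by (rule sum_norm_le) (auto simp: norm_mult cy C0 intro!: mult_right_mono aC)
    also have "\<dots> = C * norm1 (V (lmono i l))"
      by (simp add: norm1_def sum_distrib_left)
    also have "norm1 (V (lmono i l)) = norm1 (V (lmono (int (nat i)) 0))"
      using V_shift[of l "lmono i 0"] norm1_shift[of 0 l "V (lmono i 0)"] i by (simp add: lmono_mult)
    also have "\<dots> \<le> B"
      unfolding B_def using i by (intro member_le_sum) (auto simp: n1)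
    finally show ?thesis using C0 by (simp add: mult_left_mono)
  qed
  have CB: "0 \<le> C * B"
    unfolding B_def by (intro mult_nonneg_nonneg C0 sum_nonneg n1)
  \<comment> \<open>Bounds the squared norm of \<open>V (y N)\<close>: by \<open>V0\<close> only the
    \<open>m\<close> rows from \<open>-N\<close> upwards contribute, and each term there carries a
    value of \<open>a\<close> that decays with \<open>N\<close>.\<close>
  define D where "D N = (\<Sum>(i, s)\<in>{0..<int n} \<times> {0..<int m}. cmod (a (i, s - int N)) * (C * B))" for N
  have VyD: "Re (inn (V (y N)) (V (y N))) \<le> D N" if N: "m \<le> N" for N
  proof -
    let ?T = "{0..<int n} \<times> {- int N..<int m - int N}"
    have "inn (V (y N)) (V (y N)) = (\<Sum>e\<in>S N. coef (y N) e * cnj (coef (V (y N)) e))"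
    proof (rule V_inn)
      show "finite (S N)" by (simp add: S_def)
      show "supp (V (y N)) \<subseteq> S N \<or> supp (y N) \<subseteq> S N" using sy by blast
    qed (rule Vy)
    also have "\<dots> = (\<Sum>e\<in>?T. coef (y N) e * cnj (coef (V (y N)) e))"
    proof (rule sum.mono_neutral_right)
      show "\<forall>e\<in>S N - ?T. coef (y N) e * cnj (coef (V (y N)) e) = 0"
      proof
        fix e assume "e \<in> S N - ?T"
        then have "coef (V (y N)) (fst e, snd e) = 0"
          by (intro V0) (auto simp: S_def)
        then show "coef (y N) e * cnj (coef (V (y N)) e) = 0" by simp
      qed
    qed (use N in \<open>auto simp: S_def\<close>)
    finally have "cmod (inn (V (y N)) (V (y N))) \<le> (\<Sum>e\<in>?T. cmod (a e) * (C * B))"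
      by (auto intro!: sum_norm_le mult_mono VB simp: norm_mult cy CB)
    also have "\<dots> = D N"
      unfolding D_def
      by (rule sum.reindex_bij_witness[of _ "\<lambda>(i, s). (i, s - int N)" "\<lambda>(i, s). (i, s + int N)"]) auto
    finally show ?thesis
      using complex_Re_le_cmod order_trans by blast
  qed
  have "(\<lambda>N. a (i, s - int N)) \<longlonglongrightarrow> 0" for i s
  proof -
    have "a (i, s - int N) = bs p (lmono 0 (int N) * (lmono (- i) (- s) * x))" for N
      by (simp add: a_def linner_def mult.assoc[symmetric] lmono_mult) (simp add: mult.commute)
    then show ?thesis using bs_decay_w[of "lmono (- i) (- s) * x"] by simp
  qed
  then have "(\<lambda>N. D N) \<longlonglongrightarrow> 0"
    unfolding D_def case_prod_unfold
    by (intro tendsto_null_sum tendsto_mult_left_zero tendsto_norm_zero) auto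
  then have lim: "(\<lambda>N. D N * Re (inn 1 1)) \<longlonglongrightarrow> 0"
    by (rule tendsto_mult_left_zero)
  \<comment> \<open>The threshold puts row \<open>j\<close> above the cut and leaves room for
    \<open>m\<close> rows. Then \<open>a (k, j)\<close> is a moment of \<open>V (y N)\<close>, whose
    norm tends to \<open>0\<close>.\<close>
  have "(cmod (a (k, j)))\<^sup>2 \<le> D N * Re (inn 1 1)" if N: "m + nat (- j) \<le> N" for N
  proof -
    have "a (k, j) = inn (V (y N)) (lmono k j)"
      using k False N by (simp add: V_moment cy S_def)
    moreover have "inn (lmono k j) (lmono k j) = inn 1 1"
      using inn_shift[of k j 1 1] by simp
    ultimately have "(cmod (a (k, j)))\<^sup>2 \<le> Re (inn (V (y N)) (V (y N))) * Re (inn 1 1)"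
      using inn_Cauchy_Schwarz[OF bs_inn_nonneg, of "V (y N)" "lmono k j"] by simp
    also have "\<dots> \<le> D N * Re (inn 1 1)"
      using VyD[of N] N bs_inn_nonneg[of 1] by (intro mult_right_mono) auto
    finally show ?thesis .
  qed
  then have "(cmod (a (k, j)))\<^sup>2 \<le> 0"
    by (intro LIMSEQ_le_const[OF lim]) blast
  then show ?thesis by (simp add: a_def)
qed

text \<open>It remains to treat the moments of \<open>x\<close> against
  \<open>z\<^sup>n w\<^sup>j\<close>. Pairing \<open>x\<close> with
  \<open>lmono (int n) j * dagger p\<close> gives \<open>0\<close>, as \<open>x\<close> has
  \<open>z\<close>-degree below \<open>n\<close>; by \<open>row_zero\<close> only the terms of
  \<open>p(0, w)\<close> survive, which is a recurrence with a characteristic polynomial free of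
  zeros in the closed disc.\<close>

theorem row_column_orthogonal:
  assumes f: "f \<in> mono_span (ibox (n + 1) m)"
    and x: "x \<in> mono_span (ibox n (m + 1))"
    and fQ: "\<And>i j. (i, j) \<in> ibox n m \<Longrightarrow> inn x (lmono i j) = 0"
  shows "inn f x = 0"
proof -
  \<comment> \<open>\<open>s\<close> counts rows downwards from \<open>m - 1\<close>; the recurrence
    then runs forward through all negative rows, and boundedness applies.\<close>
  define c where "c s = inn x (lmono (int n) (int m - 1 - int s))" for s :: nat
  define q where "q = (\<Sum>l\<le>m. monom (coef p (0, int l)) l)"
  have cq: "coeff q l = coef p (0, int l)" for l
  proof (cases "l \<le> m")
    case False
    then have "coef p (0, int l) = 0" using supp_p[of 0 "int l"] by (auto simp: in_keys_iff)
    with False show ?thesis by (simp add: q_def coeff_sum)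
  qed (simp add: q_def coeff_sum)
  have dq: "degree q \<le> m"
    unfolding q_def by (intro degree_sum_le order_trans[OF degree_monom_le]) auto
  have sx: "0 \<le> i \<and> i < int n" if "(i, l) \<in> supp x" for i l
    using x that by (auto simp: mono_span_eq ibox_def)
  have pq: "poly q w = leval p 0 w" for w
  proof -
    have "leval p 0 w = (\<Sum>(i, j)\<in>supp p. coef p (i, j) * 0 powi i * w powi j)"
      by (simp add: leval_def)
    also have "\<dots> = (\<Sum>(i, j)\<in>(\<lambda>l. (0, int l)) ` {..m}. coef p (i, j) * 0 powi i * w powi j)"
    proof (rule sum.mono_neutral_cong)
      fix e assume "e \<in> supp p - (\<lambda>l. (0, int l)) ` {..m}"
      then have "0 \<le> fst e" "0 \<le> snd e" "snd e \<le> int m" "e \<notin> (\<lambda>l. (0, int l)) ` {..m}"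
        using supp_p[of "fst e" "snd e"] by auto
      then have "fst e \<noteq> 0"
        using image_eqI[of e "\<lambda>l. (0, int l)" "nat (snd e)" "{..m}"] by (auto simp: prod_eq_iff nat_le_iff)
      then show "(case e of (i, j) \<Rightarrow> coef p (i, j) * 0 powi i * w powi j) = 0"
        by (auto simp: power_int_0_left_if case_prod_unfold)
    qed (auto simp: in_keys_iff)
    also have "\<dots> = poly q w"
      by (subst sum.reindex) (auto simp: inj_on_def q_def poly_sum poly_monom)
    finally show ?thesis ..
  qed
  have "c s = 0" for s
  proof (rule bounded_recurrence_zero)
    show "poly q z \<noteq> 0" if "cmod z \<le> 1" for z
      unfolding pq using that by (intro stable_nz) auto
    show "cmod (c s) \<le> sqrt (Re (inn x x) * Re (inn 1 1))" for s
    proof (rule real_le_rsqrt)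
      show "(cmod (c s))\<^sup>2 \<le> Re (inn x x) * Re (inn 1 1)"
        using inn_Cauchy_Schwarz[OF bs_inn_nonneg, of x "lmono (int n) (int m - 1 - int s)"]
          inn_shift[of "int n" "int m - 1 - int s" 1 1] by (simp add: c_def)
    qed
    show "(\<Sum>l\<le>degree q. coeff q l * c (s + l)) = 0" for s
    proof -
      define j where "j = int m - 1 - int s"
      have "dagger (lmono (int n) j * dagger p) * x = p * (lmono (- int n) (- j) * x)"
        by (simp add: dagger_mult ac_simps)
      then have "inn x (lmono (int n) j * dagger p) = bs p (p * (lmono (- int n) (- j) * x))"
        by (simp add: linner_def mult.commute)
      also have "\<dots> = 0"
        by (rule bs_p_zero) (use sx in \<open>force simp: supp_lmono_mult\<close>)
      finally have "0 = inn x (lmono (int n) j * dagger p)" ..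
      also have "lmono (int n) j * dagger p =
          (\<Sum>(k, l)\<in>supp p. lscale (cnj (coef p (k, l))) (lmono (int n - k) (j - l)))"
      proof -
        have "dagger p = (\<Sum>(k, l)\<in>supp p. lscale (cnj (coef p (k, l))) (lmono (- k) (- l)))"
          by (subst laurent_expand_on[of "supp p" p])
            (auto simp: dagger_sum dagger_lscale case_prod_unfold intro!: sum.cong)
        then show ?thesis
          by (simp add: sum_distrib_left case_prod_unfold lscale_mult_right lmono_mult)
      qed
      also have "inn x \<dots> = (\<Sum>(k, l)\<in>supp p. coef p (k, l) * inn x (lmono (int n - k) (j - l)))"
        by (simp add: inn_sum_right case_prod_unfold inn_lscale_right)
      also have "\<dots> = (\<Sum>(k, l)\<in>(\<lambda>l. (0, int l)) ` {..m}. coef p (k, l) * inn x (lmono (int n - k) (j - l)))"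
      proof (rule sum.mono_neutral_cong)
        fix e assume e: "e \<in> supp p - (\<lambda>l. (0, int l)) ` {..m}"
        then have *: "0 \<le> fst e" "fst e \<le> int n" "0 \<le> snd e" "snd e \<le> int m" "e \<notin> (\<lambda>l. (0, int l)) ` {..m}"
          using supp_p[of "fst e" "snd e"] by auto
        then have "fst e \<noteq> 0"
          using image_eqI[of e "\<lambda>l. (0, int l)" "nat (snd e)" "{..m}"] by (auto simp: prod_eq_iff nat_le_iff)
        then have "inn x (lmono (int n - fst e) (j - snd e)) = 0"
          using * by (intro row_zero[OF x fQ]) (auto simp: j_def)
        then show "(case e of (k, l) \<Rightarrow> coef p (k, l) * inn x (lmono (int n - k) (j - l))) = 0"
          by (simp add: case_prod_unfold)
      qed (auto simp: in_keys_iff)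
      also have "\<dots> = (\<Sum>l\<le>m. coeff q l * c (s + l))"
        by (subst sum.reindex) (auto simp: inj_on_def cq c_def j_def algebra_simps)
      also have "\<dots> = (\<Sum>l\<le>degree q. coeff q l * c (s + l))"
        using dq by (intro sum.mono_neutral_right) (auto intro: coeff_eq_0)
      finally show ?thesis ..
    qed
  qed
  then have c0: "inn x (lmono (int n) j) = 0" if "j < int m" for j
    using that unfolding c_def by (metis add_diff_cancel_left' diff_add_cancel diff_ge_0_iff_ge int_nat_eq zle_diff1_eq)
  have "inn x f = 0"
  proof (rule inn_span_zero[OF f])
    fix i j assume "(i, j) \<in> ibox (n + 1) m"
    then show "inn x (lmono i j) = 0"
      using fQ[of i j] c0[of j] by (cases "i = int n") (auto simp: ibox_def)
  qed
  then show ?thesis using inn_cnj[of f x] by simp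
qed

end

section \<open>Exchanging the variables\<close>

text \<open>Exchanges \<open>z\<close> and \<open>w\<close>, so that results on \<open>P\<close>
  carry over to \<open>R\<close>.\<close>

definition swapl :: "laurent \<Rightarrow> laurent" where
  "swapl p = (\<Sum>(i, j)\<in>supp p. Poly_Mapping.single (j, i) (coef p (i, j)))"

lemma coef_swapl [simp]: "coef (swapl p) (i, j) = coef p (j, i)"
proof -
  have "coef (swapl p) (i, j) = (\<Sum>e\<in>supp p. if e = (j, i) then coef p e else 0)"
    unfolding swapl_def lookup_sum by (rule sum.cong) (auto simp: lookup_single when_def split: if_splits)
  then show ?thesis by (simp add: in_keys_iff)
qed

lemma swapl_swapl [simp]: "swapl (swapl p) = p"
  by (rule poly_mapping_eqI) auto

lemma swapl_add: "swapl (p + q) = swapl p + swapl q"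
  by (rule poly_mapping_eqI) (auto simp: lookup_add)

lemma swapl_zero [simp]: "swapl 0 = 0"
  by (rule poly_mapping_eqI) auto

lemma swapl_single [simp]: "swapl (Poly_Mapping.single (i, j) c) = Poly_Mapping.single (j, i) c"
  by (rule poly_mapping_eqI) (auto simp: lookup_single when_def split: if_splits)

lemma swapl_lmono [simp]: "swapl (lmono i j) = lmono j i"
  by (simp add: lmono_def)

lemma swapl_mult: "swapl (p * q) = swapl p * swapl q"
proof (induction p rule: laurent_induct)
  case (single i j c)
  show ?case
    by (induction q rule: laurent_induct) (auto simp: mult_single swapl_add distrib_left)
qed (auto simp: swapl_add distrib_right)

lemma swapl_lscale: "swapl (lscale c p) = lscale c (swapl p)"
  by (rule poly_mapping_eqI) auto

lemma swapl_sum: "swapl (\<Sum>x\<in>A. f x) = (\<Sum>x\<in>A. swapl (f x))"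
  by (induction A rule: infinite_finite_induct) (auto simp: swapl_add)

lemma swapl_dagger: "swapl (dagger p) = dagger (swapl p)"
  by (rule poly_mapping_eqI) (auto simp: lookup_dagger)

lemma swapl_reversed: "swapl (reversed n m p) = reversed m n (swapl p)"
  by (rule poly_mapping_eqI) (auto simp: coef_reversed)

lemma supp_swapl: "supp (swapl p) = prod.swap ` supp p"
proof -
  have "(i, j) \<in> supp (swapl p) \<longleftrightarrow> (j, i) \<in> supp p" for i j
    by (simp add: in_keys_iff)
  then show ?thesis by (force simp: image_iff)
qed

lemma leval_swapl: "leval (swapl p) z w = leval p w z"
  by (induction p rule: laurent_induct) (auto simp: leval_add swapl_add)

lemma swapl_in_span: "p \<in> mono_span S \<Longrightarrow> swapl p \<in> mono_span (prod.swap ` S)"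
  by (auto simp: mono_span_eq supp_swapl)

lemma swap_box: "prod.swap ` ibox a b = ibox b a"
  by (force simp: ibox_def)

lemma finite_ibox [simp]: "finite (ibox a b)"
proof (rule finite_subset)
  show "ibox a b \<subseteq> {0..<int a} \<times> {0..<int b}" by (auto simp: ibox_def)
qed simp

lemma onb_swap:
  assumes "onb L (ibox a b) (ibox a b) e"
  shows "onb (\<lambda>p. L (swapl p)) (ibox b a) (ibox b a) (\<lambda>u. swapl (e (prod.swap u)))"
  unfolding onb_def
proof (intro conjI ballI)
  have l: "linner (\<lambda>p. L (swapl p)) p q = linner L (swapl p) (swapl q)" for p q
    by (simp add: linner_def swapl_mult swapl_dagger)
  have s: "prod.swap u \<in> ibox a b" if "u \<in> ibox b a" for u
    using that by (auto simp: ibox_def)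
  show "swapl (e (prod.swap u)) \<in> mono_span (ibox b a)" if "u \<in> ibox b a" for u
    using swapl_in_span[OF onb_in_span[OF assms s[OF that]]] by (simp add: swap_box)
  show "linner (\<lambda>p. L (swapl p)) (swapl (e (prod.swap u))) (swapl (e (prod.swap v))) = (if u = v then 1 else 0)"
    if "u \<in> ibox b a" "v \<in> ibox b a" for u v
    using onb_inn[OF assms s[OF that(1)] s[OF that(2)]] by (auto simp: l dest: arg_cong[of _ _ prod.swap])
  fix f assume "f \<in> mono_span (ibox b a)"
  then have "swapl f \<in> mono_span (ibox a b)"
    using swapl_in_span[of f "ibox b a"] by (simp add: swap_box)
  from onb_expand[OF assms this]
  have "swapl (swapl f) = swapl (\<Sum>u\<in>ibox a b. lscale (linner L (swapl f) (e u)) (e u))" by simp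
  then have "f = (\<Sum>u\<in>ibox a b. lscale (linner L (swapl f) (e u)) (swapl (e u)))"
    by (simp add: swapl_sum swapl_lscale)
  also have "\<dots> = (\<Sum>u\<in>ibox b a. lscale (linner (\<lambda>p. L (swapl p)) f (swapl (e (prod.swap u)))) (swapl (e (prod.swap u))))"
    unfolding l by (rule sum.reindex_bij_witness[of _ prod.swap prod.swap]) (auto simp: ibox_def)
  finally show "f = (\<Sum>u\<in>ibox b a. lscale (linner (\<lambda>p. L (swapl p)) f (swapl (e (prod.swap u)))) (swapl (e (prod.swap u))))" .
qed simp

lemma (in laurent_functional) functional_swap: "laurent_functional (\<lambda>p. L (swapl p))"
  by unfold_locales (simp_all add: swapl_add L_add swapl_lscale L_lscale swapl_dagger L_dagger)

lemma pd_on_swap: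
  assumes "pd_on L (ibox a b)"
  shows "pd_on (\<lambda>p. L (swapl p)) (ibox b a)"
  unfolding pd_on_def
proof (intro ballI impI)
  fix f assume f: "f \<in> mono_span (ibox b a)" "f \<noteq> 0"
  then have "swapl f \<in> mono_span (ibox a b)"
    using swapl_in_span[of f "ibox b a"] by (simp add: swap_box)
  moreover have "swapl f \<noteq> 0" using f swapl_swapl[of f] by (metis swapl_zero)
  ultimately show "pos_real (linner (\<lambda>p. L (swapl p)) f f)"
    using assms by (simp add: pd_on_def linner_def swapl_mult swapl_dagger)
qed

lemma (in torus_nonzero) bs_swap: "bs (swapl p) (swapl q) = bs p q"
  unfolding bs_iterated unfolding bs_def leval_swapl ..

section \<open>Polynomials determined by their values on the bidisc\<close>

lemma leval_box:
  assumes "f \<in> mono_span (ibox a b)"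
  shows "leval f z w = (\<Sum>j<b. (\<Sum>i<a. coef f (int i, int j) * z ^ i) * w ^ j)"
proof -
  have "leval f z w = (\<Sum>(i, j)\<in>ibox a b. coef f (i, j) * z powi i * w powi j)"
    using assms by (intro leval_superset) (auto simp: mono_span_eq)
  also have "\<dots> = (\<Sum>(j, i)\<in>{..<b} \<times> {..<a}. coef f (int i, int j) * z ^ i * w ^ j)"
    by (rule sum.reindex_bij_witness[of _ "\<lambda>(j, i). (int i, int j)" "\<lambda>(i, j). (nat j, nat i)"])
      (auto simp: ibox_def power_int_def)
  finally show ?thesis
    by (simp add: sum.cartesian_product sum_distrib_right)
qed

lemma coeffs_zero_on_ball:
  fixes A :: "nat \<Rightarrow> complex"
  assumes "\<And>w. cmod w < 1 \<Longrightarrow> (\<Sum>j<b. A j * w ^ j) = 0" and "j < b"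
  shows "A j = 0"
proof -
  define q where "q = (\<Sum>j<b. monom (A j) j)"
  have "ball 0 1 \<subseteq> {w. poly q w = 0}"
    using assms(1) by (auto simp: q_def poly_sum poly_monom)
  moreover have "infinite (ball (0 :: complex) 1)"
    using uncountable_ball[of 1 "0 :: complex"] countable_finite by auto
  ultimately have "q = 0"
    using poly_roots_finite finite_subset by blast
  then have "coeff q j = 0" by simp
  then show ?thesis using assms(2) by (simp add: q_def coeff_sum)
qed

lemma laurent_zero_on_ball:
  assumes f: "f \<in> mono_span (ibox a b)"
    and z: "\<And>z w. cmod z < 1 \<Longrightarrow> cmod w < 1 \<Longrightarrow> leval f z w = 0"
  shows "f = 0"
proof (rule poly_mapping_eqI)
  fix e
  show "coef f e = coef 0 e"
  proof (cases "e \<in> ibox a b")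
    case True
    then obtain i j where e: "e = (int i, int j)" "i < a" "j < b"
      using that[of "nat (fst e)" "nat (snd e)"] by (auto simp: ibox_def)
    have "(\<Sum>i<a. coef f (int i, int j) * z ^ i) = 0" if "cmod z < 1" for z
      by (rule coeffs_zero_on_ball[OF _ e(3)]) (use z[OF that] leval_box[OF f] in simp)
    from coeffs_zero_on_ball[OF this e(2)] show ?thesis by (simp add: e)
  next
    case False
    then show ?thesis using f by (auto simp: mono_span_eq in_keys_iff)
  qed
qed

lemma leval_mult_poly:
  assumes "is_poly p" "is_poly q"
  shows "leval (p * q) z w = leval p z w * leval q z w"
  using assms by (intro leval_mult) (auto simp: is_poly_def)

lemma is_poly_box: "f \<in> mono_span (ibox a b) \<Longrightarrow> is_poly f"
  by (auto simp: mono_span_eq is_poly_def ibox_def)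

lemma is_poly_lmono: "0 \<le> i \<Longrightarrow> 0 \<le> j \<Longrightarrow> is_poly (lmono i j)"
  by (auto simp: is_poly_def lmono_def)

section \<open>One side of the box\<close>

text \<open>The index \<open>u\<close> of \<open>e u\<close> is the exponent at which it enters the basis; so the \<open>e (n, l)\<close>, \<open>l < m\<close>,
  span the orthogonal complement of the smaller box in the larger one.\<close>

locale side = laurent_functional L for L +
  fixes n m :: nat and e :: "int \<times> int \<Rightarrow> laurent"
  assumes eQ: "onb L (ibox n m) (ibox n m) e"
    and eP: "onb L (ibox (n + 1) m) (ibox (n + 1) m) e"
    and pdP: "pd_on L (ibox (n + 1) m)"
    and m1: "1 \<le> m"
begin

abbreviation f :: "nat \<Rightarrow> laurent" where "f l \<equiv> e (int n, int l)"

lemma box_P: "ibox (n + 1) m = ibox n m \<union> (\<lambda>l. (int n, int l)) ` {..<m}"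
proof (intro equalityI subsetI)
  fix u assume "u \<in> ibox (n + 1) m"
  then have "u \<in> ibox n m \<or> u = (int n, int (nat (snd u))) \<and> nat (snd u) < m"
    by (auto simp: ibox_def)
  then show "u \<in> ibox n m \<union> (\<lambda>l. (int n, int l)) ` {..<m}" by blast
qed (auto simp: ibox_def)

lemma sum_P: "(\<Sum>u\<in>ibox (n + 1) m. h u) = (\<Sum>u\<in>ibox n m. h u) + (\<Sum>l<m. h (int n, int l))"
  unfolding box_P
  by (subst sum.union_disjoint, simp, simp) (auto simp: ibox_def sum.reindex inj_on_def)

lemma f_span: "l < m \<Longrightarrow> f l \<in> mono_span (ibox (n + 1) m)"
  by (rule onb_in_span[OF eP]) (auto simp: ibox_def)

lemma f_inn: "l < m \<Longrightarrow> k < m \<Longrightarrow> inn (f l) (f k) = (if l = k then 1 else 0)"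
  by (subst onb_inn[OF eP]) (auto simp: ibox_def)

lemma f_Q: "l < m \<Longrightarrow> g \<in> mono_span (ibox n m) \<Longrightarrow> inn (f l) g = 0"
  by (rule onb_orthogonal[OF eQ], assumption, subst onb_inn[OF eP]) (auto simp: ibox_def)

lemma Q_P: "g \<in> mono_span (ibox n m) \<Longrightarrow> g \<in> mono_span (ibox (n + 1) m)"
  by (erule subsetD[OF mono_span_mono, rotated]) (auto simp: ibox_def)

lemma z_Q: "g \<in> mono_span (ibox n m) \<Longrightarrow> lmono 1 0 * g \<in> mono_span (ibox (n + 1) m)"
  by (erule mono_span_shift) (auto simp: ibox_def)

text \<open>If all \<open>f l\<close> vanished at \<open>(z0, w0)\<close>, evaluation there would be represented on the larger
  ibox by an element \<open>\<kappa>\<close> of the smaller one, and then \<open>\<kappa> = cnj z0 * z * \<kappa>\<close>.\<close>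

lemma f_nonvanishing:
  assumes z0: "cmod z0 = 1"
  shows "\<exists>l<m. leval (f l) z0 w0 \<noteq> 0"
proof (rule ccontr)
  assume "\<not> ?thesis"
  then have fz: "leval (f l) z0 w0 = 0" if "l < m" for l using that by blast
  define \<kappa> where "\<kappa> = (\<Sum>u\<in>ibox n m. lscale (cnj (leval (e u) z0 w0)) (e u))"
  have repr: "leval g z0 w0 = inn g \<kappa>" if "g \<in> mono_span (ibox (n + 1) m)" for g
  proof -
    have "leval g z0 w0 = (\<Sum>u\<in>ibox n m. inn g (e u) * leval (e u) z0 w0)"
      unfolding onb_leval_expand[OF eP that] sum_P by (simp add: fz)
    also have "\<dots> = inn g \<kappa>"
      by (simp add: \<kappa>_def inn_sum_right inn_lscale_right mult.commute)
    finally show ?thesis .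
  qed
  have \<kappa>: "\<kappa> \<in> mono_span (ibox n m)"
    unfolding \<kappa>_def by (intro mono_span_sum mono_span_lscale onb_in_span[OF eQ])
  let ?z\<kappa> = "lmono 1 0 * \<kappa>"
  \<comment> \<open>Equality case of Cauchy-Schwarz: \<open>z \<kappa>\<close> has the norm of
    \<open>\<kappa>\<close>, and by \<open>repr\<close> their inner product is \<open>z0\<close>
    times the squared norm. So \<open>d\<close> has norm zero.\<close>
  define d where "d = \<kappa> - lscale (cnj z0) ?z\<kappa>"
  have d: "d \<in> mono_span (ibox (n + 1) m)"
    unfolding d_def by (intro mono_span_diff mono_span_lscale Q_P z_Q \<kappa>)
  have "leval ?z\<kappa> z0 w0 = z0 * leval \<kappa> z0 w0"
    by (subst leval_mult_poly) (auto simp: is_poly_lmono is_poly_box[OF \<kappa>] leval_lmono)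
  then have zk: "inn ?z\<kappa> \<kappa> = z0 * inn \<kappa> \<kappa>"
    using repr[OF z_Q[OF \<kappa>]] repr[OF Q_P[OF \<kappa>]] by simp
  have kz: "inn \<kappa> ?z\<kappa> = cnj z0 * inn \<kappa> \<kappa>"
    using inn_cnj[of \<kappa> ?z\<kappa>] zk inn_cnj[of \<kappa> \<kappa>] by simp
  have zz: "z0 * cnj z0 = 1"
    using z0 by (simp flip: complex_norm_square)
  have "inn d d = inn \<kappa> \<kappa> - (z0 * cnj z0) * inn \<kappa> \<kappa> - ((z0 * cnj z0) * inn \<kappa> \<kappa> - (z0 * cnj z0) * inn \<kappa> \<kappa>)"
    unfolding d_def inn_diff_left inn_diff_right inn_lscale_left inn_lscale_right inn_shift zk kz
    by (simp add: algebra_simps)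
  then have "inn d d = 0" by (simp add: zz)
  then have "d = 0"
    using pdP d by (auto simp: pd_on_def pos_real_def)
  then have d0: "coef d (i, j) = 0" for i j by simp
  \<comment> \<open>With \<open>d = 0\<close>, each column of \<open>\<kappa>\<close> is a multiple
    of the preceding one; as there are no negative columns, \<open>\<kappa> = 0\<close>, although it
    represents the value \<open>1\<close> of the constant \<open>1\<close>.\<close>
  have rec: "coef \<kappa> (i, j) = cnj z0 * coef \<kappa> (i - 1, j)" for i j
    using d0[of i j] unfolding d_def by (simp add: lookup_minus coef_lmono_mult)
  have neg: "coef \<kappa> (i, j) = 0" if "i < 0" for i j
    using \<kappa> that by (auto simp: mono_span_eq in_keys_iff ibox_def)
  have "coef \<kappa> (int i, j) = 0" for i j
    by (induction i) (use rec[of 0] rec[of "int (Suc _)"] neg[of "-1"] in auto)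
  then have "\<kappa> = 0"
    using neg by (intro poly_mapping_eqI) (metis int_eq_iff linorder_not_less lookup_zero prod.collapse)
  moreover have "leval (lmono 0 0) z0 w0 = inn (lmono 0 0) \<kappa>"
    using m1 by (intro repr lmono_in_span) (auto simp: ibox_def)
  ultimately show False by (simp add: leval_lmono del: lmono_0_0)
qed

text \<open>A combination of the \<open>f l\<close> vanishing at \<open>z = z0\<close> is divisible by \<open>z - z0\<close>, with the quotient in
  the smaller ibox.\<close>

lemma f_independent:
  assumes z0: "cmod z0 = 1" and c: "\<And>w. cmod w < 1 \<Longrightarrow> (\<Sum>l<m. c l * leval (f l) z0 w) = 0"
    and l: "l < m"
  shows "c l = 0"
proof -
  define h where "h = (\<Sum>l<m. lscale (c l) (f l))"
  have h: "h \<in> mono_span (ibox (n + 1) m)"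
    unfolding h_def by (intro mono_span_sum mono_span_lscale f_span) auto
  have hz: "(\<Sum>i<n + 1. coef h (int i, int j) * z0 ^ i) = 0" if "j < m" for j
    by (rule coeffs_zero_on_ball[OF _ that])
      (use c leval_box[OF h, of z0] in \<open>simp add: h_def leval_sum\<close>)
  \<comment> \<open>Coefficients of \<open>h / (z - z0)\<close> from synthetic division; by
    \<open>hz\<close> there is no remainder.\<close>
  define G where "G i j = (\<Sum>k = Suc i..n. coef h (int k, j) * z0 ^ (k - Suc i))" for i j
  define g where "g = (\<Sum>(i, j)\<in>ibox n m. lscale (G (nat i) j) (lmono i j))"
  have g: "g \<in> mono_span (ibox n m)"
    unfolding g_def case_prod_unfold by (intro mono_span_sum mono_span_lscale lmono_in_span) auto
  have cg: "coef g u = (if u \<in> ibox n m then G (nat (fst u)) (snd u) else 0)" for u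
  proof -
    have "coef g u = (\<Sum>v\<in>ibox n m. if v = u then G (nat (fst v)) (snd v) else 0)"
      unfolding g_def lookup_sum by (rule sum.cong) (auto simp: coef_lmono)
    then show ?thesis by simp
  qed
  have G: "G i j = coef h (int (Suc i), j) + z0 * G (Suc i) j" if "i < n" for i j
  proof -
    have "G i j = coef h (int (Suc i), j) + (\<Sum>k = Suc (Suc i)..n. coef h (int k, j) * z0 ^ (k - Suc i))"
      unfolding G_def using that by (subst sum.atLeast_Suc_atMost) auto
    also have "(\<Sum>k = Suc (Suc i)..n. coef h (int k, j) * z0 ^ (k - Suc i)) = z0 * G (Suc i) j"
      unfolding G_def sum_distrib_left
      by (intro sum.cong) (auto simp: Suc_diff_Suc simp flip: power_Suc)
    finally show ?thesis .
  qed
  have Gn: "G n j = 0" for j by (simp add: G_def)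
  have G0: "z0 * G 0 j = - coef h (0, j)" if "0 \<le> j" "j < int m" for j
  proof -
    have "0 = (\<Sum>i<Suc n. coef h (int i, j) * z0 ^ i)"
      using hz[of "nat j"] that by simp
    also have "\<dots> = coef h (0, j) + (\<Sum>i<n. coef h (int (Suc i), j) * z0 ^ Suc i)"
      by (subst sum.lessThan_Suc_shift) simp
    also have "(\<Sum>i<n. coef h (int (Suc i), j) * z0 ^ Suc i) = z0 * G 0 j"
      unfolding G_def sum_distrib_left
      by (rule sum.reindex_bij_witness[of _ "\<lambda>k. k - 1" Suc]) auto
    finally show ?thesis by (simp add: eq_neg_iff_add_eq_0 add.commute)
  qed
  have hb: "coef h u = 0" if "u \<notin> ibox (n + 1) m" for u
    using h that by (auto simp: mono_span_eq in_keys_iff)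
  have "coef (lmono 1 0 * g) (i, j) = coef (h + lscale z0 g) (i, j)" for i j
  proof (cases "(i, j) \<in> ibox (n + 1) m")
    case False
    then show ?thesis by (auto simp: coef_lmono_mult lookup_add hb cg) (auto simp: ibox_def)
  next
    case True
    then have ij: "0 \<le> i" "i \<le> int n" "0 \<le> j" "j < int m" by (auto simp: ibox_def)
    show ?thesis
    proof (cases "i = 0")
      case True
      then show ?thesis
        using G0[of j] Gn[of j] ij
        by (cases "n = 0") (auto simp: coef_lmono_mult lookup_add cg ibox_def)
    next
      case False
      then obtain i' where i': "i = int (Suc i')" "i' < n"
        using ij that[of "nat (i - 1)"] by auto
      then show ?thesis
        using G[OF i'(2), of j] Gn[of j] ij
        by (cases "Suc i' = n") (auto simp: coef_lmono_mult lookup_add cg ibox_def nat_add_distrib)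
    qed
  qed
  then have zg: "lmono 1 0 * g = h + lscale z0 g"
    by (intro poly_mapping_eqI) auto
  have hg: "inn h g = 0"
    unfolding h_def by (simp add: inn_sum_left inn_lscale_left f_Q[OF _ g])
  then have gh: "inn g h = 0" using inn_cnj[of g h] by simp
  \<comment> \<open>Multiplication by \<open>z\<close> is an isometry and \<open>h\<close> is
    orthogonal to \<open>g\<close>, so by Pythagoras and \<open>|z0| = 1\<close> nothing is left for
    the norm of \<open>h\<close>.\<close>
  have "inn g g = inn (h + lscale z0 g) (h + lscale z0 g)"
    using inn_shift[of 1 0 g g] zg by simp
  also have "\<dots> = inn h h + (z0 * cnj z0) * inn g g"
    by (simp add: inn_add_left inn_add_right inn_lscale_left inn_lscale_right hg gh)
  also have "z0 * cnj z0 = 1"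
    using z0 by (simp flip: complex_norm_square)
  finally have "inn h h = 0" by simp
  then have "h = 0"
    using pdP h by (auto simp: pd_on_def pos_real_def)
  then have "0 = inn h (f l)" by simp
  also have "\<dots> = (\<Sum>k<m. if k = l then c k else 0)"
    unfolding h_def inn_sum_left
    by (rule sum.cong) (auto simp: inn_lscale_left f_inn l)
  finally show ?thesis using l by simp
qed

end

section \<open>The kernel identity and stability\<close>

text \<open>The reflection moves a box to the opposite corner of the full box, which is also a
  translate; reversed and shifted bases thus span the same space.\<close>

lemma reflect_ibox:
  assumes "a \<le> n + 1" "b \<le> m + 1"
  shows "(\<lambda>(i, j). (int n - i, int m - j)) ` ibox a b =
    (\<lambda>(i, j). (i + int (n + 1 - a), j + int (m + 1 - b))) ` ibox a b" (is "?l = ?r")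
proof (intro equalityI subsetI)
  fix u assume "u \<in> ?l"
  then obtain i j where u: "u = (int n - i, int m - j)" "(i, j) \<in> ibox a b" by auto
  show "u \<in> ?r"
    by (rule image_eqI[of _ _ "(int a - 1 - i, int b - 1 - j)"]) (use u assms in \<open>auto simp: ibox_def\<close>)
next
  fix u assume "u \<in> ?r"
  then obtain i j where u: "u = (i + int (n + 1 - a), j + int (m + 1 - b))" "(i, j) \<in> ibox a b" by auto
  show "u \<in> ?l"
    by (rule image_eqI[of _ _ "(int a - 1 - i, int b - 1 - j)"]) (use u assms in \<open>auto simp: ibox_def\<close>)
qed

text \<open>A single family serves \<open>Q\<close>, \<open>P\<close>, \<open>R\<close> and
  \<open>E\<close>. Since \<open>eE\<close> makes it orthonormal as a whole, \<open>P - Q\<close>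
  and \<open>R - Q\<close> are orthogonal to each other: this is how \<open>K = 0\<close> is
  used.\<close>

locale config = laurent_functional L for L +
  fixes n m :: nat and e :: "int \<times> int \<Rightarrow> laurent"
  assumes n1: "1 \<le> n" and m1: "1 \<le> m"
    and eQ: "onb L (ibox n m) (ibox n m) e"
    and eP: "onb L (ibox (n + 1) m) (ibox (n + 1) m) e"
    and eR: "onb L (ibox n (m + 1)) (ibox n (m + 1)) e"
    and eE: "onb L (ibox (n + 1) (m + 1)) (ibox (n + 1) (m + 1)) e"
    and pdE: "pd_on L (ibox (n + 1) (m + 1))"
begin

abbreviation \<phi> where "\<phi> \<equiv> e (int n, int m)"

abbreviation p where "p \<equiv> reversed n m \<phi>"

lemma config_swap: "config (\<lambda>p. L (swapl p)) m n (\<lambda>u. swapl (e (prod.swap u)))"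
  using functional_swap n1 m1 onb_swap[OF eQ] onb_swap[OF eP] onb_swap[OF eR] onb_swap[OF eE] pd_on_swap[OF pdE]
  by (simp add: config_def config_axioms_def)

lemma side_L: "side L n m e"
proof -
  have "ibox (n + 1) m \<subseteq> ibox (n + 1) (m + 1)" by (auto simp: ibox_def)
  then show ?thesis
    using eQ eP m1 pd_on_mono[OF pdE] by unfold_locales
qed

lemma sum_P: "(\<Sum>u\<in>ibox (n + 1) m. h u) = (\<Sum>u\<in>ibox n m. h u) + (\<Sum>l<m. h (int n, int l))"
  by (rule side.sum_P[OF side_L])

lemma sum_swap: "(\<Sum>u\<in>ibox a b. h u) = (\<Sum>u\<in>ibox b a. h (prod.swap u))"
  by (rule sum.reindex_bij_witness[of _ prod.swap prod.swap]) (auto simp: ibox_def)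

lemma sum_R: "(\<Sum>u\<in>ibox n (m + 1). h u) = (\<Sum>u\<in>ibox n m. h u) + (\<Sum>k<n. h (int k, int m))"
  unfolding sum_swap[of _ n] config.sum_P[OF config_swap] by simp

lemma sum_E: "(\<Sum>u\<in>ibox (n + 1) (m + 1). h u) =
    (\<Sum>u\<in>ibox n m. h u) + (\<Sum>l<m. h (int n, int l)) + (\<Sum>k<n. h (int k, int m)) + h (int n, int m)"
proof -
  have "ibox (n + 1) (m + 1) = ibox n (m + 1) \<union> (\<lambda>l. (int n, int l)) ` {..<m + 1}"
  proof (intro equalityI subsetI)
    fix u assume "u \<in> ibox (n + 1) (m + 1)"
    then have "u \<in> ibox n (m + 1) \<or> u = (int n, int (nat (snd u))) \<and> nat (snd u) < m + 1"
      by (auto simp: ibox_def)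
    then show "u \<in> ibox n (m + 1) \<union> (\<lambda>l. (int n, int l)) ` {..<m + 1}" by blast
  qed (auto simp: ibox_def)
  then have "(\<Sum>u\<in>ibox (n + 1) (m + 1). h u) = (\<Sum>u\<in>ibox n (m + 1). h u) + (\<Sum>l<m + 1. h (int n, int l))"
    by (simp only:) (subst sum.union_disjoint, simp, simp, auto simp: ibox_def sum.reindex inj_on_def)
  then show ?thesis
    by (simp add: sum_R[simplified] ac_simps)
qed

lemma is_poly_e: "u \<in> ibox (n + 1) (m + 1) \<Longrightarrow> is_poly (e u)"
  using onb_in_span[OF eE] is_poly_box by blast

lemma \<phi>_span: "\<phi> \<in> mono_span (ibox (n + 1) (m + 1))"
  by (rule onb_in_span[OF eE]) (simp add: ibox_def)

lemma p_span: "p \<in> mono_span (ibox (n + 1) (m + 1))"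
  by (rule reversed_in_span[OF \<phi>_span]) (auto simp: ibox_def)

lemma reversed_kernel:
  assumes a: "a \<le> n + 1" "b \<le> m + 1" and e: "onb L (ibox a b) (ibox a b) e"
  shows "(\<Sum>u\<in>ibox a b. leval (reversed n m (e u)) z w * cnj (leval (reversed n m (e u)) z' w')) =
    (z * cnj z') ^ (n + 1 - a) * (w * cnj w') ^ (m + 1 - b) *
    (\<Sum>u\<in>ibox a b. leval (e u) z w * cnj (leval (e u) z' w'))"
proof -
  have le: "leval (lmono (int (n + 1 - a)) (int (m + 1 - b)) * e u) z w =
      z ^ (n + 1 - a) * w ^ (m + 1 - b) * leval (e u) z w" if "u \<in> ibox a b" for u z w
  proof -
    have "is_poly (e u)" by (rule is_poly_box[OF onb_in_span[OF e that]])
    then show ?thesis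
      by (simp add: leval_mult_poly is_poly_lmono leval_lmono power_int_of_nat del: of_nat_diff)
  qed
  have "onb L ((\<lambda>(i, j). (int n - i, int m - j)) ` ibox a b) (ibox a b)
      (\<lambda>u. lmono (int (n + 1 - a)) (int (m + 1 - b)) * e u)"
    unfolding reflect_ibox[OF a] by (rule onb_shift[OF e])
  then have "kern (ibox a b) (\<lambda>u. reversed n m (e u)) z w z' w' =
      kern (ibox a b) (\<lambda>u. lmono (int (n + 1 - a)) (int (m + 1 - b)) * e u) z w z' w'"
    by (rule onb_kern_unique[OF onb_reversed[OF e]])
  also have "\<dots> = (z * cnj z') ^ (n + 1 - a) * (w * cnj w') ^ (m + 1 - b) *
      (\<Sum>u\<in>ibox a b. leval (e u) z w * cnj (leval (e u) z' w'))"
    unfolding kern_def sum_distrib_left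
  proof (rule sum.cong)
    fix u assume u: "u \<in> ibox a b"
    show "leval (lmono (int (n + 1 - a)) (int (m + 1 - b)) * e u) z w *
        cnj (leval (lmono (int (n + 1 - a)) (int (m + 1 - b)) * e u) z' w') =
      (z * cnj z') ^ (n + 1 - a) * (w * cnj w') ^ (m + 1 - b) * (leval (e u) z w * cnj (leval (e u) z' w'))"
      unfolding le[OF u] by (simp only: complex_cnj_mult complex_cnj_power power_mult_distrib ac_simps)
  qed simp
  finally show ?thesis by (simp add: kern_def)
qed

text \<open>Reversal maps the basis of each box to one of a translate of that box, whose kernel is \<open>x\<close>, \<open>y\<close> or
  \<open>x y\<close> times the kernel of the box.\<close>

lemma kernel_identity:
  fixes z w z' w' :: complex
  defines "s \<equiv> \<lambda>q. leval q z w * cnj (leval q z' w')"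
    and "x \<equiv> z * cnj z'" and "y \<equiv> w * cnj w'"
  shows "s p - s \<phi> = (1 - x) * (1 - y) * (\<Sum>u\<in>ibox n m. s (e u)) +
    (1 - y) * (\<Sum>l<m. s (e (int n, int l))) + (1 - x) * (\<Sum>k<n. s (e (int k, int m)))"
proof -
  let ?r = "\<lambda>u. s (reversed n m (e u))" and ?s = "\<lambda>u. s (e u)"
  have E: "(\<Sum>u\<in>ibox (n + 1) (m + 1). ?r u) = (\<Sum>u\<in>ibox (n + 1) (m + 1). ?s u)"
    using reversed_kernel[OF _ _ eE, of z w z' w'] by (simp add: s_def)
  have P: "(\<Sum>u\<in>ibox (n + 1) m. ?r u) = y * (\<Sum>u\<in>ibox (n + 1) m. ?s u)"
    using reversed_kernel[OF _ _ eP, of z w z' w'] by (simp add: s_def y_def)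
  have R: "(\<Sum>u\<in>ibox n (m + 1). ?r u) = x * (\<Sum>u\<in>ibox n (m + 1). ?s u)"
    using reversed_kernel[OF _ _ eR, of z w z' w'] by (simp add: s_def x_def)
  have Q: "(\<Sum>u\<in>ibox n m. ?r u) = x * y * (\<Sum>u\<in>ibox n m. ?s u)"
    using reversed_kernel[OF _ _ eQ, of z w z' w'] by (simp add: s_def x_def y_def)
  \<comment> \<open>Inclusion-exclusion on the reversed sums isolates the corner, whose reversal is
    \<open>p\<close>; by \<open>E\<close> the full sum may be taken without reversal.\<close>
  have "s p - s \<phi> = (\<Sum>u\<in>ibox n m. ?s u) + (\<Sum>l<m. ?s (int n, int l)) + (\<Sum>k<n. ?s (int k, int m)) -
      (\<Sum>u\<in>ibox (n + 1) m. ?r u) - (\<Sum>u\<in>ibox n (m + 1). ?r u) + (\<Sum>u\<in>ibox n m. ?r u)"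
    using E unfolding sum_E sum_P sum_R by (simp add: algebra_simps)
  then show ?thesis
    unfolding P R Q unfolding sum_P sum_R by (simp add: algebra_simps)
qed

lemma kernel_identity_norm:
  "(cmod (leval p z w))\<^sup>2 - (cmod (leval \<phi> z w))\<^sup>2 =
    (1 - (cmod z)\<^sup>2) * (1 - (cmod w)\<^sup>2) * (\<Sum>u\<in>ibox n m. (cmod (leval (e u) z w))\<^sup>2) +
    (1 - (cmod w)\<^sup>2) * (\<Sum>l<m. (cmod (leval (e (int n, int l)) z w))\<^sup>2) +
    (1 - (cmod z)\<^sup>2) * (\<Sum>k<n. (cmod (leval (e (int k, int m)) z w))\<^sup>2)" (is "?l = ?r")
proof -
  have "complex_of_real ?l = complex_of_real ?r"
    using kernel_identity[of z w z w] unfolding complex_norm_square[symmetric] by simp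
  then show ?thesis by (simp only: of_real_eq_iff)
qed

section \<open>Strict positivity of the kernel terms and stability\<close>

lemma top_nonvanishing:
  "cmod z = 1 \<Longrightarrow> 0 < (\<Sum>l<m. (cmod (leval (e (int n, int l)) z w))\<^sup>2)"
  using side.f_nonvanishing[OF side_L, of z w]
  by (auto intro: sum_pos2)

lemma right_nonvanishing:
  assumes "cmod w = 1"
  shows "0 < (\<Sum>k<n. (cmod (leval (e (int k, int m)) z w))\<^sup>2)"
  using config.top_nonvanishing[OF config_swap assms, of z] by (simp add: leval_swapl)

text \<open>The constant \<open>1\<close> lies in the span, so the basis has no common zero.\<close>

lemma corner_nonvanishing: "0 < (\<Sum>u\<in>ibox n m. (cmod (leval (e u) z w))\<^sup>2)"
proof (rule ccontr)
  assume "\<not> ?thesis"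
  then have "(\<Sum>u\<in>ibox n m. (cmod (leval (e u) z w))\<^sup>2) = 0"
    by (simp add: sum_nonneg antisym not_less)
  then have "leval (e u) z w = 0" if "u \<in> ibox n m" for u
    using that by (subst (asm) sum_nonneg_eq_0_iff) auto
  moreover have "lmono 0 0 \<in> mono_span (ibox n m)"
    by (rule lmono_in_span) (use n1 m1 in \<open>auto simp: ibox_def\<close>)
  ultimately have "leval (lmono 0 0) z w = 0"
    by (subst onb_leval_expand[OF eQ]) simp_all
  then show False by (simp add: leval_lmono del: lmono_0_0)
qed

text \<open>At a zero \<open>(z, w)\<close>, \<open>|p(z, r w)|\<^sup>2\<close> would be \<open>O((1 - r)\<^sup>2)\<close>, whereas the kernel identity bounds it
  below by a multiple of \<open>1 - r\<close>.\<close>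

lemma torus_nonvanishing:
  assumes z: "cmod z = 1" and w: "cmod w = 1"
  shows "leval p z w \<noteq> 0"
proof
  assume zero: "leval p z w = 0"
  define N where "N r = (\<Sum>l<m. (cmod (leval (e (int n, int l)) z (of_real r * w)))\<^sup>2)" for r :: real
  \<comment> \<open>\<open>A j\<close> is the coefficient of \<open>w\<^sup>j\<close> in
    \<open>p(z, _)\<close>; \<open>C\<close> bounds the growth of \<open>p(z, r w)\<close> away from
    its zero at \<open>r = 1\<close>.\<close>
  define A where "A j = (\<Sum>i<n + 1. coef p (int i, int j) * z ^ i)" for j
  define C where "C = (\<Sum>j<m + 1. cmod (A j) * real j)"
  have bound: "cmod (leval p z (of_real r * w)) \<le> C * (1 - r)" if r: "0 \<le> r" "r \<le> 1" for r
  proof -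
    have "leval p z (of_real r * w) = leval p z (of_real r * w) - leval p z w" using zero by simp
    also have "\<dots> = (\<Sum>j<m + 1. A j * w ^ j * of_real (r ^ j - 1))"
      unfolding leval_box[OF p_span] A_def sum_subtractf[symmetric]
      by (rule sum.cong) (simp_all add: power_mult_distrib algebra_simps)
    also have "cmod \<dots> \<le> (\<Sum>j<m + 1. cmod (A j) * real j * (1 - r))"
    proof (rule sum_norm_le)
      fix j
      have "1 + real j * (r - 1) \<le> (1 + (r - 1)) ^ j"
        by (rule Bernoulli_inequality) (use r in simp)
      moreover have "r ^ j \<le> 1" using r by (simp add: power_le_one)
      ultimately have "\<bar>r ^ j - 1\<bar> \<le> real j * (1 - r)" by (simp add: algebra_simps)
      then have "cmod (A j) * \<bar>r ^ j - 1\<bar> \<le> cmod (A j) * (real j * (1 - r))"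
        by (rule mult_left_mono) simp
      then show "cmod (A j * w ^ j * of_real (r ^ j - 1)) \<le> cmod (A j) * real j * (1 - r)"
        by (simp only: norm_mult norm_power w norm_of_real) (simp add: mult.assoc)
    qed
    also have "\<dots> = C * (1 - r)" unfolding C_def sum_distrib_right ..
    finally show ?thesis .
  qed
  \<comment> \<open>For \<open>|z| = 1\<close> only the middle term of the kernel identity survives,
    with the factor \<open>1 - r\<^sup>2\<close>. One factor \<open>1 - r\<close> cancels, so the
    bound still tends to \<open>0\<close>, whereas \<open>N r\<close> tends to \<open>N 1\<close>,
    which is positive.\<close>
  have NC: "N r \<le> C\<^sup>2 * (1 - r)" if r: "0 \<le> r" "r < 1" for r
  proof -
    have N0: "0 \<le> N r" by (simp add: N_def sum_nonneg)
    have "(1 - r\<^sup>2) * N r = (cmod (leval p z (of_real r * w)))\<^sup>2 - (cmod (leval \<phi> z (of_real r * w)))\<^sup>2"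
      using kernel_identity_norm[of z "of_real r * w"] z w
      by (simp add: N_def norm_mult power_mult_distrib)
    then have "(1 - r\<^sup>2) * N r \<le> (cmod (leval p z (of_real r * w)))\<^sup>2"
      using zero_le_power2[of "cmod (leval \<phi> z (of_real r * w))"] by linarith
    also have "\<dots> \<le> (C * (1 - r))\<^sup>2"
      using bound[of r] r by (intro power_mono) auto
    finally have "(1 - r) * ((1 + r) * N r) \<le> (1 - r) * (C\<^sup>2 * (1 - r))"
      by (simp add: power2_eq_square algebra_simps)
    then have "(1 + r) * N r \<le> C\<^sup>2 * (1 - r)"
      using r by (subst (asm) mult_le_cancel_left_pos) auto
    moreover have "N r \<le> (1 + r) * N r" using r N0 by (simp add: algebra_simps)
    ultimately show ?thesis by simp
  qed
  define r where "r k = 1 - inverse (real (Suc k))" for k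
  have r1: "r \<longlonglongrightarrow> 1"
    unfolding r_def using tendsto_diff[OF tendsto_const LIMSEQ_inverse_real_of_nat, of 1] by simp
  have "isCont N 1"
  proof -
    have hol: "(\<lambda>w. leval (e (int n, int l)) z w) holomorphic_on UNIV" if "l < m" for l
      using is_poly_e[of "(int n, int l)"] that
      by (intro leval_holomorphic_w) (auto simp: is_poly_def ibox_def)
    have "continuous_on UNIV (\<lambda>r::real. leval (e (int n, int l)) z (of_real r * w))" if "l < m" for l
      by (rule continuous_on_compose2[OF holomorphic_on_imp_continuous_on[OF hol[OF that]]])
        (auto intro!: continuous_intros)
    then have "continuous_on UNIV N"
      unfolding N_def by (intro continuous_intros) auto
    then show ?thesis by (simp add: continuous_on_eq_continuous_at)
  qed
  then have "(\<lambda>k. N (r k)) \<longlonglongrightarrow> N 1"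
    using r1 by (rule isCont_tendsto_compose)
  moreover have "(\<lambda>k. C\<^sup>2 * (1 - r k)) \<longlonglongrightarrow> C\<^sup>2 * (1 - 1)"
    by (intro tendsto_intros r1)
  moreover have "N (r k) \<le> C\<^sup>2 * (1 - r k)" for k
    by (rule NC) (auto simp: r_def field_simps)
  ultimately have "N 1 \<le> C\<^sup>2 * (1 - 1)"
    by (intro LIMSEQ_le) auto
  then show False
    using top_nonvanishing[OF z, of w] by (simp add: N_def)
qed

text \<open>Off the torus some term on the right of \<open>kernel_identity_norm\<close> is strictly
  positive: the first if both moduli are below \<open>1\<close>, the second if
  \<open>|z| = 1\<close>, the third if \<open>|w| = 1\<close>.\<close>

theorem stable_p: "stable_poly p"
  unfolding stable_poly_def
proof (intro allI impI, elim conjE)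
  fix z w assume z: "cmod z \<le> 1" and w: "cmod w \<le> 1"
  show "leval p z w \<noteq> 0"
  proof (cases "cmod z = 1 \<and> cmod w = 1")
    case True
    then show ?thesis using torus_nonvanishing by blast
  next
    case False
    let ?Q = "(1 - (cmod z)\<^sup>2) * (1 - (cmod w)\<^sup>2) * (\<Sum>u\<in>ibox n m. (cmod (leval (e u) z w))\<^sup>2)"
    let ?P = "(1 - (cmod w)\<^sup>2) * (\<Sum>l<m. (cmod (leval (e (int n, int l)) z w))\<^sup>2)"
    let ?R = "(1 - (cmod z)\<^sup>2) * (\<Sum>k<n. (cmod (leval (e (int k, int m)) z w))\<^sup>2)"
    have z2: "0 \<le> 1 - (cmod z)\<^sup>2" and w2: "0 \<le> 1 - (cmod w)\<^sup>2"
      using z w by (simp_all add: power_le_one)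
    have nn: "0 \<le> ?Q" "0 \<le> ?P" "0 \<le> ?R"
      using z2 w2 by (auto intro!: mult_nonneg_nonneg sum_nonneg simp del: diff_ge_0_iff_ge)
    have lt: "0 < 1 - (cmod u)\<^sup>2" if "cmod u < 1" for u :: complex
      using that by (simp add: power_less_one_iff)
    consider "cmod z < 1" "cmod w < 1" | "cmod z = 1" "cmod w < 1" | "cmod z < 1" "cmod w = 1"
      using False z w by linarith
    then have "0 < ?Q + ?P + ?R"
    proof cases
      case 1
      then have "0 < ?Q" using corner_nonvanishing by (intro mult_pos_pos lt)
      then show ?thesis using nn by linarith
    next
      case 2
      then have "0 < ?P" using top_nonvanishing by (intro mult_pos_pos lt)
      then show ?thesis using nn by linarith
    next
      case 3
      then have "0 < ?R" using right_nonvanishing by (intro mult_pos_pos lt)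
      then show ?thesis using nn by linarith
    qed
    then have "0 < (cmod (leval p z w))\<^sup>2"
      using kernel_identity_norm[of z w] zero_le_power2[of "cmod (leval \<phi> z w)"] by linarith
    then show ?thesis by auto
  qed
qed

end

section \<open>Orthonormality on the fibres\<close>

text \<open>\<open>fiber\<close> is the kernel identity for equal first coordinates of modulus
  \<open>1\<close>, where the terms with \<open>1 - x\<close> drop out: a Christoffel-Darboux
  formula in \<open>w\<close>. \<open>S\<close> carries the given inner product, \<open>B\<close>
  the weighted one.\<close>

locale side_stable = S: side L n m e + B: stable_box p n m
  for L :: "laurent \<Rightarrow> complex" and n m :: nat and e :: "int \<times> int \<Rightarrow> laurent" and p :: laurent +
  assumes fiber: "cmod z = 1 \<Longrightarrow>
    leval p z w * cnj (leval p z w') - leval (reversed n m p) z w * cnj (leval (reversed n m p) z w') =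
    (1 - w * cnj w') * (\<Sum>l<m. leval (e (int n, int l)) z w * cnj (leval (e (int n, int l)) z w'))"
begin

abbreviation f :: "nat \<Rightarrow> laurent" where "f l \<equiv> e (int n, int l)"

abbreviation D :: "complex \<Rightarrow> complex \<Rightarrow> complex" where
  "D z w \<equiv> complex_of_real ((cmod (leval p z w))\<^sup>2)"

text \<open>The inner product of \<open>g\<close> and \<open>f l\<close> for the weight on the fibre
  over \<open>z\<close>.\<close>

definition \<gamma> :: "laurent \<Rightarrow> nat \<Rightarrow> complex \<Rightarrow> complex" where
  "\<gamma> g l z = cmean (\<lambda>w. leval (g * dagger (f l)) z w / D z w)"

lemma one_minus_nz: "cmod w = 1 \<Longrightarrow> cmod u < 1 \<Longrightarrow> 1 - cnj w * u \<noteq> 0"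
  "cmod w = 1 \<Longrightarrow> cmod u < 1 \<Longrightarrow> 1 - w * cnj u \<noteq> 0"
proof -
  show *: "1 - cnj w * u \<noteq> 0" if "cmod w = 1" "cmod u < 1" for w u
  proof
    assume "1 - cnj w * u = 0"
    then have "cmod (cnj w * u) = 1" by simp
    then show False using that by (simp only: norm_mult complex_mod_cnj)
  qed
  show "1 - w * cnj u \<noteq> 0" if "cmod w = 1" "cmod u < 1"
    using *[OF that] by (metis complex_cnj_cnj complex_cnj_mult complex_cnj_one mult_eq_0_iff cancel_comm_monoid_add_class.diff_cancel right_minus_eq)
qed

lemma leval_reversed_torus:
  assumes "cmod z = 1" "cmod w = 1"
  shows "leval (reversed n m g) z w = z ^ n * w ^ m * cnj (leval g z w)"
  using assms by (simp add: reversed_def leval_mult_torus leval_dagger_torus leval_lmono)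

lemma reversed_supp_w:
  assumes "g \<in> mono_span (ibox (n + 1) m)"
  shows "\<forall>(i, j)\<in>supp (reversed n m g). 0 < j"
proof -
  have "0 < j" if "(i, j) \<in> supp (reversed n m g)" for i j
  proof -
    have "(int n - i, int m - j) \<in> supp g"
      using that by (auto simp: in_keys_iff coef_reversed)
    then show ?thesis using assms by (auto simp: mono_span_eq ibox_def)
  qed
  then show ?thesis by blast
qed

text \<open>Divide the conjugate of \<open>fiber\<close> at \<open>w' = u\<close> by
  \<open>1 - cnj w * u\<close>. The part with \<open>p\<close> reproduces \<open>g\<close> through
  the Szego kernel. The part with \<open>reversed n m p\<close> is the conjugate of a holomorphic
  function of \<open>w\<close> vanishing at \<open>0\<close>, because \<open>g\<close> has
  \<open>w\<close>-degree below \<open>m\<close>.\<close>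

lemma fiber_reproducing:
  assumes z: "cmod z = 1" and u: "cmod u < 1" and g: "g \<in> mono_span (ibox (n + 1) m)"
  shows "(\<Sum>l<m. \<gamma> g l z * leval (f l) z u) = leval g z u"
proof -
  let ?r = "reversed n m p" and ?q = "reversed n m g"
  have gw: "\<forall>(i, j)\<in>supp g. 0 \<le> j" using is_poly_box[OF g] by (auto simp: is_poly_def)
  have qw: "\<forall>(i, j)\<in>supp ?q. 0 < j" by (rule reversed_supp_w[OF g])
  then have qw': "\<forall>(i, j)\<in>supp ?q. 0 \<le> j" by fastforce
  let ?A = "\<lambda>w. leval g z w / leval p z w / (1 - cnj w * u)"
  let ?B = "\<lambda>w. leval ?q z w / leval p z w / (1 - w * cnj u)"
  have z1: "cmod z \<le> 1" using z by simp
  have cg: "continuous_on circ (\<lambda>w. leval g z w / leval p z w)"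
    using B.quot_hol_w(2)[OF gw z1] by (rule continuous_on_subset) auto
  have cq: "continuous_on (cball 0 1) (\<lambda>w. leval ?q z w / leval p z w)"
    using B.quot_hol_w(2)[OF qw' z1] .
  have nz1: "1 - w * cnj u \<noteq> 0" if "cmod w \<le> 1" for w
  proof
    assume "1 - w * cnj u = 0"
    then have "cmod (w * cnj u) = 1" by simp
    moreover have "cmod (w * cnj u) < 1"
      using that u mult_left_le_one_le[of "cmod u" "cmod w"] by (simp add: norm_mult)
    ultimately show False by simp
  qed
  have cA: "continuous_on circ ?A"
    by (intro continuous_on_divide cg continuous_intros) (auto simp: one_minus_nz u simp del: right_minus_eq)
  have cB: "continuous_on (cball 0 1) ?B"
    by (intro continuous_on_divide cq continuous_intros) (auto simp: nz1 simp del: right_minus_eq)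
  have hB: "?B holomorphic_on ball 0 1"
    by (intro holomorphic_on_divide B.quot_hol_w(1)[OF qw' z1] holomorphic_intros)
      (auto simp: nz1 simp del: right_minus_eq)
  have "cmean ?B = 0"
    using cmean_holomorphic[OF cB hB] leval_w_0[OF qw] by simp
  then have MB: "cmean (\<lambda>w. cnj (?B w)) = 0"
    by (simp only: cmean_cnj) simp
  have MA: "cmean ?A = leval g z u / leval p z u"
    using B.quot_hol_w[OF gw z1] u by (intro cmean_Szego) auto
  have "(\<Sum>l<m. \<gamma> g l z * leval (f l) z u) =
      cmean (\<lambda>w. \<Sum>l<m. leval (g * dagger (f l)) z w / D z w * leval (f l) z u)"
    unfolding \<gamma>_def cmean_mult_right[symmetric]
    by (rule cmean_sum[symmetric]) (intro continuous_intros B.quot_continuous_w z)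
  also have "\<dots> = cmean (\<lambda>w. ?A w * leval p z u - cnj (?B w) * leval ?r z u)"
  proof (rule cmean_cong)
    fix w assume w: "cmod w = 1"
    have nzp: "leval p z w \<noteq> 0" using z w by (rule B.nz)
    let ?d = "1 - cnj w * u"
    have d: "?d \<noteq> 0" by (rule one_minus_nz[OF w u])
    have "(\<Sum>l<m. leval (g * dagger (f l)) z w / D z w * leval (f l) z u) * ?d =
        leval g z w / D z w * cnj ((1 - w * cnj u) * (\<Sum>l<m. leval (f l) z w * cnj (leval (f l) z u)))"
      by (simp add: leval_mult_torus leval_dagger_torus z w sum_distrib_left sum_distrib_right mult_ac
          del: of_real_power)
    also have "\<dots> = leval g z w / D z w * (cnj (leval p z w) * leval p z u - cnj (leval ?r z w) * leval ?r z u)"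
      unfolding fiber[OF z, symmetric] by simp
    also have "\<dots> = leval g z w / leval p z w * leval p z u -
        cnj (leval ?q z w / leval p z w) * leval ?r z u"
    proof -
      have 1: "leval g z w / D z w * cnj (leval p z w) = leval g z w / leval p z w"
        using nzp by (simp add: complex_norm_square del: of_real_power)
      have 2: "leval g z w / D z w * cnj (leval ?r z w) = cnj (leval ?q z w / leval p z w)"
        using nzp unfolding leval_reversed_torus[OF z w]
        by (simp add: complex_norm_square del: of_real_power)
      show ?thesis
        unfolding 1[symmetric] 2[symmetric] by (simp add: algebra_simps)
    qed
    also have "\<dots> = (?A w * leval p z u - cnj (?B w) * leval ?r z u) * ?d"
    proof -
      have "cnj (?B w) = cnj (leval ?q z w / leval p z w) / ?d" by simp
      then show ?thesis using d by (simp only: left_diff_distrib) (simp add: mult.commute)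
    qed
    finally show "(\<Sum>l<m. leval (g * dagger (f l)) z w / D z w * leval (f l) z u) =
        ?A w * leval p z u - cnj (?B w) * leval ?r z u"
      using d by (simp only: mult_cancel_right) blast
  qed
  also have "\<dots> = cmean ?A * leval p z u - cmean (\<lambda>w. cnj (?B w)) * leval ?r z u"
    unfolding cmean_mult_right[symmetric]
    by (rule cmean_diff; intro continuous_on_mult continuous_on_const continuous_on_cnj cA
        continuous_on_subset[OF cB]) auto
  also have "\<dots> = leval g z u"
    unfolding MA MB using B.stable_nz[of z u] z1 u by simp
  finally show ?thesis .
qed

text \<open>\<open>fiber_reproducing\<close> writes \<open>f k\<close> as a combination of the
  \<open>f l\<close> on the fibre; by \<open>f_independent\<close> the coefficients are the trivial
  ones.\<close>

lemma fiber_orthonormal: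
  assumes z: "cmod z = 1" and k: "k < m" and l: "l < m"
  shows "\<gamma> (f k) l z = (if k = l then 1 else 0)"
proof -
  let ?c = "\<lambda>l. \<gamma> (f k) l z - (if k = l then 1 else 0)"
  have "(\<Sum>l<m. ?c l * leval (f l) z u) = 0" if u: "cmod u < 1" for u
  proof -
    have "(\<Sum>l<m. ?c l * leval (f l) z u) = leval (f k) z u - (\<Sum>l<m. if k = l then leval (f l) z u else 0)"
      unfolding fiber_reproducing[OF z u S.f_span[OF k], symmetric] sum_subtractf[symmetric]
      by (rule sum.cong) (auto simp: algebra_simps)
    then show ?thesis using k by simp
  qed
  from S.f_independent[OF z this l] show ?thesis by simp
qed

text \<open>The Gram matrix is the identity on every fibre, so only the mean of
  \<open>z\<^sup>a\<close> remains.\<close>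

lemma bs_f_inn:
  assumes k: "k < m" and l: "l < m"
  shows "linner (bs p) (lmono a 0 * f k) (f l) = (if k = l \<and> a = 0 then 1 else 0)"
proof -
  have "linner (bs p) (lmono a 0 * f k) (f l) = cmean (\<lambda>z. \<gamma> (f k) l z * z powi a)"
    unfolding linner_def bs_def \<gamma>_def cmean_mult_right[symmetric]
    by (intro cmean_cong) (simp add: leval_mult_torus leval_lmono mult_ac)
  also have "\<dots> = cmean (\<lambda>z. (if k = l then 1 else 0) * z powi a)"
    by (intro cmean_cong) (simp add: fiber_orthonormal k l)
  also have "\<dots> = (if k = l \<and> a = 0 then 1 else 0)"
    by (simp only: cmean_cmult cmean_power) simp
  finally show ?thesis .
qed

text \<open>Splitting \<open>z h\<close> into its components in and orthogonal to the smaller box, \<open>N\<close> times in a row, moves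
  \<open>g\<close> to \<open>z\<^sup>-\<^sup>N h\<close> with \<open>h\<close> bounded: the split-off \<open>z\<^sup>-\<^sup>k f l\<close> do not contribute by \<open>bs_f_inn\<close>.\<close>

lemma ladder:
  assumes g: "g \<in> mono_span (ibox n m)"
  shows "\<exists>h\<in>mono_span (ibox n m). Re (linner L h h) \<le> Re (linner L g g) \<and>
    (\<forall>l<m. \<forall>b. linner (bs p) (lmono (- int b) 0 * g) (f l) =
      linner (bs p) (lmono (- int (b + N)) 0 * h) (f l))"
proof (induction N)
  case 0
  then show ?case using g by (intro bexI[of _ g]) auto
next
  case (Suc N)
  then obtain h where h: "h \<in> mono_span (ibox n m)" "Re (linner L h h) \<le> Re (linner L g g)"
    and hl: "\<And>l b. l < m \<Longrightarrow> linner (bs p) (lmono (- int b) 0 * g) (f l) =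
      linner (bs p) (lmono (- int (b + N)) 0 * h) (f l)" by blast
  let ?zh = "lmono 1 0 * h"
  have zh: "?zh \<in> mono_span (ibox (n + 1) m)" by (rule S.z_Q[OF h(1)])
  \<comment> \<open>The projection of \<open>z h\<close> to the smaller box with respect to
    \<open>L\<close>, so its norm is at most that of \<open>h\<close>.\<close>
  define h' where "h' = (\<Sum>u\<in>ibox n m. lscale (linner L ?zh (e u)) (e u))"
  have h': "h' \<in> mono_span (ibox n m)"
    unfolding h'_def by (intro mono_span_sum mono_span_lscale onb_in_span[OF S.eQ])
  have zh_eq: "?zh = h' + (\<Sum>l<m. lscale (linner L ?zh (f l)) (f l))"
    unfolding h'_def using onb_expand[OF S.eP zh] unfolding S.sum_P .
  have "linner L h' (e u) = linner L ?zh (e u)" if u: "u \<in> ibox n m" for u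
  proof -
    have "linner L h' (e u) = (\<Sum>v\<in>ibox n m. if v = u then linner L ?zh (e v) else 0)"
      unfolding h'_def S.inn_sum_left
      by (rule sum.cong) (auto simp: S.inn_lscale_left onb_inn[OF S.eQ _ u])
    then show ?thesis using u by simp
  qed
  then have "Re (linner L h' h') = (\<Sum>u\<in>ibox n m. (cmod (linner L ?zh (e u)))\<^sup>2)"
    unfolding S.onb_norm[OF S.eQ h'] by simp
  also have "\<dots> \<le> (\<Sum>u\<in>ibox (n + 1) m. (cmod (linner L ?zh (e u)))\<^sup>2)"
    unfolding S.sum_P by (simp add: sum_nonneg)
  also have "\<dots> = Re (linner L h h)"
    unfolding S.onb_norm[OF S.eP zh, symmetric] S.inn_shift ..
  finally have norm: "Re (linner L h' h') \<le> Re (linner L g g)" using h(2) by simp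
  have "linner (bs p) (lmono (- int b) 0 * g) (f l) = linner (bs p) (lmono (- int (b + Suc N)) 0 * h') (f l)"
    if l: "l < m" for l b
  proof -
    have "lmono (- int (b + N)) 0 * h = lmono (- int (b + Suc N)) 0 * ?zh"
      by (simp add: mult.assoc[symmetric] lmono_mult)
    also have "\<dots> = lmono (- int (b + Suc N)) 0 * h' +
        (\<Sum>k<m. lscale (linner L ?zh (f k)) (lmono (- int (b + Suc N)) 0 * f k))"
      by (subst zh_eq) (simp add: distrib_left sum_distrib_left lscale_mult_right)
    \<comment> \<open>\<open>Suc\<close> keeps the exponent of \<open>z\<close> nonzero even for
      \<open>b = N = 0\<close>; therefore \<open>bs_f_inn\<close> removes every \<open>f k\<close>,
      also \<open>k = l\<close>.\<close>
    finally have "linner (bs p) (lmono (- int (b + N)) 0 * h) (f l) =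
        linner (bs p) (lmono (- int (b + Suc N)) 0 * h') (f l)"
      using l by (simp add: B.inn_add_left B.inn_sum_left B.inn_lscale_left bs_f_inn)
    then show ?thesis using hl[OF l, of b] by simp
  qed
  with norm h' show ?case by blast
qed

text \<open>\<open>ladder\<close> replaces \<open>g\<close> by \<open>z\<^sup>-\<^sup>N h\<close>.
  The coefficients of \<open>h\<close> in the basis stay bounded, as its \<open>L\<close>-norm does,
  while every shifted basis element contributes an inner product that decays with
  \<open>N\<close>.\<close>

lemma bs_f_Q:
  assumes g: "g \<in> mono_span (ibox n m)" and l: "l < m"
  shows "linner (bs p) (lmono (- int b) 0 * g) (f l) = 0"
proof -
  define c where "c = linner (bs p) (lmono (- int b) 0 * g) (f l)"
  define G where "G = sqrt (Re (linner L g g))"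
  have bound: "cmod c \<le> (\<Sum>u\<in>ibox n m. G * cmod (linner (bs p) (lmono (- int (b + N)) 0 * e u) (f l)))" for N
  proof -
    obtain h where h: "h \<in> mono_span (ibox n m)" "Re (linner L h h) \<le> Re (linner L g g)"
      and hl: "c = linner (bs p) (lmono (- int (b + N)) 0 * h) (f l)"
      unfolding c_def using ladder[OF g, of N] l by blast
    have "c = (\<Sum>u\<in>ibox n m. linner L h (e u) * linner (bs p) (lmono (- int (b + N)) 0 * e u) (f l))"
      unfolding hl by (subst onb_expand[OF S.eQ h(1)])
        (simp add: sum_distrib_left lscale_mult_right B.inn_sum_left B.inn_lscale_left)
    moreover have "cmod (linner L h (e u)) \<le> G" if "u \<in> ibox n m" for u
    proof -
      have "(cmod (linner L h (e u)))\<^sup>2 \<le> Re (linner L h h)"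
        unfolding S.onb_norm[OF S.eQ h(1)] using that by (intro member_le_sum) auto
      then show ?thesis unfolding G_def using h(2) by (intro real_le_rsqrt) simp
    qed
    ultimately show ?thesis
      by (auto intro!: sum_norm_le mult_right_mono simp: norm_mult)
  qed
  have "(\<lambda>N. linner (bs p) (lmono (- int (b + N)) 0 * e u) (f l)) \<longlonglongrightarrow> 0" for u
  proof -
    have "linner (bs p) (lmono (- int (b + N)) 0 * e u) (f l) =
        bs p (lmono (- int N) 0 * (lmono (- int b) 0 * e u * dagger (f l)))" for N
      by (simp add: linner_def mult.assoc[symmetric] lmono_mult minus_diff_commute)
    then show ?thesis using B.bs_decay_z by simp
  qed
  then have "(\<lambda>N. \<Sum>u\<in>ibox n m. G * cmod (linner (bs p) (lmono (- int (b + N)) 0 * e u) (f l))) \<longlonglongrightarrow> 0"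
    by (intro tendsto_null_sum tendsto_mult_right_zero tendsto_norm_zero)
  then have "cmod c \<le> 0"
    by (rule LIMSEQ_le_const) (use bound in blast)
  then show ?thesis by (simp add: c_def)
qed

text \<open>The outer mean is a Szego integral of \<open>\<gamma> g l\<close>, whose relevant
  Fourier coefficients vanish by \<open>bs_f_Q\<close>. This removes the \<open>P - Q\<close> term
  from the integrated kernel identity.\<close>

lemma kernel_term_zero:
  assumes g: "g \<in> mono_span (ibox n m)" and l: "l < m" and u: "cmod u < 1"
  shows "cmean (\<lambda>z. cmean (\<lambda>w. leval (g * dagger (f l)) z w / D z w / (1 - cnj z * u))) = 0"
proof -
  have "cmean (\<lambda>z. \<gamma> g l z / (1 - cnj z * u)) = 0"
  proof (rule cmean_geometric_zero[OF _ u])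
    show "continuous_on circ (\<gamma> g l)"
      unfolding \<gamma>_def by (rule B.quot_mean_continuous)
    fix a :: nat
    have "cmean (\<lambda>z. \<gamma> g l z * z powi (- int a)) = linner (bs p) (lmono (- int a) 0 * g) (f l)"
      unfolding linner_def bs_def \<gamma>_def cmean_mult_right[symmetric]
      by (intro cmean_cong) (simp add: leval_mult_torus leval_lmono mult_ac)
    then show "cmean (\<lambda>z. \<gamma> g l z * z powi (- int a)) = 0"
      by (simp add: bs_f_Q[OF g l])
  qed
  moreover have "cmean (\<lambda>w. leval (g * dagger (f l)) z w / D z w / (1 - cnj z * u)) = \<gamma> g l z / (1 - cnj z * u)" for z
    unfolding \<gamma>_def using cmean_mult_right[of _ "inverse (1 - cnj z * u)"]
    by (simp add: divide_inverse del: of_real_power)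
  ultimately show ?thesis by simp
qed

end

section \<open>Agreement of the two functionals\<close>

abbreviation dmean :: "(complex \<Rightarrow> complex \<Rightarrow> complex) \<Rightarrow> complex" where
  "dmean F \<equiv> cmean (\<lambda>z. cmean (\<lambda>w. F z w))"

lemma dmean_cong: "(\<And>z w. cmod z = 1 \<Longrightarrow> cmod w = 1 \<Longrightarrow> F z w = G z w) \<Longrightarrow> dmean F = dmean G"
  by (intro cmean_cong)

lemma dmean_diff:
  assumes "continuous_on (circ \<times> circ) (\<lambda>(z, w). F z w)" "continuous_on (circ \<times> circ) (\<lambda>(z, w). G z w)"
  shows "dmean (\<lambda>z w. F z w - G z w) = dmean F - dmean G"
proof -
  have "dmean (\<lambda>z w. F z w - G z w) = cmean (\<lambda>z. cmean (\<lambda>w. F z w) - cmean (\<lambda>w. G z w))"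
    by (intro cmean_cong cmean_diff continuous_on_slices(1)[OF assms(1)] continuous_on_slices(1)[OF assms(2)])
  then show ?thesis
    by (simp add: cmean_diff continuous_on_cmean assms)
qed

lemma dmean_sum:
  assumes "\<And>x. x \<in> A \<Longrightarrow> continuous_on (circ \<times> circ) (\<lambda>(z, w). F x z w)"
  shows "dmean (\<lambda>z w. \<Sum>x\<in>A. F x z w) = (\<Sum>x\<in>A. dmean (F x))"
proof -
  have "dmean (\<lambda>z w. \<Sum>x\<in>A. F x z w) = cmean (\<lambda>z. \<Sum>x\<in>A. cmean (\<lambda>w. F x z w))"
    by (intro cmean_cong cmean_sum continuous_on_slices(1)[OF assms])
  then show ?thesis
    by (simp add: cmean_sum continuous_on_cmean assms)
qed

context config
begin

lemma side_stable_L: "side_stable L n m e p"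
proof -
  have "stable_box p n m"
    using is_poly_box[OF p_span] stable_p p_span by unfold_locales
  moreover have "leval p z w * cnj (leval p z w') -
      leval (reversed n m p) z w * cnj (leval (reversed n m p) z w') =
    (1 - w * cnj w') * (\<Sum>l<m. leval (e (int n, int l)) z w * cnj (leval (e (int n, int l)) z w'))"
    if "cmod z = 1" for z w w'
  proof -
    have "z * cnj z = 1" using that by (simp flip: complex_norm_square)
    then show ?thesis using kernel_identity[of z w z w'] by simp
  qed
  ultimately show ?thesis
    using side_L by (simp add: side_stable_def side_stable_axioms_def)
qed

lemma side_stable_swap: "side_stable (\<lambda>q. L (swapl q)) m n (\<lambda>u. swapl (e (prod.swap u))) (swapl p)"
  using config.side_stable_L[OF config_swap] by (simp add: swapl_reversed)

sublocale B: stable_box p n m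
  using side_stable_L by (simp add: side_stable_def)

abbreviation D :: "complex \<Rightarrow> complex \<Rightarrow> complex" where
  "D z w \<equiv> complex_of_real ((cmod (leval p z w))\<^sup>2)"

text \<open>\<open>kernel_term_zero\<close> with the variables exchanged; Fubini restores the order
  of the means.\<close>

lemma right_term_zero:
  assumes g: "g \<in> mono_span (ibox n m)" and k: "k < n" and u: "cmod u < 1"
  shows "dmean (\<lambda>z w. leval (g * dagger (e (int k, int m))) z w / D z w / (1 - cnj w * u)) = 0"
proof -
  have g': "swapl g \<in> mono_span (ibox m n)"
    using swapl_in_span[OF g] by (simp add: swap_box)
  have c: "continuous_on (circ \<times> circ)
      (\<lambda>(z, w). leval (g * dagger (e (int k, int m))) z w / D z w / (1 - cnj w * u))"
    unfolding case_prod_unfold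
    by (intro continuous_on_divide B.quot_continuous[unfolded case_prod_unfold] continuous_intros)
      (use u in \<open>auto simp: side_stable.one_minus_nz[OF side_stable_L] simp del: right_minus_eq\<close>)
  have "dmean (\<lambda>z w. leval (g * dagger (e (int k, int m))) z w / D z w / (1 - cnj w * u)) =
      dmean (\<lambda>w z. leval (g * dagger (e (int k, int m))) z w / D z w / (1 - cnj w * u))"
    by (rule cmean_torus_integral(3)[OF c])
  also have "\<dots> = 0"
    using side_stable.kernel_term_zero[OF side_stable_swap g' k u]
    by (simp add: swapl_dagger[symmetric] swapl_mult[symmetric] leval_swapl del: of_real_power)
  finally show ?thesis .
qed

text \<open>Conjugate the kernel identity between \<open>(z, w)\<close> and \<open>(a, b)\<close>,
  divide by \<open>(1 - cnj z * a) * (1 - cnj w * b)\<close> and integrate against \<open>f\<close>.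
  Two Szego formulas evaluate \<open>T1\<close>; \<open>T2\<close> is the conjugate of a function
  holomorphic in \<open>w\<close> and zero at \<open>w = 0\<close>; \<open>T3\<close> and
  \<open>T4\<close> vanish as \<open>f\<close> is orthogonal to both complements.\<close>

lemma corner_reproducing:
  assumes f: "f \<in> mono_span (ibox n m)" and a: "cmod a < 1" and b: "cmod b < 1"
  shows "(\<Sum>u\<in>ibox n m. linner (bs p) f (e u) * leval (e u) a b) = leval f a b"
proof -
  let ?q = "reversed n m f"
  let ?k = "\<lambda>v z w. leval (f * dagger (e v)) z w / D z w"
  define T1 where "T1 z w = leval f z w / leval p z w / (1 - cnj w * b) / (1 - cnj z * a) * leval p a b" for z w
  define T2 where "T2 z w = cnj (leval ?q z w / leval p z w / (1 - w * cnj b) / (1 - z * cnj a)) * leval \<phi> a b" for z w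
  define T3 where "T3 z w = (\<Sum>l<m. ?k (int n, int l) z w / (1 - cnj z * a) * leval (e (int n, int l)) a b)" for z w
  define T4 where "T4 z w = (\<Sum>k<n. ?k (int k, int m) z w / (1 - cnj w * b) * leval (e (int k, int m)) a b)" for z w
  note nz = side_stable.one_minus_nz[OF side_stable_L]
  have fP: "f \<in> mono_span (ibox (n + 1) m)" by (rule side.Q_P[OF side_L f])
  have qj: "\<forall>(i, j)\<in>supp ?q. 0 < j" by (rule side_stable.reversed_supp_w[OF side_stable_L fP])
  then have qj': "\<forall>(i, j)\<in>supp ?q. 0 \<le> j" by fastforce
  have fi: "\<forall>(i, j)\<in>supp f. 0 \<le> i" "\<forall>(i, j)\<in>supp f. 0 \<le> j"
    using is_poly_box[OF f] by (auto simp: is_poly_def)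
  have cl: "continuous_on (circ \<times> circ) (\<lambda>x. leval q (fst x) (snd x))" for q
    using leval_continuous[of circ circ q] by (simp add: case_prod_unfold)
  have ck: "continuous_on (circ \<times> circ) (\<lambda>x. ?k v (fst x) (snd x))" for v
    using B.quot_continuous by (simp add: case_prod_unfold)
  note nzs = nz B.nz a b
  have c1: "continuous_on (circ \<times> circ) (\<lambda>(z, w). T1 z w)"
    unfolding case_prod_unfold T1_def
    by (intro continuous_on_divide continuous_on_mult cl continuous_intros) (auto simp: nzs simp del: right_minus_eq)
  have c2: "continuous_on (circ \<times> circ) (\<lambda>(z, w). T2 z w)"
    unfolding case_prod_unfold T2_def
    by (intro continuous_on_divide continuous_on_mult continuous_on_cnj cl continuous_intros)
      (auto simp: nzs simp del: right_minus_eq)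
  have c3': "continuous_on (circ \<times> circ) (\<lambda>(z, w). ?k v z w / (1 - cnj z * a) * c)" for v c
    unfolding case_prod_unfold
    by (intro continuous_on_divide continuous_on_mult ck continuous_intros) (auto simp: nzs simp del: right_minus_eq)
  have c4': "continuous_on (circ \<times> circ) (\<lambda>(z, w). ?k v z w / (1 - cnj w * b) * c)" for v c
    unfolding case_prod_unfold
    by (intro continuous_on_divide continuous_on_mult ck continuous_intros) (auto simp: nzs simp del: right_minus_eq)
  have c3: "continuous_on (circ \<times> circ) (\<lambda>(z, w). T3 z w)"
    unfolding case_prod_unfold T3_def by (intro continuous_on_sum c3'[unfolded case_prod_unfold])
  have c4: "continuous_on (circ \<times> circ) (\<lambda>(z, w). T4 z w)"
    unfolding case_prod_unfold T4_def by (intro continuous_on_sum c4'[unfolded case_prod_unfold])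
  have "dmean T1 = leval f a b"
  proof -
    have "dmean T1 = cmean (\<lambda>z. leval f z b / leval p z b / (1 - cnj z * a)) * leval p a b"
      unfolding T1_def cmean_mult_right
    proof (intro arg_cong2[where f = "(*)"] refl cmean_cong)
      fix z :: complex assume "cmod z = 1"
      then have z: "cmod z \<le> 1" by simp
      have "cmean (\<lambda>w. leval f z w / leval p z w / (1 - cnj w * b)) = leval f z b / leval p z b"
        by (rule cmean_Szego[OF B.quot_hol_w(2,1)[OF fi(2) z] b])
      then show "cmean (\<lambda>w. leval f z w / leval p z w / (1 - cnj w * b) / (1 - cnj z * a)) =
          leval f z b / leval p z b / (1 - cnj z * a)"
        using cmean_mult_right[of _ "inverse (1 - cnj z * a)"] by (simp add: divide_inverse)
    qed
    also have "cmean (\<lambda>z. leval f z b / leval p z b / (1 - cnj z * a)) = leval f a b / leval p a b"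
      using b by (intro cmean_Szego[OF _ _ a] B.quot_hol_z fi) auto
    finally show ?thesis using B.stable_nz[of a b] a b by simp
  qed
  moreover have "dmean T2 = 0"
  proof -
    have "cmean (\<lambda>w. T2 z w) = 0" if "cmod z = 1" for z
    proof -
      have z: "cmod z \<le> 1" using that by simp
      have nzb: "1 - w * cnj b \<noteq> 0" if "cmod w \<le> 1" for w
      proof
        assume "1 - w * cnj b = 0"
        then have "cmod (w * cnj b) = 1" by simp
        moreover have "cmod (w * cnj b) < 1"
          using that b mult_left_le_one_le[of "cmod b" "cmod w"] by (simp add: norm_mult)
        ultimately show False by simp
      qed
      let ?h = "\<lambda>w. leval ?q z w / leval p z w / (1 - w * cnj b)"
      have "continuous_on (cball 0 1) ?h"
        by (intro continuous_on_divide[OF B.quot_hol_w(2)[OF qj' z]] continuous_intros)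
          (auto simp: nzb simp del: right_minus_eq)
      moreover have "?h holomorphic_on ball 0 1"
        by (intro holomorphic_on_divide[OF B.quot_hol_w(1)[OF qj' z]] holomorphic_intros)
          (auto simp: nzb simp del: right_minus_eq)
      ultimately have "cmean ?h = 0"
        using cmean_holomorphic[of ?h] leval_w_0[OF qj] by simp
      then have "cmean (\<lambda>w. cnj (?h w)) = 0"
        by (simp only: cmean_cnj) simp
      moreover have "T2 z = (\<lambda>w. cnj (?h w) * (leval \<phi> a b / (1 - cnj z * a)))"
        by (simp add: T2_def fun_eq_iff)
      ultimately show ?thesis
        by (simp only: cmean_mult_right) simp
    qed
    then have "dmean T2 = cmean (\<lambda>z. 0)" by (intro cmean_cong)
    then show ?thesis by simp
  qed
  moreover have "dmean T3 = 0"
  proof -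
    have "dmean (\<lambda>z w. ?k (int n, int l) z w / (1 - cnj z * a) * leval (e (int n, int l)) a b) = 0"
      if "l < m" for l
      unfolding cmean_mult_right side_stable.kernel_term_zero[OF side_stable_L f that a] by (rule mult_zero_left)
    then show ?thesis
      unfolding T3_def dmean_sum[OF c3'] by (intro sum.neutral) blast
  qed
  moreover have "dmean T4 = 0"
  proof -
    have "dmean (\<lambda>z w. ?k (int k, int m) z w / (1 - cnj w * b) * leval (e (int k, int m)) a b) = 0"
      if "k < n" for k
      unfolding cmean_mult_right right_term_zero[OF f that b] by (rule mult_zero_left)
    then show ?thesis
      unfolding T4_def dmean_sum[OF c4'] by (intro sum.neutral) blast
  qed
  moreover have "(\<Sum>u\<in>ibox n m. linner (bs p) f (e u) * leval (e u) a b) = dmean T1 - dmean T2 - dmean T3 - dmean T4"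
  proof -
    have cq: "continuous_on (circ \<times> circ) (\<lambda>(z, w). ?k v z w * c)" for v c
      unfolding case_prod_unfold by (intro continuous_on_mult ck continuous_intros)
    have "(\<Sum>u\<in>ibox n m. linner (bs p) f (e u) * leval (e u) a b) =
        dmean (\<lambda>z w. \<Sum>u\<in>ibox n m. ?k u z w * leval (e u) a b)"
      unfolding dmean_sum[OF cq] cmean_mult_right linner_def bs_def ..
    also have "\<dots> = dmean (\<lambda>z w. T1 z w - T2 z w - T3 z w - T4 z w)"
    proof (rule dmean_cong)
      fix z w assume z: "cmod z = 1" and w: "cmod w = 1"
      define x y where "x = 1 - cnj z * a" and "y = 1 - cnj w * b"
      have xy: "x \<noteq> 0" "y \<noteq> 0" unfolding x_def y_def using z w a b by (intro nz; simp)+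
      have nzp: "leval p z w \<noteq> 0" using z w by (rule B.nz)
      let ?s = "\<lambda>q. cnj (leval q z w) * leval q a b"
      let ?F = "leval f z w / D z w"
      have id: "?s p - ?s \<phi> = x * y * (\<Sum>u\<in>ibox n m. ?s (e u)) +
          y * (\<Sum>l<m. ?s (e (int n, int l))) + x * (\<Sum>k<n. ?s (e (int k, int m)))"
        using arg_cong[OF kernel_identity[of z w a b], of cnj] by (simp add: x_def y_def)
      have S: "(\<Sum>v\<in>A. ?k (h v) z w * leval (e (h v)) a b) = ?F * (\<Sum>v\<in>A. ?s (e (h v)))"
        for A :: "'c set" and h
        unfolding sum_distrib_left
        by (rule sum.cong) (simp_all add: leval_mult_torus leval_dagger_torus z w del: of_real_power)
      have T3: "T3 z w * x = ?F * (\<Sum>l<m. ?s (e (int n, int l)))"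
        unfolding T3_def S[symmetric] sum_distrib_right x_def[symmetric] using xy by (intro sum.cong) auto
      have T4: "T4 z w * y = ?F * (\<Sum>k<n. ?s (e (int k, int m)))"
        unfolding T4_def S[symmetric] sum_distrib_right y_def[symmetric] using xy by (intro sum.cong) auto
      have T1: "T1 z w * (x * y) = ?F * ?s p"
        unfolding T1_def x_def[symmetric] y_def[symmetric] using xy nzp
        by (simp add: complex_norm_square del: of_real_power)
      have T2: "T2 z w * (x * y) = ?F * ?s \<phi>"
      proof -
        \<comment> \<open>On the torus reversal is conjugation up to the unimodular factor
          \<open>c\<close>, so it can be moved from \<open>\<phi>\<close> to
          \<open>f\<close>.\<close>
        define c where "c = z ^ n * w ^ m"
        have "cnj c * c = c * cnj c" by (rule mult.commute)
        also have "\<dots> = 1"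
          unfolding complex_norm_square[symmetric] by (simp add: c_def norm_mult norm_power z w)
        finally have c: "cnj c * c = 1" .
        have p: "leval p z w = c * cnj (leval \<phi> z w)" and q: "leval ?q z w = c * cnj (leval f z w)"
          unfolding c_def by (rule side_stable.leval_reversed_torus[OF side_stable_L z w])+
        have "cnj (leval ?q z w) * leval p z w = (cnj c * c) * (leval f z w * cnj (leval \<phi> z w))"
          unfolding p q by (simp add: ac_simps)
        then have "leval f z w * cnj (leval \<phi> z w) = cnj (leval ?q z w) * leval p z w"
          by (simp add: c)
        then have "?F * cnj (leval \<phi> z w) = cnj (leval ?q z w) * leval p z w / D z w"
          by (simp del: of_real_power)
        also have "\<dots> = cnj (leval ?q z w) / cnj (leval p z w)"
          using nzp by (simp add: complex_norm_square del: of_real_power)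
        finally have "cnj (leval ?q z w) / cnj (leval p z w) = ?F * cnj (leval \<phi> z w)" ..
        moreover have "T2 z w * (x * y) = cnj (leval ?q z w) / cnj (leval p z w) * leval \<phi> a b"
          using xy by (simp add: T2_def x_def y_def)
        ultimately show ?thesis by simp
      qed
      have "(\<Sum>u\<in>ibox n m. ?k u z w * leval (e u) a b) * (x * y) = ?F * (x * y * (\<Sum>u\<in>ibox n m. ?s (e u)))"
        using S[of id "ibox n m"] by simp
      also have "\<dots> = ?F * (?s p - ?s \<phi> - y * (\<Sum>l<m. ?s (e (int n, int l))) - x * (\<Sum>k<n. ?s (e (int k, int m))))"
        unfolding id by simp
      also have "\<dots> = ?F * ?s p - ?F * ?s \<phi> - (?F * (\<Sum>l<m. ?s (e (int n, int l)))) * y -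
          (?F * (\<Sum>k<n. ?s (e (int k, int m)))) * x"
        by (simp only: right_diff_distrib mult_ac)
      also have "\<dots> = (T1 z w - T2 z w - T3 z w - T4 z w) * (x * y)"
        unfolding T1[symmetric] T2[symmetric] T3[symmetric] T4[symmetric] by (simp only: algebra_simps)
      finally show "(\<Sum>u\<in>ibox n m. ?k u z w * leval (e u) a b) = T1 z w - T2 z w - T3 z w - T4 z w"
        using xy by (simp only: mult_cancel_right) simp
    qed
    also have "\<dots> = dmean T1 - dmean T2 - dmean T3 - dmean T4"
    proof -
      have c12: "continuous_on (circ \<times> circ) (\<lambda>(z, w). T1 z w - T2 z w)"
        using continuous_on_diff[OF c1 c2] by (simp add: case_prod_unfold)
      have c123: "continuous_on (circ \<times> circ) (\<lambda>(z, w). T1 z w - T2 z w - T3 z w)"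
        using continuous_on_diff[OF c12 c3] by (simp add: case_prod_unfold)
      show ?thesis
        by (simp only: dmean_diff[OF c123 c4] dmean_diff[OF c12 c3] dmean_diff[OF c1 c2])
    qed
    finally show ?thesis .
  qed
  ultimately show ?thesis by simp
qed

text \<open>By \<open>corner_reproducing\<close> the weighted expansion of \<open>e u\<close> agrees
  with \<open>e u\<close> on the bidisc, hence identically; pairing with \<open>e v\<close> under
  \<open>L\<close> reads off its coefficients.\<close>

lemma bs_corner:
  assumes u: "u \<in> ibox n m" and v: "v \<in> ibox n m"
  shows "linner (bs p) (e u) (e v) = (if u = v then 1 else 0)"
proof -
  have eu: "e u \<in> mono_span (ibox n m)" using onb_in_span[OF eQ u] .
  define d where "d = (\<Sum>w\<in>ibox n m. lscale (linner (bs p) (e u) (e w)) (e w)) - e u"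
  have "d = 0"
  proof (rule laurent_zero_on_ball)
    show "d \<in> mono_span (ibox n m)"
      unfolding d_def by (intro mono_span_diff mono_span_sum mono_span_lscale onb_in_span[OF eQ] u)
    show "leval d a b = 0" if "cmod a < 1" "cmod b < 1" for a b
      using corner_reproducing[OF eu that] by (simp add: d_def leval_diff leval_sum)
  qed
  then have "linner L (e u) (e v) = linner L (\<Sum>w\<in>ibox n m. lscale (linner (bs p) (e u) (e w)) (e w)) (e v)"
    by (simp add: d_def)
  also have "\<dots> = (\<Sum>w\<in>ibox n m. if w = v then linner (bs p) (e u) (e w) else 0)"
    unfolding inn_sum_left
    by (rule sum.cong) (auto simp: inn_lscale_left onb_inn[OF eQ _ v])
  finally show ?thesis
    using v onb_inn[OF eQ u v] by simp
qed

lemma bs_top: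
  assumes "l < m"
  shows "g \<in> mono_span (ibox n m) \<Longrightarrow> linner (bs p) g (e (int n, int l)) = 0"
    and "k < m \<Longrightarrow> linner (bs p) (e (int n, int k)) (e (int n, int l)) = (if k = l then 1 else 0)"
  using side_stable.bs_f_Q[OF side_stable_L _ assms, of g 0]
    side_stable.bs_f_inn[OF side_stable_L _ assms, of k 0] by simp_all

lemma bs_linner_swap: "linner (bs (swapl p)) (swapl f) (swapl g) = linner (bs p) f g"
  by (simp add: linner_def swapl_dagger[symmetric] swapl_mult[symmetric] B.bs_swap)

lemma bs_right:
  assumes "l < n"
  shows "g \<in> mono_span (ibox n m) \<Longrightarrow> linner (bs p) g (e (int l, int m)) = 0"
    and "k < n \<Longrightarrow> linner (bs p) (e (int k, int m)) (e (int l, int m)) = (if k = l then 1 else 0)"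
  using side_stable.bs_f_Q[OF side_stable_swap _ assms, of "swapl g" 0] swapl_in_span[of g "ibox n m"]
    side_stable.bs_f_inn[OF side_stable_swap _ assms, of k 0]
  by (simp_all add: bs_linner_swap swap_box)

text \<open>The argument for the converse implication, applied to the weighted inner product of the
  stable \<open>p\<close> just constructed.\<close>

lemma bs_top_right:
  assumes l: "l < m" and k: "k < n"
  shows "linner (bs p) (e (int n, int l)) (e (int k, int m)) = 0"
proof (rule B.row_column_orthogonal)
  show "e (int n, int l) \<in> mono_span (ibox (n + 1) m)"
    using l by (intro onb_in_span[OF eP]) (simp add: ibox_def)
  show "e (int k, int m) \<in> mono_span (ibox n (m + 1))"
    using k by (intro onb_in_span[OF eR]) (simp add: ibox_def)
  show "linner (bs p) (e (int k, int m)) (lmono i j) = 0" if "(i, j) \<in> ibox n m" for i j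
    using bs_right(1)[OF k lmono_in_span[OF that]] B.inn_cnj[of "e (int k, int m)" "lmono i j"] by simp
qed

text \<open>\<open>dagger \<phi>\<close> is \<open>p\<close> divided by
  \<open>z\<^sup>n w\<^sup>m\<close>, and this division makes all \<open>z\<close>-exponents or all
  \<open>w\<close>-exponents of \<open>g\<close> negative.\<close>

lemma bs_corner_phi:
  assumes "g \<in> mono_span (ibox (n + 1) m) \<or> g \<in> mono_span (ibox n (m + 1))"
  shows "linner (bs p) g \<phi> = 0"
proof -
  have "dagger \<phi> = lmono (- int n) (- int m) * p"
    by (simp add: reversed_def mult.assoc[symmetric] lmono_mult)
  then have "linner (bs p) g \<phi> = bs p (p * (lmono (- int n) (- int m) * g))"
    by (simp add: linner_def ac_simps)
  also have "\<dots> = 0"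
    by (rule B.bs_p_zero) (use assms in \<open>force simp: supp_lmono_mult mono_span_eq ibox_def\<close>)
  finally show ?thesis .
qed

lemma bs_phi_phi: "linner (bs p) \<phi> \<phi> = 1"
proof -
  have "\<phi> = reversed n m p" by simp
  then have "linner (bs p) \<phi> \<phi> = linner (bs p) p p"
    using B.inn_rev[of n m p p] by simp
  then show ?thesis
    using B.bs_p_dagger_p[of 1] by (simp add: linner_def flip: zero_prod_def)
qed

lemma bs_onb:
  assumes u: "u \<in> ibox (n + 1) (m + 1)" and v: "v \<in> ibox (n + 1) (m + 1)"
  shows "linner (bs p) (e u) (e v) = (if u = v then 1 else 0)"
proof -
  have cases: "u \<in> ibox n m \<or> (\<exists>l<m. u = (int n, int l)) \<or> (\<exists>k<n. u = (int k, int m)) \<or> u = (int n, int m)"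
    if u: "u \<in> ibox (n + 1) (m + 1)" for u
  proof -
    obtain i j where "u = (int i, int j)" "i < n + 1" "j < m + 1"
      using u that[of "nat (fst u)" "nat (snd u)"] by (cases u) (auto simp: ibox_def)
    then show ?thesis by (auto simp: ibox_def less_Suc_eq)
  qed
  have Q: "e u \<in> mono_span (ibox n m)" if "u \<in> ibox n m" for u
    using onb_in_span[OF eQ that] .
  have P: "e (int n, int l) \<in> mono_span (ibox (n + 1) m)" if "l < m" for l
    using that by (intro onb_in_span[OF eP]) (simp add: ibox_def)
  have R: "e (int k, int m) \<in> mono_span (ibox n (m + 1))" if "k < n" for k
    using that by (intro onb_in_span[OF eR]) (simp add: ibox_def)
  have half: "linner (bs p) g f = 0" if "linner (bs p) f g = 0" for f g
    using that B.inn_cnj[of g f] by simp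
  have no: "(int n, j) \<notin> ibox n m" "(i, int m) \<notin> ibox n m" for i j
    by (auto simp: ibox_def)
  have \<phi>P: "linner (bs p) (e (int n, int l)) \<phi> = 0" if "l < m" for l
    using P[OF that] by (intro bs_corner_phi) blast
  have \<phi>R: "linner (bs p) (e (int k, int m)) \<phi> = 0" if "k < n" for k
    using R[OF that] by (intro bs_corner_phi) blast
  have \<phi>Q: "linner (bs p) (e u) \<phi> = 0" if "u \<in> ibox n m" for u
    using side.Q_P[OF side_L Q[OF that]] by (intro bs_corner_phi) blast
  from cases[OF u] show ?thesis
  proof (elim disjE exE conjE)
    assume u: "u \<in> ibox n m"
    from cases[OF v] show ?thesis
    proof (elim disjE exE conjE)
      fix l assume "l < m" "v = (int n, int l)"
      then show ?thesis using bs_top(1)[OF _ Q[OF u]] u no by auto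
    next
      fix k assume "k < n" "v = (int k, int m)"
      then show ?thesis using bs_right(1)[OF _ Q[OF u]] u no by auto
    next
      assume "v = (int n, int m)"
      then show ?thesis using \<phi>Q[OF u] u no by auto
    qed (rule bs_corner[OF u])
  next
    fix l assume l: "l < m" and u: "u = (int n, int l)"
    from cases[OF v] show ?thesis
    proof (elim disjE exE conjE)
      assume "v \<in> ibox n m"
      then show ?thesis using half[OF bs_top(1)[OF l Q]] u no by auto
    next
      fix k assume "k < m" "v = (int n, int k)"
      then show ?thesis using bs_top(2)[of k l] l u by simp
    next
      fix k assume "k < n" "v = (int k, int m)"
      then show ?thesis using bs_top_right[OF l, of k] l u by simp
    next
      assume "v = (int n, int m)"
      then show ?thesis using \<phi>P[OF l] l u by simp
    qed
  next
    fix k assume k: "k < n" and u: "u = (int k, int m)"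
    from cases[OF v] show ?thesis
    proof (elim disjE exE conjE)
      assume "v \<in> ibox n m"
      then show ?thesis using half[OF bs_right(1)[OF k Q]] u no by auto
    next
      fix l assume "l < m" "v = (int n, int l)"
      then show ?thesis using half[OF bs_top_right[OF _ k, of l]] k u by simp
    next
      fix l assume "l < n" "v = (int l, int m)"
      then show ?thesis using bs_right(2)[of l k] k u by simp
    next
      assume "v = (int n, int m)"
      then show ?thesis using \<phi>R[OF k] k u by simp
    qed
  next
    assume u: "u = (int n, int m)"
    from cases[OF v] show ?thesis
    proof (elim disjE exE conjE)
      assume "v \<in> ibox n m"
      then show ?thesis using half[OF \<phi>Q] u no by auto
    next
      fix l assume "l < m" "v = (int n, int l)"
      then show ?thesis using half[OF \<phi>P, of l] u by simp
    next
      fix k assume "k < n" "v = (int k, int m)"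
      then show ?thesis using half[OF \<phi>R, of k] u by simp
    next
      assume "v = (int n, int m)"
      then show ?thesis using bs_phi_phi u by simp
    qed
  qed
qed

text \<open>One basis is orthonormal for both inner products.\<close>

theorem bs_eq_L:
  assumes f: "f \<in> mono_span (ibox (n + 1) (m + 1))" and g: "g \<in> mono_span (ibox (n + 1) (m + 1))"
  shows "linner (bs p) f g = linner L f g"
proof -
  let ?E = "ibox (n + 1) (m + 1)"
  let ?f = "\<Sum>u\<in>?E. lscale (linner L f (e u)) (e u)" and ?g = "\<Sum>u\<in>?E. lscale (linner L g (e u)) (e u)"
  have "linner (bs p) ?f ?g = linner L ?f ?g"
    unfolding B.inn_sum_left B.inn_sum_right B.inn_lscale_left B.inn_lscale_right
      inn_sum_left inn_sum_right inn_lscale_left inn_lscale_right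
    by (intro sum.cong refl) (simp add: bs_onb onb_inn[OF eE])
  then show ?thesis
    using onb_expand[OF eE f] onb_expand[OF eE g] by simp
qed

end

section \<open>Globalisation of the functional\<close>

text \<open>Outside the box the moments are set to \<open>0\<close>; this keeps the functional Hermitian.\<close>

definition globalize :: "nat \<Rightarrow> nat \<Rightarrow> (laurent \<Rightarrow> complex) \<Rightarrow> laurent \<Rightarrow> complex" where
  "globalize n m L q = (\<Sum>(i, j)\<in>supp q. coef q (i, j) *
    (if \<bar>i\<bar> \<le> int n \<and> \<bar>j\<bar> \<le> int m then L (lmono i j) else 0))"

lemma globalize_superset:
  assumes "finite A" "supp q \<subseteq> A"
  shows "globalize n m L q = (\<Sum>(i, j)\<in>A. coef q (i, j) *
    (if \<bar>i\<bar> \<le> int n \<and> \<bar>j\<bar> \<le> int m then L (lmono i j) else 0))"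
  unfolding globalize_def
  by (rule sum.mono_neutral_left) (use assms in \<open>auto simp: in_keys_iff\<close>)

lemma globalize_functional:
  assumes "positive_definite n m L"
  shows "laurent_functional (globalize n m L)"
proof
  let ?c = "\<lambda>e. if \<bar>fst e\<bar> \<le> int n \<and> \<bar>snd e\<bar> \<le> int m then L (lmono (fst e) (snd e)) else 0"
  have ex: "globalize n m L q = (\<Sum>e\<in>A. coef q e * ?c e)" if "finite A" "supp q \<subseteq> A" for A q
    unfolding globalize_superset[OF that] by (rule sum.cong) auto
  fix p q c
  show "globalize n m L (p + q) = globalize n m L p + globalize n m L q"
    using keys_add[of p q]
    by (subst (1 2 3) ex[of "supp p \<union> supp q"]) (auto simp: lookup_add ring_distribs sum.distrib)
  show "globalize n m L (lscale c p) = c * globalize n m L p"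
    by (subst (1 2) ex[of "supp p"]) (auto simp: supp_lscale sum_distrib_left mult.assoc)
  have herm: "L (lmono (- i) (- j)) = cnj (L (lmono i j))" if "\<bar>i\<bar> \<le> int n \<and> \<bar>j\<bar> \<le> int m" for i j
    using assms that by (auto simp: positive_definite_def)
  have "globalize n m L (dagger p) = (\<Sum>e\<in>supp (dagger p). coef (dagger p) e * ?c e)"
    by (rule ex) auto
  also have "\<dots> = (\<Sum>e\<in>supp p. coef (dagger p) (- e) * ?c (- e))"
    by (rule sum.reindex_bij_witness[of _ uminus uminus])
      (auto simp: in_keys_iff lookup_dagger)
  also have "\<dots> = (\<Sum>e\<in>supp p. cnj (coef p e * ?c e))"
    by (rule sum.cong) (auto simp: lookup_dagger herm)
  also have "\<dots> = cnj (globalize n m L p)"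
    by (subst ex[of "supp p" p]) (auto simp: cnj_sum)
  finally show "globalize n m L (dagger p) = cnj (globalize n m L p)" .
qed

lemma laurent_space_supp:
  "q \<in> laurent_space n m \<longleftrightarrow> (\<forall>(i, j)\<in>supp q. \<bar>i\<bar> \<le> int n \<and> \<bar>j\<bar> \<le> int m)"
  by (auto simp: laurent_space_def mono_span_eq)

lemma linear_functional_sum:
  assumes L: "linear_functional n m L" and A: "finite A"
    and f: "\<And>x. x \<in> A \<Longrightarrow> f x \<in> laurent_space n m"
  shows "L (\<Sum>x\<in>A. f x) = (\<Sum>x\<in>A. L (f x))"
  using A f
proof (induction A rule: finite_induct)
  case empty
  have z: "0 \<in> laurent_space n m" by (simp add: laurent_space_supp)
  then have "L (0 + 0) = L 0 + L 0" using L by (simp only: linear_functional_def)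
  then show ?case by simp
next
  case (insert a A)
  have "f a \<in> laurent_space n m" "(\<Sum>x\<in>A. f x) \<in> laurent_space n m"
    using insert by (auto simp: laurent_space_def intro: mono_span_sum)
  then have "L (f a + (\<Sum>x\<in>A. f x)) = L (f a) + L (\<Sum>x\<in>A. f x)"
    using L by (simp add: linear_functional_def)
  then show ?case using insert by simp
qed

lemma linear_functional_expand:
  assumes L: "linear_functional n m L" and q: "q \<in> laurent_space n m"
  shows "L q = (\<Sum>(i, j)\<in>supp q. coef q (i, j) * L (lmono i j))"
proof -
  have m: "lmono i j \<in> laurent_space n m" if "(i, j) \<in> supp q" for i j
    using q that by (auto simp: laurent_space_supp lmono_def)
  have ls: "lscale (coef q e) (lmono (fst e) (snd e)) \<in> laurent_space n m" if "e \<in> supp q" for e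
    using m[of "fst e" "snd e"] that by (simp add: laurent_space_def mono_span_lscale)
  have "L q = L (\<Sum>(i, j)\<in>supp q. lscale (coef q (i, j)) (lmono i j))"
    using laurent_expand_on[of "supp q" q] by simp
  also have "\<dots> = (\<Sum>(i, j)\<in>supp q. L (lscale (coef q (i, j)) (lmono i j)))"
    by (simp add: case_prod_unfold linear_functional_sum[OF L _ ls])
  also have "\<dots> = (\<Sum>(i, j)\<in>supp q. coef q (i, j) * L (lmono i j))"
    using L m by (intro sum.cong refl) (auto simp: linear_functional_def)
  finally show ?thesis .
qed

lemma globalize_eq:
  assumes "linear_functional n m L" "q \<in> laurent_space n m"
  shows "globalize n m L q = L q"
  unfolding linear_functional_expand[OF assms] globalize_def
  using assms(2) by (intro sum.cong refl) (auto simp: laurent_space_supp)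

text \<open>Differences of exponents of the box stay where \<open>L\<close> is given, so inner
  products on the box see only given moments.\<close>

lemma mult_dagger_in_laurent_space:
  assumes "f \<in> mono_span (ibox (n + 1) (m + 1))" "g \<in> mono_span (ibox (n + 1) (m + 1))"
  shows "f * dagger g \<in> laurent_space n m"
  unfolding laurent_space_supp
proof (clarify)
  fix i j assume "(i, j) \<in> supp (f * dagger g)"
  then obtain i1 j1 i2 j2 where *: "(i1, j1) \<in> supp f" "(i2, j2) \<in> supp (dagger g)" "i = i1 + i2" "j = j1 + j2"
    by (rule supp_multE)
  then have "(- i2, - j2) \<in> supp g" by (auto simp: supp_dagger)
  with * assms show "\<bar>i\<bar> \<le> int n \<and> \<bar>j\<bar> \<le> int m"
    by (fastforce simp: mono_span_eq ibox_def)
qed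

lemma linner_globalize:
  assumes "positive_definite n m L"
    and "f \<in> mono_span (ibox (n + 1) (m + 1))" "g \<in> mono_span (ibox (n + 1) (m + 1))"
  shows "linner (globalize n m L) f g = linner L f g"
  unfolding linner_def using assms mult_dagger_in_laurent_space
  by (intro globalize_eq) (auto simp: positive_definite_def)

lemma poly_space_ibox: "poly_space n m = mono_span (ibox (n + 1) (m + 1))"
  unfolding poly_space_def ibox_def by (rule arg_cong[where f = mono_span]) auto

lemma pd_on_globalize:
  assumes "positive_definite n m L"
  shows "pd_on (globalize n m L) (ibox (n + 1) (m + 1))"
  using assms linner_globalize[OF assms]
  by (auto simp: pd_on_def positive_definite_def poly_space_ibox linner_def)

lemma orthonormal_at_cong:
  assumes "\<And>f g. f \<in> mono_span S \<Longrightarrow> g \<in> mono_span S \<Longrightarrow> linner L f g = linner L' f g"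
  shows "orthonormal_at L S a p \<longleftrightarrow> orthonormal_at L' S a p"
proof (cases "p \<in> mono_span S")
  case True
  have "linner L p (lmono i j) = linner L' p (lmono i j)" if "(i, j) \<in> S" for i j
    using assms[OF True lmono_in_span[OF that]] .
  then have "(\<forall>(i, j)\<in>S - {a}. linner L p (lmono i j) = 0) \<longleftrightarrow> (\<forall>(i, j)\<in>S - {a}. linner L' p (lmono i j) = 0)"
    by (intro ball_cong) auto
  then show ?thesis
    using assms[OF True True] by (simp add: orthonormal_at_def)
qed (simp add: orthonormal_at_def)

lemma lex_set_subset: "a \<le> n \<Longrightarrow> b \<le> m \<Longrightarrow> l \<le> b \<Longrightarrow> lex_set a b l \<subseteq> ibox (a + 1) (b + 1)"
  by (auto simp: lex_set_def ibox_def)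

lemma revlex_set_subset: "a \<le> n \<Longrightarrow> b \<le> m \<Longrightarrow> l \<le> a \<Longrightarrow> revlex_set a b l \<subseteq> ibox (a + 1) (b + 1)"
  by (auto simp: revlex_set_def ibox_def)

lemma ibox_mono: "a \<le> c \<Longrightarrow> b \<le> d \<Longrightarrow> ibox a b \<subseteq> ibox c d"
  by (auto simp: ibox_def)

lemma orthonormal_at_globalize:
  assumes "positive_definite n m L" "S \<subseteq> ibox (n + 1) (m + 1)"
  shows "orthonormal_at L S a p \<longleftrightarrow> orthonormal_at (globalize n m L) S a p"
  using linner_globalize[OF assms(1)] mono_span_mono[OF assms(2)]
  by (intro orthonormal_at_cong) (metis subsetD)

lemma the_orthonormal_at_globalize:
  assumes pd: "positive_definite n m L" and S: "S \<subseteq> ibox (n + 1) (m + 1)" and a: "a \<in> S"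
  shows "orthonormal_at (globalize n m L) S a (THE p. orthonormal_at L S a p)"
  unfolding orthonormal_at_globalize[OF pd S]
  by (rule laurent_functional.the_orthonormal_at[OF globalize_functional[OF pd] _ a])
    (use finite_subset[OF S] pd_on_mono[OF pd_on_globalize[OF pd] S] in auto)

lemma phi_orthonormal:
  assumes pd: "positive_definite n m L" and ab: "a \<le> n" "b \<le> m" "l \<le> b"
  shows "orthonormal_at (globalize n m L) (lex_set a b l) (int a, int l) (phi L a b l)"
  unfolding phi_def using ab
  by (intro the_orthonormal_at_globalize[OF pd] order_trans[OF lex_set_subset ibox_mono])
    (auto simp: lex_set_def)

lemma phi_tilde_orthonormal:
  assumes pd: "positive_definite n m L" and ab: "a \<le> n" "b \<le> m" "l \<le> a"
  shows "orthonormal_at (globalize n m L) (revlex_set a b l) (int l, int b) (phi_tilde L a b l)"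
  unfolding phi_tilde_def using ab
  by (intro the_orthonormal_at_globalize[OF pd] order_trans[OF revlex_set_subset ibox_mono])
    (auto simp: revlex_set_def)

section \<open>The matrix of mixed inner products\<close>

lemma Kmat_dim:
  assumes "1 \<le> n" "1 \<le> m"
  shows "dim_row (Kmat L n m) = m" "dim_col (Kmat L n m) = n"
  using assms by (simp_all add: Kmat_def inner_mat_def dagger_mat_def Phi_def Phi_tilde_def)

lemma Kmat_entry:
  assumes "1 \<le> n" "1 \<le> m" "r < m" "c < n"
  shows "Kmat L n m $$ (r, c) = linner L (phi L n (m - 1) (m - 1 - r)) (phi_tilde L (n - 1) m (n - 1 - c))"
  using assms
  by (simp add: Kmat_def inner_mat_def dagger_mat_def Phi_def Phi_tilde_def linner_def scalar_prod_def
      times_mat_def Matrix.row_def col_def)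

lemma Kmat_zero_iff:
  assumes "1 \<le> n" "1 \<le> m"
  shows "Kmat L n m = 0\<^sub>m m n \<longleftrightarrow>
    (\<forall>l<m. \<forall>k<n. linner L (phi L n (m - 1) l) (phi_tilde L (n - 1) m k) = 0)"
proof
  assume K: "Kmat L n m = 0\<^sub>m m n"
  show "\<forall>l<m. \<forall>k<n. linner L (phi L n (m - 1) l) (phi_tilde L (n - 1) m k) = 0"
  proof (intro allI impI)
    fix l k assume lk: "l < m" "k < n"
    then show "linner L (phi L n (m - 1) l) (phi_tilde L (n - 1) m k) = 0"
      using Kmat_entry[OF assms, of "m - 1 - l" "n - 1 - k" L] by (simp add: K)
  qed
next
  assume z: "\<forall>l<m. \<forall>k<n. linner L (phi L n (m - 1) l) (phi_tilde L (n - 1) m k) = 0"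
  show "Kmat L n m = 0\<^sub>m m n"
    by (rule eq_matI) (use assms z in \<open>auto simp: Kmat_dim Kmat_entry\<close>)
qed

section \<open>Bases adapted to the box\<close>

lemma onb_cong:
  assumes "onb L S I e" "\<And>u. u \<in> I \<Longrightarrow> e u = e' u"
  shows "onb L S I e'"
  using assms(1) unfolding onb_def
  by (simp add: assms(2) cong: ball_cong sum.cong)

context laurent_functional
begin

text \<open>Adjoins the exponents \<open>a 0\<close>, \<open>a 1\<close>, ... one at a time, as the
  two lexicographic orders prescribe.\<close>

lemma onb_chain:
  assumes e: "onb L S S e" and inj: "inj_on a {..<k}" and new: "\<And>i. i < k \<Longrightarrow> a i \<notin> S"
    and orth: "\<And>i. i < k \<Longrightarrow> orthonormal_at L (S \<union> a ` {..<Suc i}) (a i) (e (a i))"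
  shows "onb L (S \<union> a ` {..<k}) (S \<union> a ` {..<k}) e"
  using inj new orth
proof (induction k)
  case 0
  then show ?case using e by simp
next
  case (Suc k)
  have IH: "onb L (S \<union> a ` {..<k}) (S \<union> a ` {..<k}) e"
    using Suc.prems by (intro Suc.IH) (auto simp: inj_on_def)
  have ins: "insert (a k) (S \<union> a ` {..<k}) = S \<union> a ` {..<Suc k}"
    by (auto simp: lessThan_Suc)
  have "a k \<notin> S \<union> a ` {..<k}"
    using Suc.prems(2)[of k] inj_onD[OF Suc.prems(1), of k] by force
  from onb_insert[OF IH this, unfolded ins, OF Suc.prems(3)[OF lessI]]
  show ?case by simp
qed

text \<open>Split an element by support into a part over \<open>S\<close> and a part over
  \<open>T\<close>; each has its own expansion, and by orthogonality the remaining basis elements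
  add nothing.\<close>

lemma onb_union:
  assumes S: "onb L S S e" and T: "onb L T T e"
    and orth: "\<And>u v. u \<in> S - T \<Longrightarrow> v \<in> T - S \<Longrightarrow> inn (e u) (e v) = 0"
  shows "onb L (S \<union> T) (S \<union> T) e"
  unfolding onb_def
proof (intro conjI ballI)
  have orth': "inn (e v) (e u) = 0" if "u \<in> S - T" "v \<in> T - S" for u v
    using orth[OF that] inn_cnj[of "e v" "e u"] by simp
  have fin: "finite S" "finite T" using onb_finite[OF S] onb_finite[OF T] by auto
  then show "finite (S \<union> T)" by simp
  show inn: "inn (e u) (e v) = (if u = v then 1 else 0)" if "u \<in> S \<union> T" "v \<in> S \<union> T" for u v
    using that onb_inn[OF S, of u v] onb_inn[OF T, of u v] orth[of u v] orth'[of v u]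
    by (cases "u \<in> S"; cases "u \<in> T"; cases "v \<in> S"; cases "v \<in> T") auto
  have "mono_span S \<subseteq> mono_span (S \<union> T)" "mono_span T \<subseteq> mono_span (S \<union> T)"
    by (auto intro!: mono_span_mono)
  then show "e u \<in> mono_span (S \<union> T)" if "u \<in> S \<union> T" for u
    using that onb_in_span[OF S, of u] onb_in_span[OF T, of u] by blast
  let ?X = "\<lambda>f. \<Sum>u\<in>S \<union> T. lscale (inn f (e u)) (e u)"
  have part: "f = ?X f" if U: "U = S \<or> U = T" and f: "f \<in> mono_span U" for U f
  proof -
    have e: "onb L U U e" "U \<subseteq> S \<union> T" using U S T by auto
    have "inn f (e v) = 0" if v: "v \<in> S \<union> T - U" for v
    proof -
      have "inn (e v) f = 0"
        by (rule onb_orthogonal[OF e(1) f]) (use v e(2) in \<open>subst inn; auto\<close>)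
      then show ?thesis using inn_cnj[of f "e v"] by simp
    qed
    then have "?X f = (\<Sum>u\<in>U. lscale (inn f (e u)) (e u))"
      using e(2) fin by (intro sum.mono_neutral_right) (auto simp: lscale_def)
    then show ?thesis using onb_expand[OF e(1) f] by simp
  qed
  fix f assume f: "f \<in> mono_span (S \<union> T)"
  let ?g = "lrestrict S f" and ?h = "lrestrict (- S) f"
  have g: "?g \<in> mono_span S" and h: "?h \<in> mono_span T"
    using f by (auto simp: mono_span_eq supp_lrestrict)
  have "f = ?g + ?h" by (rule lrestrict_split)
  also have "\<dots> = ?X ?g + ?X ?h"
    using part[OF _ g] part[OF _ h] by simp
  also have "\<dots> = ?X (?g + ?h)"
    by (simp add: inn_add_left sum.distrib[symmetric]) (simp add: lscale_def single_add distrib_right)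
  finally show "f = ?X f"
    using lrestrict_split[of f S] by simp
qed

end

text \<open>Any orthonormal basis of \<open>Q\<close> is extended by the
  \<open>phi L n (m - 1) l\<close> to \<open>P\<close> and by the
  \<open>phi_tilde L (n - 1) m k\<close> to \<open>R\<close>. \<open>K = 0\<close> allows the two to
  be united, and \<open>phi L n m m\<close> completes \<open>E\<close>.\<close>

lemma config_exists:
  assumes n: "1 \<le> n" and m: "1 \<le> m" and pd: "positive_definite n m L"
    and K: "Kmat L n m = 0\<^sub>m m n"
  shows "\<exists>e. config (globalize n m L) n m e \<and> e (int n, int m) = phi L n m m"
proof -
  let ?L = "globalize n m L"
  interpret laurent_functional ?L by (rule globalize_functional[OF pd])
  have pdE: "pd_on ?L (ibox (n + 1) (m + 1))" by (rule pd_on_globalize[OF pd])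
  have "ibox n m \<subseteq> ibox (n + 1) (m + 1)" by (auto simp: ibox_def)
  from onb_exists[OF finite_ibox pd_on_mono[OF pdE this]]
  obtain e0 where e0: "onb ?L (ibox n m) (ibox n m) e0" by blast
  define e where "e u = (if u \<in> ibox n m then e0 u
    else if fst u = int n \<and> snd u < int m then phi L n (m - 1) (nat (snd u))
    else if fst u < int n then phi_tilde L (n - 1) m (nat (fst u)) else phi L n m m)" for u
  have eQ: "onb ?L (ibox n m) (ibox n m) e"
    by (rule onb_cong[OF e0]) (simp add: e_def)
  have et: "e (int n, int l) = phi L n (m - 1) l" if "l < m" for l
    using that by (simp add: e_def ibox_def)
  have er: "e (int k, int m) = phi_tilde L (n - 1) m k" if "k < n" for k
    using that by (simp add: e_def ibox_def)
  have ec: "e (int n, int m) = phi L n m m"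
    by (simp add: e_def ibox_def)
  \<comment> \<open>The lexicographic order exhausts \<open>Q\<close> before it enters column
    \<open>n\<close>; likewise the reverse order for row \<open>m\<close> below.\<close>
  have P: "ibox n m \<union> (\<lambda>l. (int n, int l)) ` {..<Suc l} = lex_set n (m - 1) l" if "l < m" for l
  proof (intro equalityI subsetI)
    fix u assume "u \<in> lex_set n (m - 1) l"
    then have "u \<in> ibox n m \<or> u = (int n, int (nat (snd u))) \<and> nat (snd u) < Suc l"
      using m by (auto simp: ibox_def lex_set_def)
    then show "u \<in> ibox n m \<union> (\<lambda>l. (int n, int l)) ` {..<Suc l}" by blast
  qed (use m that in \<open>auto simp: ibox_def lex_set_def\<close>)
  have R: "ibox n m \<union> (\<lambda>k. (int k, int m)) ` {..<Suc k} = revlex_set (n - 1) m k" if "k < n" for k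
  proof (intro equalityI subsetI)
    fix u assume "u \<in> revlex_set (n - 1) m k"
    then have "u \<in> ibox n m \<or> u = (int (nat (fst u)), int m) \<and> nat (fst u) < Suc k"
      using n by (auto simp: ibox_def revlex_set_def)
    then show "u \<in> ibox n m \<union> (\<lambda>k. (int k, int m)) ` {..<Suc k}" by blast
  qed (use n that in \<open>auto simp: ibox_def revlex_set_def\<close>)
  have P': "ibox n m \<union> (\<lambda>l. (int n, int l)) ` {..<m} = ibox (n + 1) m"
  proof -
    have "lex_set n (m - 1) (m - 1) = ibox (n + 1) m"
      using m by (auto simp: lex_set_def ibox_def)
    then show ?thesis using P[of "m - 1"] m by simp
  qed
  have R': "ibox n m \<union> (\<lambda>k. (int k, int m)) ` {..<n} = ibox n (m + 1)"
  proof -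
    have "revlex_set (n - 1) m (n - 1) = ibox n (m + 1)"
      using n by (auto simp: revlex_set_def ibox_def)
    then show ?thesis using R[of "n - 1"] n by simp
  qed
  have "onb ?L (ibox n m \<union> (\<lambda>l. (int n, int l)) ` {..<m}) (ibox n m \<union> (\<lambda>l. (int n, int l)) ` {..<m}) e"
  proof (rule onb_chain[OF eQ])
    fix l assume l: "l < m"
    show "orthonormal_at ?L (ibox n m \<union> (\<lambda>l. (int n, int l)) ` {..<Suc l}) (int n, int l) (e (int n, int l))"
      unfolding P[OF l] et[OF l] by (rule phi_orthonormal[OF pd]) (use l in auto)
  qed (auto simp: inj_on_def ibox_def)
  then have eP: "onb ?L (ibox (n + 1) m) (ibox (n + 1) m) e" unfolding P' .
  have "onb ?L (ibox n m \<union> (\<lambda>k. (int k, int m)) ` {..<n}) (ibox n m \<union> (\<lambda>k. (int k, int m)) ` {..<n}) e"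
  proof (rule onb_chain[OF eQ])
    fix k assume k: "k < n"
    show "orthonormal_at ?L (ibox n m \<union> (\<lambda>k. (int k, int m)) ` {..<Suc k}) (int k, int m) (e (int k, int m))"
      unfolding R[OF k] er[OF k] by (rule phi_tilde_orthonormal[OF pd]) (use k in auto)
  qed (auto simp: inj_on_def ibox_def)
  then have eR: "onb ?L (ibox n (m + 1)) (ibox n (m + 1)) e" unfolding R' .
  have sub: "ibox (n + 1) m \<subseteq> ibox (n + 1) (m + 1)" "ibox n (m + 1) \<subseteq> ibox (n + 1) (m + 1)"
    by (auto simp: ibox_def)
  have "onb ?L (ibox (n + 1) m \<union> ibox n (m + 1)) (ibox (n + 1) m \<union> ibox n (m + 1)) e"
  proof (rule onb_union[OF eP eR])
    fix u v assume "u \<in> ibox (n + 1) m - ibox n (m + 1)" "v \<in> ibox n (m + 1) - ibox (n + 1) m"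
    then have "u = (int n, int (nat (snd u)))" "nat (snd u) < m" "v = (int (nat (fst v)), int m)" "nat (fst v) < n"
      by (auto simp: ibox_def)
    then obtain l k where uv: "u = (int n, int l)" "l < m" "v = (int k, int m)" "k < n" by blast
    have "e u \<in> mono_span (ibox (n + 1) (m + 1))" "e v \<in> mono_span (ibox (n + 1) (m + 1))"
      using onb_in_span[OF eP, of u] onb_in_span[OF eR, of v] mono_span_mono[OF sub(1)] mono_span_mono[OF sub(2)] uv
      by (auto simp: ibox_def)
    then have "inn (e u) (e v) = linner L (e u) (e v)" by (rule linner_globalize[OF pd])
    then show "inn (e u) (e v) = 0"
      using K uv unfolding Kmat_zero_iff[OF n m] by (simp add: et er)
  qed
  moreover have "(int n, int m) \<notin> ibox (n + 1) m \<union> ibox n (m + 1)" by (auto simp: ibox_def)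
  moreover have E: "insert (int n, int m) (ibox (n + 1) m \<union> ibox n (m + 1)) = lex_set n m m"
    and E': "lex_set n m m = ibox (n + 1) (m + 1)"
    by (auto simp: ibox_def lex_set_def)
  ultimately have "onb ?L (lex_set n m m) (lex_set n m m) (e((int n, int m) := phi L n m m))"
    using onb_insert[of "ibox (n + 1) m \<union> ibox n (m + 1)" e "(int n, int m)" "phi L n m m"]
      phi_orthonormal[OF pd, of n m m] by simp
  then have eE: "onb ?L (ibox (n + 1) (m + 1)) (ibox (n + 1) (m + 1)) e"
    unfolding E' by (rule onb_cong) (simp add: ec)
  have "config ?L n m e"
    using n m eQ eP eR eE pdE by unfold_locales
  with ec show ?thesis by blast
qed

section \<open>The Bernstein-Szego representation and the vanishing of the mixed inner
  products\<close>

lemma bs_reversed: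
  assumes "stable_poly (reversed n m q)" "is_poly (reversed n m q)"
  shows "torus_nonzero q" "bs q = bs (reversed n m q)"
proof -
  have r: "cmod (leval (reversed n m q) z w) = cmod (leval q z w)" if "cmod z = 1" "cmod w = 1" for z w
    using that by (simp add: reversed_def leval_mult_torus leval_dagger_torus leval_lmono norm_mult norm_power)
  interpret stable_polynomial "reversed n m q"
    using assms by unfold_locales
  show "torus_nonzero q"
  proof
    fix z w :: complex assume zw: "cmod z = 1" "cmod w = 1"
    show "leval q z w \<noteq> 0" using nz[OF zw] r[OF zw] by auto
  qed
  show "bs q = bs (reversed n m q)"
    unfolding bs_def fun_eq_iff by (intro allI cmean_cong) (simp add: r)
qed

theorem theorem7p2:
  fixes n m :: nat and L :: "laurent \<Rightarrow> complex"
  assumes "1 \<le> n" and "1 \<le> m" and "positive_definite n m L"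
  shows "(Kmat L n m = 0\<^sub>m m n \<longrightarrow>
      stable_poly (reversed n m (phi L n m m)) \<and>
      (\<forall>k l. \<bar>k\<bar> \<le> int n \<and> \<bar>l\<bar> \<le> int m \<longrightarrow>
        L (lmono (- k) (- l)) = bernstein_szego_moment (phi L n m m) k l)) \<and>
    (\<forall>p. has_degree p n m \<and> stable_poly (reversed n m p) \<and>
      (\<forall>k l. \<bar>k\<bar> \<le> int n \<and> \<bar>l\<bar> \<le> int m \<longrightarrow>
        L (lmono (- k) (- l)) = bernstein_szego_moment p k l) \<longrightarrow>
      Kmat L n m = 0\<^sub>m m n)"
proof (intro conjI impI allI; (elim conjE)?)
  note pd = assms(3)
  let ?L = "globalize n m L" and ?\<phi> = "phi L n m m"
  have lin: "linear_functional n m L" using pd by (simp add: positive_definite_def)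
  {
    assume K: "Kmat L n m = 0\<^sub>m m n"
    obtain e where e: "config ?L n m e" "e (int n, int m) = ?\<phi>"
      using config_exists[OF assms K] by blast
    interpret config ?L n m e by (rule e(1))
    have st: "stable_poly (reversed n m ?\<phi>)"
      using stable_p by (simp add: e(2))
    then show "stable_poly (reversed n m ?\<phi>)" .
    have ip: "is_poly (reversed n m ?\<phi>)"
      using is_poly_box[OF p_span] by (simp add: e(2))
    fix k l :: int assume kl: "\<bar>k\<bar> \<le> int n" "\<bar>l\<bar> \<le> int m"
    \<comment> \<open>Writes \<open>z\<^sup>-\<^sup>k w\<^sup>-\<^sup>l\<close> as a monomial of the
      box times the \<open>dagger\<close> of another; the maximum keeps all four exponents
      nonnegative.\<close>
    define a b where "a = max 0 (- k)" and "b = max 0 (- l)"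
    have 1: "lmono a b \<in> mono_span (ibox (n + 1) (m + 1))" "lmono (a + k) (b + l) \<in> mono_span (ibox (n + 1) (m + 1))"
      using kl by (auto intro!: lmono_in_span simp: ibox_def a_def b_def)
    have 2: "lmono a b * dagger (lmono (a + k) (b + l)) = lmono (- k) (- l)"
      by (simp add: lmono_mult)
    have "L (lmono (- k) (- l)) = linner L (lmono a b) (lmono (a + k) (b + l))"
      by (simp only: linner_def 2)
    also have "\<dots> = linner (bs (reversed n m ?\<phi>)) (lmono a b) (lmono (a + k) (b + l))"
      using bs_eq_L[OF 1] linner_globalize[OF pd 1] by (simp add: e(2))
    also have "\<dots> = bs (reversed n m ?\<phi>) (lmono (- k) (- l))"
      by (simp only: linner_def 2)
    also have "\<dots> = bernstein_szego_moment ?\<phi> k l"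
      using torus_nonzero.bernstein_szego_moment_eq[OF bs_reversed(1)[OF st ip]] bs_reversed(2)[OF st ip] by simp
    finally show "L (lmono (- k) (- l)) = bernstein_szego_moment ?\<phi> k l" .
  next
    fix q assume deg: "has_degree q n m" and st: "stable_poly (reversed n m q)"
      and mom: "\<forall>k l. \<bar>k\<bar> \<le> int n \<and> \<bar>l\<bar> \<le> int m \<longrightarrow> L (lmono (- k) (- l)) = bernstein_szego_moment q k l"
    have q: "q \<in> mono_span (ibox (n + 1) (m + 1))"
      using deg by (simp add: has_degree_def poly_space_ibox)
    have r: "reversed n m q \<in> mono_span (ibox (n + 1) (m + 1))"
      by (rule reversed_in_span[OF q]) (auto simp: ibox_def)
    interpret stable_box "reversed n m q" n m
      using st is_poly_box[OF r] r by unfold_locales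
    have moment: "L (lmono i j) = bs (reversed n m q) (lmono i j)" if "\<bar>i\<bar> \<le> int n" "\<bar>j\<bar> \<le> int m" for i j
      using mom[rule_format, of "- i" "- j"] that bs_reversed(2)[OF st poly]
        torus_nonzero.bernstein_szego_moment_eq[OF bs_reversed(1)[OF st poly]] by simp
    have "L s = bs (reversed n m q) s" if s: "s \<in> laurent_space n m" for s
    proof -
      have "linear_functional n m (bs (reversed n m q))"
        by (simp add: linear_functional_def L_add L_lscale)
      from linear_functional_expand[OF this s] linear_functional_expand[OF lin s] show ?thesis
        using s moment by (auto simp: laurent_space_supp intro!: sum.cong)
    qed
    then have Lb: "linner L f g = linner (bs (reversed n m q)) f g"
      if "f \<in> mono_span (ibox (n + 1) (m + 1))" "g \<in> mono_span (ibox (n + 1) (m + 1))" for f g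
      using mult_dagger_in_laurent_space[OF that] by (simp add: linner_def)
    have "linner L (phi L n (m - 1) l) (phi_tilde L (n - 1) m k) = 0" if lk: "l < m" "k < n" for l k
    proof -
      let ?f = "phi L n (m - 1) l" and ?x = "phi_tilde L (n - 1) m k"
      have of: "orthonormal_at ?L (lex_set n (m - 1) l) (int n, int l) ?f"
        by (rule phi_orthonormal[OF pd]) (use lk in auto)
      have ox: "orthonormal_at ?L (revlex_set (n - 1) m k) (int k, int m) ?x"
        by (rule phi_tilde_orthonormal[OF pd]) (use lk in auto)
      have "lex_set n (m - 1) l \<subseteq> ibox (n + 1) m" "revlex_set (n - 1) m k \<subseteq> ibox n (m + 1)"
        using lk by (auto simp: lex_set_def revlex_set_def ibox_def)
      then have f: "?f \<in> mono_span (ibox (n + 1) m)" and x: "?x \<in> mono_span (ibox n (m + 1))"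
        using of ox mono_span_mono unfolding orthonormal_at_def by blast+
      have sub: "ibox (n + 1) m \<subseteq> ibox (n + 1) (m + 1)" "ibox n (m + 1) \<subseteq> ibox (n + 1) (m + 1)"
        "ibox n m \<subseteq> ibox (n + 1) (m + 1)"
        by (auto simp: ibox_def)
      note in_E = subsetD[OF mono_span_mono[OF sub(1)] f] subsetD[OF mono_span_mono[OF sub(2)] x]
      \<comment> \<open>\<open>?f\<close> lies in \<open>P\<close>, and \<open>?x\<close> lies in
        \<open>R\<close> and is orthogonal to \<open>Q\<close> by its definition; \<open>Lb\<close>
        carries this over to the weighted inner product.\<close>
      have "linner (bs (reversed n m q)) ?f ?x = 0"
      proof (rule row_column_orthogonal[OF f x])
        fix i j assume ij: "(i, j) \<in> ibox n m"
        then have ijE: "lmono i j \<in> mono_span (ibox (n + 1) (m + 1))"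
          using sub(3) by (intro lmono_in_span) blast
        have "(i, j) \<in> revlex_set (n - 1) m k - {(int k, int m)}"
          using ij lk by (auto simp: ibox_def revlex_set_def)
        then have "linner ?L ?x (lmono i j) = 0"
          using ox by (auto simp: orthonormal_at_def)
        then show "linner (bs (reversed n m q)) ?x (lmono i j) = 0"
          using Lb[OF in_E(2) ijE] linner_globalize[OF pd in_E(2) ijE] by simp
      qed
      then show ?thesis using Lb[OF in_E] by simp
    qed
    then show "Kmat L n m = 0\<^sub>m m n"
      unfolding Kmat_zero_iff[OF assms(1,2)] by blast
  }
qed

end
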